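(* Let $(\mathcal{C},\iota,\lambda)$ be a category with conjugation, $(D,\delta)$ a duality on $\mathcal{C}$ and $\alpha$ a commutation between $(\iota,\lambda)$ and $(D,\delta)$. Consider the cyclic sequence (octagon) of hermitian categories and functors \[\mathcal{S}(\mathcal{C},D,\delta)\xrightarrow{\mathcal{S}(\widehat F)}\mathcal{S}(\mathcal{C}',D',\delta')\xrightarrow{\mathcal{S}(\widehat G)}\mathcal{S}(\mathcal{C},\iota D,-\delta_\alpha)\xrightarrow{\mathcal{S}(\check F)}\mathcal{S}(\mathcal{C}',\iota'D',-\delta'_{\alpha'})\xrightarrow{\mathcal{S}(\check G)}\mathcal{S}(\mathcal{C},D,-\delta)\] \[\mathcal{S}(\mathcal{C},D,-\delta)\xrightarrow{\mathcal{S}(\widehat F)}\mathcal{S}(\mathcal{C}',D',-\delta')\xrightarrow{\mathcal{S}(\widehat G)}\mathcal{S}(\mathcal{C},\iota D,\delta_\alpha)\xrightarrow{\mathcal{S}(\check F)}\mathcal{S}(\mathcal{C}',\iota'D',\delta'_{\alpha'})\xrightarrow{\mathcal{S}(\check G)}\mathcal{S}(\mathcal{C},D,\delta).\] Under the composition of any two consecutive functors in this octagon (cyclically, so eight compositions), the image of each category consists of hyperbolic symmetric spaces.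
   Context: Throughout, $k$ is a commutative ring in which $2$ is invertible, $\mathcal{C}$ is an additive $k$-linear category that is pseudo-abelian (every idempotent endomorphism splits), and all functors are $k$-linear. Composition is written by juxtaposition; $1_C$ is the identity of $C$. Conjugations. A conjugation on $\mathcal{C}$ is a pair $(\iota,\lambda)$ where $\iota\colon\mathcal{C}\to\mathcal{C}$ is a covariant functor and $\lambda\colon\iota\iota\Rightarrow\mathrm{Id}_{\mathcal{C}}$ is a natural isomorphism with $\lambda_{\iota(C)}=\iota(\lambda_C)$ for all $C$. The double category $\mathcal{C}'$ has as objects the pairs $(C,f)$ with $f\colon\iota(C)\to C$ an isomorphism with $f\,\iota(f)=\lambda_C$; morphisms $(C,f)\to(E,g)$ are the morphisms $\varphi\colon C\to E$ in $\mathcal{C}$ with $\varphi f=g\,\iota(\varphi)$. It carries the conjugation $\iota'(C,f)=(\iota(C),-\iota(f))$, $\iota'(\varphi)=\iota(\varphi)$, $\lambda'_{(C,f)}=-\lambda_C$. Functors: $F\colon\mathcal{C}\to\mathcal{C}'$, $F(C)=(C\oplus\iota(C),\Lambda_C)$ with $\Lambda_C=\begin{pmatrix}0&\lambda_C\\1_{\iota(C)}&0\end{pmatrix}$, $F(\varphi)=\begin{pmatrix}\varphi&0\\0&\iota(\varphi)\end{pmatrix}$; and $G\colon\mathcal{C}'\to\mathcal{C}$ the forgetful functor $G(C,f)=C$. Dualities. A duality on $\mathcal{C}$ is a pair $(D,\delta)$ of a contravariant functor $D\colon\mathcal{C}\to\mathcal{C}$ and a natural isomorphism $\delta\colon\mathrm{Id}\Rightarrow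 DD$ with $\delta_{D(C)}=D(\delta_C)^{-1}$ for all $C$; then $(D,-\delta)$ is also a duality. A morphism of categories with duality $(\mathcal{C}_1,D_1,\delta_1)\to(\mathcal{C}_2,D_2,\delta_2)$ is a pair $(R,\theta)$ of a covariant functor $R\colon\mathcal{C}_1\to\mathcal{C}_2$ and a natural isomorphism $\theta\colon RD_1\Rightarrow D_2R$ with $\theta_{D_1(C)}R((\delta_1)_C)=D_2(\theta_C)(\delta_2)_{R(C)}$. A commutation between $(\iota,\lambda)$ and $(D,\delta)$ is a natural isomorphism $\alpha\colon\iota D\Rightarrow D\iota$ such that $\alpha_{D(C)}\,\iota(\delta_C)=D(\alpha_C)\,\delta_{\iota(C)}$ and $\alpha_{\iota(C)}^{-1}D(\lambda_C)=\iota(\alpha_C)\,\lambda_{D(C)}^{-1}$ for all $C$. It yields a duality $(\iota D,\delta_\alpha)$ on $\mathcal{C}$ with $(\delta_\alpha)_C=\iota(\alpha_{D(C)})\,\lambda^{-1}_{DD(C)}\,\delta_C$, and a duality $(D',\delta')$ on $\mathcal{C}'$ with $D'(C,f)=(D(C),-D(f)^{-1}\alpha_C)$, $D'(\varphi)=D(\varphi)$, $\delta'_{(C,f)}=\delta_C$, together with a commutation $\alpha'_{(C,f)}=-\alpha_C$ between $(\iota',\lambda')$ and $(D',\delta')$; hence also a duality $(\iota'D',\delta'_{\alpha'})$ on $\mathcal{C}'$. Morphisms of categories with duality: $\widehat F=(F,\widehat\phi)\colon(\mathcal{C},D,\pm\delta)\to(\mathcal{C}',D',\pm\delta')$ with $\widehat\phi_C=\begin{pmatrix}1_{D(C)}&0\\0&-\alpha_C\end{pmatrix}$;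 $\check F=(F,\check\phi)\colon(\mathcal{C},\iota D,\pm\delta_\alpha)\to(\mathcal{C}',\iota'D',\pm\delta'_{\alpha'})$ with $\check\phi_C=\begin{pmatrix}1_{\iota D(C)}&0\\0&\iota(\alpha_C)\end{pmatrix}$; $\widehat G=(G,\widehat\gamma)\colon(\mathcal{C}',D',\pm\delta')\to(\mathcal{C},\iota D,\mp\delta_\alpha)$ with $\widehat\gamma_{(C,f)}=\alpha_C^{-1}D(f)$; $\check G=(G,\check\gamma)\colon(\mathcal{C}',\iota'D',\pm\delta'_{\alpha'})\to(\mathcal{C},D,\pm\delta)$ with $\check\gamma_{(C,f)}=D(f^{-1})\alpha_C$. Symmetric spaces. A symmetric space in a category with duality $(\mathcal{C},D,\delta)$ is a pair $(C,h)$ with $h\colon C\to D(C)$ an isomorphism such that $D(h)\delta_C=h$. An isometry $(C_1,h_1)\to(C_2,h_2)$ is an isomorphism $\varphi\colon C_1\to C_2$ with $D(\varphi)h_2\varphi=h_1$. The hermitian category $\mathcal{S}(\mathcal{C},D,\delta)$ has symmetric spaces as objects and isometries as morphisms. A morphism of categories with duality $\widetilde R=(R,\theta)$ induces a functor $\mathcal{S}(\widetilde R)$ with $\mathcal{S}(\widetilde R)(C,h)=(R(C),\theta_CR(h))$ (and $\varphi\mapsto R(\varphi)$). For an object $L$, $H(L)=\left(L\oplus D(L),\begin{pmatrix}0&1_{D(L)}\\\delta_L&0\end{pmatrix}\right)$; a symmetric space is hyperbolic if it is isometric to $H(L)$ for some object $L$. *)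

theory Defs
  imports "HOL-Algebra.Module"
begin

section \<open>Additive categories linear over a commutative ring\<close>

text \<open>
  Morphism sets \<open>Arr C A B\<close> of different pairs of objects are not required to be disjoint
  (those of the double category below are not), so everything that depends on the source and
  target of a morphism takes them as arguments; only composition is a single operation.
  Values of the operations on arguments outside \<open>Obj C\<close> and \<open>Arr C A B\<close> are irrelevant.
\<close>

record ('o, 'm) cat =
  Obj :: "'o set"
  Arr :: "'o \<Rightarrow> 'o \<Rightarrow> 'm set"
  Comp :: "'m \<Rightarrow> 'm \<Rightarrow> 'm"  (infixr "\<cdot>\<index>" 75)
  Id :: "'o \<Rightarrow> 'm"

text \<open>
  \<open>DSum C A B\<close> is a chosen biproduct of \<open>A\<close> and \<open>B\<close>, with injections \<open>In1\<close>, \<open>In2\<close> and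
  projections \<open>Pr1\<close>, \<open>Pr2\<close>.
\<close>

record ('k, 'o, 'm) addcat = "('o, 'm) cat" +
  hom_add :: "'o \<Rightarrow> 'o \<Rightarrow> 'm \<Rightarrow> 'm \<Rightarrow> 'm"
  hom_zero :: "'o \<Rightarrow> 'o \<Rightarrow> 'm"
  hom_smult :: "'o \<Rightarrow> 'o \<Rightarrow> 'k \<Rightarrow> 'm \<Rightarrow> 'm"
  DSum :: "'o \<Rightarrow> 'o \<Rightarrow> 'o"
  In1 :: "'o \<Rightarrow> 'o \<Rightarrow> 'm"
  In2 :: "'o \<Rightarrow> 'o \<Rightarrow> 'm"
  Pr1 :: "'o \<Rightarrow> 'o \<Rightarrow> 'm"
  Pr2 :: "'o \<Rightarrow> 'o \<Rightarrow> 'm"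

text \<open>
  The fields \<open>mult\<close> and \<open>one\<close> are dummies: the library's record of modules extends that of
  rings, but the locale \<open>module\<close> does not constrain them.
\<close>

definition Hom :: "('k, 'o, 'm) addcat \<Rightarrow> 'o \<Rightarrow> 'o \<Rightarrow> ('k, 'm) module" where
  "Hom C A B = \<lparr>carrier = Arr C A B, mult = (\<lambda>_ _. hom_zero C A B), one = hom_zero C A B,
     zero = hom_zero C A B, add = hom_add C A B, smult = hom_smult C A B\<rparr>"

locale category =
  fixes C :: "('o, 'm, 'z) cat_scheme" (structure)
  assumes Id_arr: "A \<in> Obj C \<Longrightarrow> Id C A \<in> Arr C A A"
    and comp_arr: "\<lbrakk>A \<in> Obj C; B \<in> Obj C; E \<in> Obj C; f \<in> Arr C A B; g \<in> Arr C B E\<rbrakk>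
      \<Longrightarrow> g \<cdot> f \<in> Arr C A E"
    and comp_assoc: "\<lbrakk>A \<in> Obj C; B \<in> Obj C; E \<in> Obj C; P \<in> Obj C;
        f \<in> Arr C A B; g \<in> Arr C B E; h \<in> Arr C E P\<rbrakk> \<Longrightarrow> (h \<cdot> g) \<cdot> f = h \<cdot> (g \<cdot> f)"
    and comp_Id: "\<lbrakk>A \<in> Obj C; B \<in> Obj C; f \<in> Arr C A B\<rbrakk> \<Longrightarrow> f \<cdot> Id C A = f"
    and Id_comp: "\<lbrakk>A \<in> Obj C; B \<in> Obj C; f \<in> Arr C A B\<rbrakk> \<Longrightarrow> Id C B \<cdot> f = f"

definition is_zero_object :: "('k, 'o, 'm) addcat \<Rightarrow> 'o \<Rightarrow> bool" where
  "is_zero_object C Z \<longleftrightarrow> Z \<in> Obj C \<and>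
     (\<forall>A\<in>Obj C. (\<exists>!f. f \<in> Arr C Z A) \<and> (\<exists>!f. f \<in> Arr C A Z))"

locale additive_category = category C + cring k
  for k :: "('k, 'r) ring_scheme" and C :: "('k, 'o, 'm) addcat" (structure) +
  assumes hom_module: "\<lbrakk>A \<in> Obj C; B \<in> Obj C\<rbrakk> \<Longrightarrow> module k (Hom C A B)"
    and comp_add_left: "\<lbrakk>A \<in> Obj C; B \<in> Obj C; E \<in> Obj C;
        f \<in> Arr C A B; g \<in> Arr C B E; h \<in> Arr C B E\<rbrakk>
      \<Longrightarrow> (g \<oplus>\<^bsub>Hom C B E\<^esub> h) \<cdot> f = g \<cdot> f \<oplus>\<^bsub>Hom C A E\<^esub> h \<cdot> f"
    and comp_add_right: "\<lbrakk>A \<in> Obj C; B \<in> Obj C; E \<in> Obj C;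
        f \<in> Arr C A B; g \<in> Arr C A B; h \<in> Arr C B E\<rbrakk>
      \<Longrightarrow> h \<cdot> (f \<oplus>\<^bsub>Hom C A B\<^esub> g) = h \<cdot> f \<oplus>\<^bsub>Hom C A E\<^esub> h \<cdot> g"
    and comp_smult_left: "\<lbrakk>A \<in> Obj C; B \<in> Obj C; E \<in> Obj C; r \<in> carrier k;
        f \<in> Arr C A B; g \<in> Arr C B E\<rbrakk>
      \<Longrightarrow> (r \<odot>\<^bsub>Hom C B E\<^esub> g) \<cdot> f = r \<odot>\<^bsub>Hom C A E\<^esub> (g \<cdot> f)"
    and comp_smult_right: "\<lbrakk>A \<in> Obj C; B \<in> Obj C; E \<in> Obj C; r \<in> carrier k;
        f \<in> Arr C A B; g \<in> Arr C B E\<rbrakk>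
      \<Longrightarrow> g \<cdot> (r \<odot>\<^bsub>Hom C A B\<^esub> f) = r \<odot>\<^bsub>Hom C A E\<^esub> (g \<cdot> f)"
    and zero_object: "\<exists>Z. is_zero_object C Z"
    and DSum_obj: "\<lbrakk>A \<in> Obj C; B \<in> Obj C\<rbrakk> \<Longrightarrow> DSum C A B \<in> Obj C"
    and In1_arr: "\<lbrakk>A \<in> Obj C; B \<in> Obj C\<rbrakk> \<Longrightarrow> In1 C A B \<in> Arr C A (DSum C A B)"
    and In2_arr: "\<lbrakk>A \<in> Obj C; B \<in> Obj C\<rbrakk> \<Longrightarrow> In2 C A B \<in> Arr C B (DSum C A B)"
    and Pr1_arr: "\<lbrakk>A \<in> Obj C; B \<in> Obj C\<rbrakk> \<Longrightarrow> Pr1 C A B \<in> Arr C (DSum C A B) A"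
    and Pr2_arr: "\<lbrakk>A \<in> Obj C; B \<in> Obj C\<rbrakk> \<Longrightarrow> Pr2 C A B \<in> Arr C (DSum C A B) B"
    and Pr1_In1: "\<lbrakk>A \<in> Obj C; B \<in> Obj C\<rbrakk> \<Longrightarrow> Pr1 C A B \<cdot> In1 C A B = Id C A"
    and Pr2_In2: "\<lbrakk>A \<in> Obj C; B \<in> Obj C\<rbrakk> \<Longrightarrow> Pr2 C A B \<cdot> In2 C A B = Id C B"
    and Pr1_In2: "\<lbrakk>A \<in> Obj C; B \<in> Obj C\<rbrakk> \<Longrightarrow> Pr1 C A B \<cdot> In2 C A B = \<zero>\<^bsub>Hom C B A\<^esub>"
    and Pr2_In1: "\<lbrakk>A \<in> Obj C; B \<in> Obj C\<rbrakk> \<Longrightarrow> Pr2 C A B \<cdot> In1 C A B = \<zero>\<^bsub>Hom C A B\<^esub>"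
    and In1_Pr1_In2_Pr2: "\<lbrakk>A \<in> Obj C; B \<in> Obj C\<rbrakk> \<Longrightarrow>
        In1 C A B \<cdot> Pr1 C A B \<oplus>\<^bsub>Hom C (DSum C A B) (DSum C A B)\<^esub> In2 C A B \<cdot> Pr2 C A B
          = Id C (DSum C A B)"

locale pseudo_abelian_category = additive_category k C
  for k :: "('k, 'r) ring_scheme" and C :: "('k, 'o, 'm) addcat" (structure) +
  assumes idempotents_split: "\<lbrakk>A \<in> Obj C; e \<in> Arr C A A; e \<cdot> e = e\<rbrakk> \<Longrightarrow>
    \<exists>B\<in>Obj C. \<exists>r\<in>Arr C A B. \<exists>s\<in>Arr C B A. r \<cdot> s = Id C B \<and> s \<cdot> r = e"

definition is_inverse :: "('o, 'm, 'z) cat_scheme \<Rightarrow> 'o \<Rightarrow> 'o \<Rightarrow> 'm \<Rightarrow> 'm \<Rightarrow> bool" where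
  "is_inverse C A B f g \<longleftrightarrow> g \<in> Arr C B A \<and> g \<cdot>\<^bsub>C\<^esub> f = Id C A \<and> f \<cdot>\<^bsub>C\<^esub> g = Id C B"

definition Isos :: "('o, 'm, 'z) cat_scheme \<Rightarrow> 'o \<Rightarrow> 'o \<Rightarrow> 'm set" where
  "Isos C A B = {f \<in> Arr C A B. \<exists>g. is_inverse C A B f g}"

definition inverse_arr :: "('o, 'm, 'z) cat_scheme \<Rightarrow> 'o \<Rightarrow> 'o \<Rightarrow> 'm \<Rightarrow> 'm" where
  "inverse_arr C A B f = (THE g. is_inverse C A B f g)"

text \<open>
  \<open>matrix C A1 A2 B1 B2 a b c d\<close> is the morphism from \<open>DSum C A1 A2\<close> to \<open>DSum C B1 B2\<close> with
  rows \<open>(a, b)\<close> and \<open>(c, d)\<close>, acting on columns: \<open>a\<close> goes from \<open>A1\<close> to \<open>B1\<close>, \<open>b\<close> from \<open>A2\<close>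
  to \<open>B1\<close>, \<open>c\<close> from \<open>A1\<close> to \<open>B2\<close> and \<open>d\<close> from \<open>A2\<close> to \<open>B2\<close>.
\<close>

definition matrix ::
  "('k, 'o, 'm) addcat \<Rightarrow> 'o \<Rightarrow> 'o \<Rightarrow> 'o \<Rightarrow> 'o \<Rightarrow> 'm \<Rightarrow> 'm \<Rightarrow> 'm \<Rightarrow> 'm \<Rightarrow> 'm" where
  "matrix C A1 A2 B1 B2 a b c d =
     (let H = Hom C (DSum C A1 A2) (DSum C B1 B2) in
       (In1 C B1 B2 \<cdot>\<^bsub>C\<^esub> a \<cdot>\<^bsub>C\<^esub> Pr1 C A1 A2 \<oplus>\<^bsub>H\<^esub> In1 C B1 B2 \<cdot>\<^bsub>C\<^esub> b \<cdot>\<^bsub>C\<^esub> Pr2 C A1 A2) \<oplus>\<^bsub>H\<^esub>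
       (In2 C B1 B2 \<cdot>\<^bsub>C\<^esub> c \<cdot>\<^bsub>C\<^esub> Pr1 C A1 A2 \<oplus>\<^bsub>H\<^esub> In2 C B1 B2 \<cdot>\<^bsub>C\<^esub> d \<cdot>\<^bsub>C\<^esub> Pr2 C A1 A2))"


section \<open>Functors\<close>

text \<open>
  One record serves for covariant and contravariant functors. In \<open>ar R A B f\<close>, the morphism
  \<open>f\<close> goes from \<open>A\<close> to \<open>B\<close>, also when \<open>R\<close> is contravariant.
\<close>

record ('o, 'm, 'p, 'n) func =
  ob :: "'o \<Rightarrow> 'p"
  ar :: "'o \<Rightarrow> 'o \<Rightarrow> 'm \<Rightarrow> 'n"

definition is_functor ::
  "('k, 'r) ring_scheme \<Rightarrow> ('k, 'o, 'm) addcat \<Rightarrow> ('k, 'p, 'n) addcat \<Rightarrow>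
    ('o, 'm, 'p, 'n) func \<Rightarrow> bool" where
  "is_functor k C1 C2 R \<longleftrightarrow>
     (\<forall>A\<in>Obj C1. ob R A \<in> Obj C2 \<and> ar R A A (Id C1 A) = Id C2 (ob R A)) \<and>
     (\<forall>A\<in>Obj C1. \<forall>B\<in>Obj C1. \<forall>E\<in>Obj C1. \<forall>f\<in>Arr C1 A B. \<forall>g\<in>Arr C1 B E.
        ar R A E (g \<cdot>\<^bsub>C1\<^esub> f) = ar R B E g \<cdot>\<^bsub>C2\<^esub> ar R A B f) \<and>
     (\<forall>A\<in>Obj C1. \<forall>B\<in>Obj C1. \<forall>f\<in>Arr C1 A B. ar R A B f \<in> Arr C2 (ob R A) (ob R B)) \<and>
     (\<forall>A\<in>Obj C1. \<forall>B\<in>Obj C1. \<forall>f\<in>Arr C1 A B. \<forall>g\<in>Arr C1 A B.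
        ar R A B (f \<oplus>\<^bsub>Hom C1 A B\<^esub> g) =
          ar R A B f \<oplus>\<^bsub>Hom C2 (ob R A) (ob R B)\<^esub> ar R A B g) \<and>
     (\<forall>A\<in>Obj C1. \<forall>B\<in>Obj C1. \<forall>r\<in>carrier k. \<forall>f\<in>Arr C1 A B.
        ar R A B (r \<odot>\<^bsub>Hom C1 A B\<^esub> f) = r \<odot>\<^bsub>Hom C2 (ob R A) (ob R B)\<^esub> ar R A B f)"

definition is_contrafunctor ::
  "('k, 'r) ring_scheme \<Rightarrow> ('k, 'o, 'm) addcat \<Rightarrow> ('k, 'p, 'n) addcat \<Rightarrow>
    ('o, 'm, 'p, 'n) func \<Rightarrow> bool" where
  "is_contrafunctor k C1 C2 D \<longleftrightarrow>
     (\<forall>A\<in>Obj C1. ob D A \<in> Obj C2 \<and> ar D A A (Id C1 A) = Id C2 (ob D A)) \<and>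
     (\<forall>A\<in>Obj C1. \<forall>B\<in>Obj C1. \<forall>E\<in>Obj C1. \<forall>f\<in>Arr C1 A B. \<forall>g\<in>Arr C1 B E.
        ar D A E (g \<cdot>\<^bsub>C1\<^esub> f) = ar D A B f \<cdot>\<^bsub>C2\<^esub> ar D B E g) \<and>
     (\<forall>A\<in>Obj C1. \<forall>B\<in>Obj C1. \<forall>f\<in>Arr C1 A B. ar D A B f \<in> Arr C2 (ob D B) (ob D A)) \<and>
     (\<forall>A\<in>Obj C1. \<forall>B\<in>Obj C1. \<forall>f\<in>Arr C1 A B. \<forall>g\<in>Arr C1 A B.
        ar D A B (f \<oplus>\<^bsub>Hom C1 A B\<^esub> g) =
          ar D A B f \<oplus>\<^bsub>Hom C2 (ob D B) (ob D A)\<^esub> ar D A B g) \<and>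
     (\<forall>A\<in>Obj C1. \<forall>B\<in>Obj C1. \<forall>r\<in>carrier k. \<forall>f\<in>Arr C1 A B.
        ar D A B (r \<odot>\<^bsub>Hom C1 A B\<^esub> f) = r \<odot>\<^bsub>Hom C2 (ob D B) (ob D A)\<^esub> ar D A B f)"

definition id_func :: "('o, 'm, 'o, 'm) func" where
  "id_func = \<lparr>ob = (\<lambda>A. A), ar = (\<lambda>_ _ f. f)\<rparr>"

text \<open>
  Composition of functors, the inner functor being covariant in \<open>S \<circ>\<^sub>F R\<close> and contravariant
  in \<open>S \<circ>\<^sub>C D\<close>; the outer functor may have either variance.
\<close>

definition func_comp ::
  "('p, 'n, 'q, 'l) func \<Rightarrow> ('o, 'm, 'p, 'n) func \<Rightarrow> ('o, 'm, 'q, 'l) func"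
  (infixl "\<circ>\<^sub>F" 55) where
  "S \<circ>\<^sub>F R = \<lparr>ob = (\<lambda>A. ob S (ob R A)),
     ar = (\<lambda>A B f. ar S (ob R A) (ob R B) (ar R A B f))\<rparr>"

definition func_comp_contra ::
  "('p, 'n, 'q, 'l) func \<Rightarrow> ('o, 'm, 'p, 'n) func \<Rightarrow> ('o, 'm, 'q, 'l) func"
  (infixl "\<circ>\<^sub>C" 55) where
  "S \<circ>\<^sub>C D = \<lparr>ob = (\<lambda>A. ob S (ob D A)),
     ar = (\<lambda>A B f. ar S (ob D B) (ob D A) (ar D A B f))\<rparr>"

definition nat_iso ::
  "('k, 'o, 'm) addcat \<Rightarrow> ('k, 'p, 'n) addcat \<Rightarrow> ('o, 'm, 'p, 'n) func \<Rightarrow>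
    ('o, 'm, 'p, 'n) func \<Rightarrow> ('o \<Rightarrow> 'n) \<Rightarrow> bool" where
  "nat_iso C1 C2 R S \<eta> \<longleftrightarrow>
     (\<forall>A\<in>Obj C1. \<eta> A \<in> Isos C2 (ob R A) (ob S A)) \<and>
     (\<forall>A\<in>Obj C1. \<forall>B\<in>Obj C1. \<forall>f\<in>Arr C1 A B.
        \<eta> B \<cdot>\<^bsub>C2\<^esub> ar R A B f = ar S A B f \<cdot>\<^bsub>C2\<^esub> \<eta> A)"

definition nat_iso_contra ::
  "('k, 'o, 'm) addcat \<Rightarrow> ('k, 'p, 'n) addcat \<Rightarrow> ('o, 'm, 'p, 'n) func \<Rightarrow>
    ('o, 'm, 'p, 'n) func \<Rightarrow> ('o \<Rightarrow> 'n) \<Rightarrow> bool" where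
  "nat_iso_contra C1 C2 R S \<eta> \<longleftrightarrow>
     (\<forall>A\<in>Obj C1. \<eta> A \<in> Isos C2 (ob R A) (ob S A)) \<and>
     (\<forall>A\<in>Obj C1. \<forall>B\<in>Obj C1. \<forall>f\<in>Arr C1 A B.
        \<eta> A \<cdot>\<^bsub>C2\<^esub> ar R A B f = ar S A B f \<cdot>\<^bsub>C2\<^esub> \<eta> B)"

text \<open>
  The canonical isomorphisms along which an additive functor is usually taken to commute
  with direct sums without mention: \<open>sum_split\<close> from \<open>R(A \<oplus> B)\<close> to \<open>R(A) \<oplus> R(B)\<close> for
  covariant \<open>R\<close>, and \<open>sum_join\<close> from \<open>D(A) \<oplus> D(B)\<close> to \<open>D(A \<oplus> B)\<close> for contravariant \<open>D\<close>.
  Every matrix below whose source or target is the value of a functor at a direct sum is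
  composed with one of them.
\<close>

definition sum_split ::
  "('k, 'o, 'm) addcat \<Rightarrow> ('o, 'm, 'o, 'm) func \<Rightarrow> 'o \<Rightarrow> 'o \<Rightarrow> 'm" where
  "sum_split C R A B =
     In1 C (ob R A) (ob R B) \<cdot>\<^bsub>C\<^esub> ar R (DSum C A B) A (Pr1 C A B)
       \<oplus>\<^bsub>Hom C (ob R (DSum C A B)) (DSum C (ob R A) (ob R B))\<^esub>
     In2 C (ob R A) (ob R B) \<cdot>\<^bsub>C\<^esub> ar R (DSum C A B) B (Pr2 C A B)"

definition sum_join ::
  "('k, 'o, 'm) addcat \<Rightarrow> ('o, 'm, 'o, 'm) func \<Rightarrow> 'o \<Rightarrow> 'o \<Rightarrow> 'm" where
  "sum_join C D A B =
     ar D (DSum C A B) A (Pr1 C A B) \<cdot>\<^bsub>C\<^esub> Pr1 C (ob D A) (ob D B)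
       \<oplus>\<^bsub>Hom C (DSum C (ob D A) (ob D B)) (ob D (DSum C A B))\<^esub>
     ar D (DSum C A B) B (Pr2 C A B) \<cdot>\<^bsub>C\<^esub> Pr2 C (ob D A) (ob D B)"


section \<open>Conjugations and the double category\<close>

definition conjugation ::
  "('k, 'r) ring_scheme \<Rightarrow> ('k, 'o, 'm) addcat \<Rightarrow> ('o, 'm, 'o, 'm) func \<Rightarrow>
    ('o \<Rightarrow> 'm) \<Rightarrow> bool" where
  "conjugation k C \<iota> lam \<longleftrightarrow>
     is_functor k C C \<iota> \<and> nat_iso C C (\<iota> \<circ>\<^sub>F \<iota>) id_func lam \<and>
     (\<forall>A\<in>Obj C. lam (ob \<iota> A) = ar \<iota> (ob \<iota> (ob \<iota> A)) A (lam A))"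

text \<open>
  The direct sum of \<open>(A, f)\<close> and \<open>(B, g)\<close> in the double category is \<open>A \<oplus> B\<close> with the
  structure morphism \<open>f \<oplus> g\<close>.
\<close>

definition double_cat ::
  "('k, 'o, 'm) addcat \<Rightarrow> ('o, 'm, 'o, 'm) func \<Rightarrow> ('o \<Rightarrow> 'm) \<Rightarrow>
    ('k, 'o \<times> 'm, 'm) addcat" where
  "double_cat C \<iota> lam =
     \<lparr>Obj = {(A, f). A \<in> Obj C \<and> f \<in> Isos C (ob \<iota> A) A \<and>
               f \<cdot>\<^bsub>C\<^esub> ar \<iota> (ob \<iota> A) A f = lam A},
      Arr = (\<lambda>(A, f) (B, g). {\<phi> \<in> Arr C A B. \<phi> \<cdot>\<^bsub>C\<^esub> f = g \<cdot>\<^bsub>C\<^esub> ar \<iota> A B \<phi>}),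
      Comp = Comp C,
      Id = (\<lambda>(A, f). Id C A),
      hom_add = (\<lambda>(A, f) (B, g). hom_add C A B),
      hom_zero = (\<lambda>(A, f) (B, g). hom_zero C A B),
      hom_smult = (\<lambda>(A, f) (B, g). hom_smult C A B),
      DSum = (\<lambda>(A, f) (B, g). (DSum C A B,
        matrix C (ob \<iota> A) (ob \<iota> B) A B
          f \<zero>\<^bsub>Hom C (ob \<iota> B) A\<^esub> \<zero>\<^bsub>Hom C (ob \<iota> A) B\<^esub> g \<cdot>\<^bsub>C\<^esub> sum_split C \<iota> A B)),
      In1 = (\<lambda>(A, f) (B, g). In1 C A B),
      In2 = (\<lambda>(A, f) (B, g). In2 C A B),
      Pr1 = (\<lambda>(A, f) (B, g). Pr1 C A B),
      Pr2 = (\<lambda>(A, f) (B, g). Pr2 C A B)\<rparr>"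

definition double_conj ::
  "('k, 'o, 'm) addcat \<Rightarrow> ('o, 'm, 'o, 'm) func \<Rightarrow> ('o \<times> 'm, 'm, 'o \<times> 'm, 'm) func" where
  "double_conj C \<iota> =
     \<lparr>ob = (\<lambda>(A, f). (ob \<iota> A,
        \<ominus>\<^bsub>Hom C (ob \<iota> (ob \<iota> A)) (ob \<iota> A)\<^esub> ar \<iota> (ob \<iota> A) A f)),
      ar = (\<lambda>(A, f) (B, g) \<phi>. ar \<iota> A B \<phi>)\<rparr>"

definition double_lam ::
  "('k, 'o, 'm) addcat \<Rightarrow> ('o, 'm, 'o, 'm) func \<Rightarrow> ('o \<Rightarrow> 'm) \<Rightarrow> 'o \<times> 'm \<Rightarrow> 'm" where
  "double_lam C \<iota> lam = (\<lambda>(A, f). \<ominus>\<^bsub>Hom C (ob \<iota> (ob \<iota> A)) A\<^esub> lam A)"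

definition F_func ::
  "('k, 'o, 'm) addcat \<Rightarrow> ('o, 'm, 'o, 'm) func \<Rightarrow> ('o \<Rightarrow> 'm) \<Rightarrow>
    ('o, 'm, 'o \<times> 'm, 'm) func" where
  "F_func C \<iota> lam =
     \<lparr>ob = (\<lambda>A. (DSum C A (ob \<iota> A),
        matrix C (ob \<iota> A) (ob \<iota> (ob \<iota> A)) A (ob \<iota> A)
          \<zero>\<^bsub>Hom C (ob \<iota> A) A\<^esub> (lam A) (Id C (ob \<iota> A)) \<zero>\<^bsub>Hom C (ob \<iota> (ob \<iota> A)) (ob \<iota> A)\<^esub>
        \<cdot>\<^bsub>C\<^esub> sum_split C \<iota> A (ob \<iota> A))),
      ar = (\<lambda>A B \<phi>. matrix C A (ob \<iota> A) B (ob \<iota> B)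
        \<phi> \<zero>\<^bsub>Hom C (ob \<iota> A) B\<^esub> \<zero>\<^bsub>Hom C A (ob \<iota> B)\<^esub> (ar \<iota> A B \<phi>))\<rparr>"

definition G_func :: "('o \<times> 'm, 'm, 'o, 'm) func" where
  "G_func = \<lparr>ob = fst, ar = (\<lambda>_ _ \<phi>. \<phi>)\<rparr>"


section \<open>Dualities and commutations\<close>

definition duality ::
  "('k, 'r) ring_scheme \<Rightarrow> ('k, 'o, 'm) addcat \<Rightarrow> ('o, 'm, 'o, 'm) func \<Rightarrow>
    ('o \<Rightarrow> 'm) \<Rightarrow> bool" where
  "duality k C D \<delta> \<longleftrightarrow>
     is_contrafunctor k C C D \<and> nat_iso C C id_func (D \<circ>\<^sub>C D) \<delta> \<and>
     (\<forall>A\<in>Obj C. \<delta> (ob D A) =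
        inverse_arr C (ob D (ob D (ob D A))) (ob D A) (ar D A (ob D (ob D A)) (\<delta> A)))"

definition neg_bidual ::
  "('k, 'o, 'm) addcat \<Rightarrow> ('o, 'm, 'o, 'm) func \<Rightarrow> ('o \<Rightarrow> 'm) \<Rightarrow> 'o \<Rightarrow> 'm" where
  "neg_bidual C D \<delta> = (\<lambda>A. \<ominus>\<^bsub>Hom C A (ob D (ob D A))\<^esub> \<delta> A)"

definition commutation ::
  "('k, 'o, 'm) addcat \<Rightarrow> ('o, 'm, 'o, 'm) func \<Rightarrow> ('o \<Rightarrow> 'm) \<Rightarrow>
    ('o, 'm, 'o, 'm) func \<Rightarrow> ('o \<Rightarrow> 'm) \<Rightarrow> ('o \<Rightarrow> 'm) \<Rightarrow> bool" where
  "commutation C \<iota> lam D \<delta> \<alpha> \<longleftrightarrow>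
     nat_iso_contra C C (\<iota> \<circ>\<^sub>C D) (D \<circ>\<^sub>F \<iota>) \<alpha> \<and>
     (\<forall>A\<in>Obj C. \<alpha> (ob D A) \<cdot>\<^bsub>C\<^esub> ar \<iota> A (ob D (ob D A)) (\<delta> A) =
        ar D (ob \<iota> (ob D A)) (ob D (ob \<iota> A)) (\<alpha> A) \<cdot>\<^bsub>C\<^esub> \<delta> (ob \<iota> A)) \<and>
     (\<forall>A\<in>Obj C.
        inverse_arr C (ob \<iota> (ob D (ob \<iota> A))) (ob D (ob \<iota> (ob \<iota> A))) (\<alpha> (ob \<iota> A))
          \<cdot>\<^bsub>C\<^esub> ar D (ob \<iota> (ob \<iota> A)) A (lam A) =
        ar \<iota> (ob \<iota> (ob D A)) (ob D (ob \<iota> A)) (\<alpha> A)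
          \<cdot>\<^bsub>C\<^esub> inverse_arr C (ob \<iota> (ob \<iota> (ob D A))) (ob D A) (lam (ob D A)))"

text \<open>The isomorphism \<open>\<delta>\<^sub>\<alpha>\<close> of the duality on \<open>C\<close> with functor \<open>\<iota> \<circ>\<^sub>C D\<close>.\<close>

definition twisted_bidual ::
  "('k, 'o, 'm) addcat \<Rightarrow> ('o, 'm, 'o, 'm) func \<Rightarrow> ('o \<Rightarrow> 'm) \<Rightarrow>
    ('o, 'm, 'o, 'm) func \<Rightarrow> ('o \<Rightarrow> 'm) \<Rightarrow> ('o \<Rightarrow> 'm) \<Rightarrow> 'o \<Rightarrow> 'm" where
  "twisted_bidual C \<iota> lam D \<delta> \<alpha> = (\<lambda>A.
     ar \<iota> (ob \<iota> (ob D (ob D A))) (ob D (ob \<iota> (ob D A))) (\<alpha> (ob D A))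
       \<cdot>\<^bsub>C\<^esub> inverse_arr C (ob \<iota> (ob \<iota> (ob D (ob D A)))) (ob D (ob D A)) (lam (ob D (ob D A)))
       \<cdot>\<^bsub>C\<^esub> \<delta> A)"

definition double_dual ::
  "('k, 'o, 'm) addcat \<Rightarrow> ('o, 'm, 'o, 'm) func \<Rightarrow> ('o, 'm, 'o, 'm) func \<Rightarrow>
    ('o \<Rightarrow> 'm) \<Rightarrow> ('o \<times> 'm, 'm, 'o \<times> 'm, 'm) func" where
  "double_dual C \<iota> D \<alpha> =
     \<lparr>ob = (\<lambda>(A, f). (ob D A,
        \<ominus>\<^bsub>Hom C (ob \<iota> (ob D A)) (ob D A)\<^esub>
          (inverse_arr C (ob D A) (ob D (ob \<iota> A)) (ar D (ob \<iota> A) A f) \<cdot>\<^bsub>C\<^esub> \<alpha> A))),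
      ar = (\<lambda>(A, f) (B, g) \<phi>. ar D A B \<phi>)\<rparr>"

definition double_bidual :: "('o \<Rightarrow> 'm) \<Rightarrow> 'o \<times> 'm \<Rightarrow> 'm" where
  "double_bidual \<delta> = (\<lambda>(A, f). \<delta> A)"

definition double_comm ::
  "('k, 'o, 'm) addcat \<Rightarrow> ('o, 'm, 'o, 'm) func \<Rightarrow> ('o, 'm, 'o, 'm) func \<Rightarrow>
    ('o \<Rightarrow> 'm) \<Rightarrow> 'o \<times> 'm \<Rightarrow> 'm" where
  "double_comm C \<iota> D \<alpha> = (\<lambda>(A, f). \<ominus>\<^bsub>Hom C (ob \<iota> (ob D A)) (ob D (ob \<iota> A))\<^esub> \<alpha> A)"

definition phi_hat ::
  "('k, 'o, 'm) addcat \<Rightarrow> ('o, 'm, 'o, 'm) func \<Rightarrow> ('o, 'm, 'o, 'm) func \<Rightarrow>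
    ('o \<Rightarrow> 'm) \<Rightarrow> 'o \<Rightarrow> 'm" where
  "phi_hat C \<iota> D \<alpha> = (\<lambda>A.
     sum_join C D A (ob \<iota> A) \<cdot>\<^bsub>C\<^esub>
     matrix C (ob D A) (ob \<iota> (ob D A)) (ob D A) (ob D (ob \<iota> A))
       (Id C (ob D A)) \<zero>\<^bsub>Hom C (ob \<iota> (ob D A)) (ob D A)\<^esub>
       \<zero>\<^bsub>Hom C (ob D A) (ob D (ob \<iota> A))\<^esub>
       (\<ominus>\<^bsub>Hom C (ob \<iota> (ob D A)) (ob D (ob \<iota> A))\<^esub> \<alpha> A))"

definition phi_check ::
  "('k, 'o, 'm) addcat \<Rightarrow> ('o, 'm, 'o, 'm) func \<Rightarrow> ('o, 'm, 'o, 'm) func \<Rightarrow>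
    ('o \<Rightarrow> 'm) \<Rightarrow> 'o \<Rightarrow> 'm" where
  "phi_check C \<iota> D \<alpha> = (\<lambda>A.
     sum_join C (\<iota> \<circ>\<^sub>C D) A (ob \<iota> A) \<cdot>\<^bsub>C\<^esub>
     matrix C (ob \<iota> (ob D A)) (ob \<iota> (ob \<iota> (ob D A))) (ob \<iota> (ob D A)) (ob \<iota> (ob D (ob \<iota> A)))
       (Id C (ob \<iota> (ob D A))) \<zero>\<^bsub>Hom C (ob \<iota> (ob \<iota> (ob D A))) (ob \<iota> (ob D A))\<^esub>
       \<zero>\<^bsub>Hom C (ob \<iota> (ob D A)) (ob \<iota> (ob D (ob \<iota> A)))\<^esub>
       (ar \<iota> (ob \<iota> (ob D A)) (ob D (ob \<iota> A)) (\<alpha> A)))"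

definition gamma_hat ::
  "('k, 'o, 'm) addcat \<Rightarrow> ('o, 'm, 'o, 'm) func \<Rightarrow> ('o, 'm, 'o, 'm) func \<Rightarrow>
    ('o \<Rightarrow> 'm) \<Rightarrow> 'o \<times> 'm \<Rightarrow> 'm" where
  "gamma_hat C \<iota> D \<alpha> = (\<lambda>(A, f).
     inverse_arr C (ob \<iota> (ob D A)) (ob D (ob \<iota> A)) (\<alpha> A) \<cdot>\<^bsub>C\<^esub> ar D (ob \<iota> A) A f)"

definition gamma_check ::
  "('k, 'o, 'm) addcat \<Rightarrow> ('o, 'm, 'o, 'm) func \<Rightarrow> ('o, 'm, 'o, 'm) func \<Rightarrow>
    ('o \<Rightarrow> 'm) \<Rightarrow> 'o \<times> 'm \<Rightarrow> 'm" where
  "gamma_check C \<iota> D \<alpha> = (\<lambda>(A, f).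
     ar D A (ob \<iota> A) (inverse_arr C (ob \<iota> A) A f) \<cdot>\<^bsub>C\<^esub> \<alpha> A)"


section \<open>Symmetric spaces\<close>

definition symmetric_space ::
  "('k, 'o, 'm) addcat \<Rightarrow> ('o, 'm, 'o, 'm) func \<Rightarrow> ('o \<Rightarrow> 'm) \<Rightarrow> 'o \<times> 'm \<Rightarrow> bool" where
  "symmetric_space C D \<delta> = (\<lambda>(A, h). A \<in> Obj C \<and> h \<in> Isos C A (ob D A) \<and>
     ar D A (ob D A) h \<cdot>\<^bsub>C\<^esub> \<delta> A = h)"

definition herm_cat ::
  "('k, 'o, 'm) addcat \<Rightarrow> ('o, 'm, 'o, 'm) func \<Rightarrow> ('o \<Rightarrow> 'm) \<Rightarrow> ('o \<times> 'm, 'm) cat" where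
  "herm_cat C D \<delta> =
     \<lparr>Obj = {X. symmetric_space C D \<delta> X},
      Arr = (\<lambda>(A1, h1) (A2, h2). {\<phi> \<in> Isos C A1 A2.
        ar D A1 A2 \<phi> \<cdot>\<^bsub>C\<^esub> h2 \<cdot>\<^bsub>C\<^esub> \<phi> = h1}),
      Comp = Comp C,
      Id = (\<lambda>(A, h). Id C A)\<rparr>"

text \<open>
  The functor between hermitian categories induced by a morphism \<open>(R, \<theta>)\<close> of categories with
  duality from \<open>(C1, D1, \<delta>1)\<close> to \<open>(C2, D2, \<delta>2)\<close>. Apart from \<open>R\<close> and \<open>\<theta>\<close>, it depends only on
  \<open>D1\<close> (which gives the target of \<open>h\<close>) and on the composition of \<open>C2\<close>.
\<close>

definition herm_func ::
  "('o, 'm, 'o, 'm) func \<Rightarrow> ('k, 'p, 'n) addcat \<Rightarrow> ('o, 'm, 'p, 'n) func \<Rightarrow> ('o \<Rightarrow> 'n) \<Rightarrow>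
    ('o \<times> 'm, 'm, 'p \<times> 'n, 'n) func" where
  "herm_func D1 C2 R \<theta> =
     \<lparr>ob = (\<lambda>(A, h). (ob R A, \<theta> A \<cdot>\<^bsub>C2\<^esub> ar R A (ob D1 A) h)),
      ar = (\<lambda>(A1, h1) (A2, h2) \<phi>. ar R A1 A2 \<phi>)\<rparr>"

definition hyperbolic_space ::
  "('k, 'o, 'm) addcat \<Rightarrow> ('o, 'm, 'o, 'm) func \<Rightarrow> ('o \<Rightarrow> 'm) \<Rightarrow> 'o \<Rightarrow> 'o \<times> 'm" where
  "hyperbolic_space C D \<delta> L =
     (DSum C L (ob D L),
      sum_join C D L (ob D L) \<cdot>\<^bsub>C\<^esub>
      matrix C L (ob D L) (ob D L) (ob D (ob D L))
        \<zero>\<^bsub>Hom C L (ob D L)\<^esub> (Id C (ob D L)) (\<delta> L) \<zero>\<^bsub>Hom C (ob D L) (ob D (ob D L))\<^esub>)"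

definition hyperbolic ::
  "('k, 'o, 'm) addcat \<Rightarrow> ('o, 'm, 'o, 'm) func \<Rightarrow> ('o \<Rightarrow> 'm) \<Rightarrow> 'o \<times> 'm \<Rightarrow> bool" where
  "hyperbolic C D \<delta> X \<longleftrightarrow> symmetric_space C D \<delta> X \<and>
     (\<exists>L\<in>Obj C. \<exists>\<phi>. \<phi> \<in> Arr (herm_cat C D \<delta>) X (hyperbolic_space C D \<delta> L))"

end

theory Submission
  imports Defs
begin

text \<open>
  Each of the eight composite functors produces a space with an evident Lagrangian, and the proof
  writes down the resulting isometry with a hyperbolic space \<open>H(L)\<close>.

  A space \<open>(V, b)\<close> is recognised as hyperbolic by giving two components \<open>r: V \<rightarrow> L\<close> and
  \<open>q: V \<rightarrow> D(L)\<close> that identify \<open>V\<close> with \<open>L \<oplus> D(L)\<close> and satisfy \<open>b = D(r) q + D(q) \<delta> r\<close>; this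
  formula says that \<open>b\<close> is the pullback of the hyperbolic form. Symmetry and invertibility of
  \<open>b\<close> are then inherited from \<open>H(L)\<close>, so that it is not necessary to know beforehand that the
  functors of the octagon preserve symmetric spaces (\<open>pullback_of_hyperbolic\<close>).

  Compositions \<open>G F\<close>. The space has underlying object \<open>A \<oplus> \<iota>(A)\<close>. Before the forgetful functor is
  applied, the form is diagonal; the isomorphism attached to \<open>G\<close> contributes the dual of the
  structure morphism \<open>\<Lambda>\<close> of \<open>F(A)\<close> or of its inverse, and \<open>\<Lambda>\<close> interchanges the two summands. The
  outcome is an off-diagonal form, determined by an isomorphism from \<open>\<iota>(A)\<close> to the dual of \<open>A\<close>,
  and such a form is isometric to \<open>H(A)\<close> (\<open>off_diagonal_hyperbolic\<close>).

  Compositions \<open>F G\<close>. Let \<open>(A, f)\<close> be an object of the double category and \<open>b\<^sub>0\<close> the form on \<open>A\<close>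
  produced by \<open>G\<close>. In the coordinates \<open>P = p\<^sub>1\<close> and \<open>Q = f p\<^sub>2\<close> on \<open>A \<oplus> \<iota>(A)\<close>, the form produced
  by \<open>F\<close> is the difference \<open>b\<^sub>0(P, P) - b\<^sub>0(Q, Q)\<close>. As \<open>2\<close> is invertible, the components
  \<open>r = P + Q\<close> and \<open>q = b\<^sub>0 (P - Q) / 2\<close> identify it with \<open>H(A)\<close>. The structure morphism \<open>\<Lambda>\<close>
  interchanges \<open>P\<close> and \<open>Q\<close>, so \<open>P + Q\<close> is a morphism to \<open>(A, f)\<close>, while \<open>P - Q\<close> is a morphism
  to \<open>(A, -f)\<close>; this sign is compensated by \<open>b\<^sub>0\<close>, which commutes with the structure morphisms only
  up to sign. Hence the isometry lies in the double category (\<open>difference_hyperbolic\<close>).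

  What remains is to compute the four forms from the naturality of \<open>\<lambda>\<close>, \<open>\<delta>\<close> and \<open>\<alpha>\<close> and the two
  commutation axioms, and to know that \<open>(\<iota>D, \<delta>\<^sub>\<alpha>)\<close> is a duality (\<open>twisted_duality\<close>). The other four
  compositions are the same four for the duality \<open>(D, -\<delta>)\<close>, for which \<open>\<alpha>\<close> is again a
  commutation (\<open>neg_commutation\<close>).
\<close>

section \<open>Typed arrows\<close>

context additive_category
begin

text \<open>
  A typed arrow \<open>Some (A, B, f)\<close> carries the source and target that \<open>f\<close> alone does not determine;
  \<open>None\<close> is the value of undefined composites and sums. With this value, associativity,
  commutativity and distributivity hold without typing hypotheses and can be used for rewriting.
\<close>

fun valid :: "('o \<times> 'o \<times> 'm) option \<Rightarrow> bool" where
  "valid None = False"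
| "valid (Some (A, B, f)) = (A \<in> Obj C \<and> B \<in> Obj C \<and> f \<in> Arr C A B)"

definition typed :: "'o \<Rightarrow> 'o \<Rightarrow> 'm \<Rightarrow> ('o \<times> 'o \<times> 'm) option" where
  "typed A B f = Some (A, B, f)"

fun src :: "('o \<times> 'o \<times> 'm) option \<Rightarrow> 'o" where
  "src (Some (A, B, f)) = A"

fun tgt :: "('o \<times> 'o \<times> 'm) option \<Rightarrow> 'o" where
  "tgt (Some (A, B, f)) = B"

fun raw :: "('o \<times> 'o \<times> 'm) option \<Rightarrow> 'm" where
  "raw (Some (A, B, f)) = f"

definition mul (infixr "\<star>" 70) where
  "x \<star> y = (if valid x \<and> valid y \<and> src x = tgt y
     then typed (src y) (tgt x) (raw x \<cdot> raw y) else None)"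

definition pls (infixl "\<boxplus>" 65) where
  "x \<boxplus> y = (if valid x \<and> valid y \<and> src x = src y \<and> tgt x = tgt y
     then typed (src x) (tgt x) (raw x \<oplus>\<^bsub>Hom C (src x) (tgt x)\<^esub> raw y) else None)"

definition neg where
  "neg x = (if valid x then typed (src x) (tgt x) (\<ominus>\<^bsub>Hom C (src x) (tgt x)\<^esub> raw x) else None)"

definition scal where
  "scal c x = (if valid x then typed (src x) (tgt x) (c \<odot>\<^bsub>Hom C (src x) (tgt x)\<^esub> raw x) else None)"

definition ident where
  "ident A = typed A A (Id C A)"

definition nil where
  "nil A B = typed A B (\<zero>\<^bsub>Hom C A B\<^esub>)"

lemma valid_typed [simp]: "valid (typed A B f) \<longleftrightarrow> A \<in> Obj C \<and> B \<in> Obj C \<and> f \<in> Arr C A B"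
  and src_typed [simp]: "src (typed A B f) = A"
  and tgt_typed [simp]: "tgt (typed A B f) = B"
  and raw_typed [simp]: "raw (typed A B f) = f"
  by (simp_all add: typed_def)

lemma typed_inj [simp]: "typed A B f = typed A' B' f' \<longleftrightarrow> A = A' \<and> B = B' \<and> f = f'"
  by (simp add: typed_def)

lemma validE:
  assumes "valid x"
  obtains A B f where "x = typed A B f" "A \<in> Obj C" "B \<in> Obj C" "f \<in> Arr C A B"
  using assms by (cases x rule: valid.cases) (auto simp: typed_def)

lemma valid_objs [simp]: "valid x \<Longrightarrow> src x \<in> Obj C" "valid x \<Longrightarrow> tgt x \<in> Obj C"
  "valid x \<Longrightarrow> raw x \<in> Arr C (src x) (tgt x)"
  by (auto elim!: validE)

lemma typed_raw: "valid x \<Longrightarrow> typed (src x) (tgt x) (raw x) = x"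
  by (auto elim!: validE)

lemma carrier_Hom [simp]: "carrier (Hom C A B) = Arr C A B"
  by (simp add: Hom_def)

lemma hom_grp: "A \<in> Obj C \<Longrightarrow> B \<in> Obj C \<Longrightarrow> abelian_group (Hom C A B)"
  using hom_module[of A B] by (simp add: module_def)

lemma hom_add_closed [simp]:
  "\<lbrakk>A \<in> Obj C; B \<in> Obj C; f \<in> Arr C A B; g \<in> Arr C A B\<rbrakk> \<Longrightarrow> f \<oplus>\<^bsub>Hom C A B\<^esub> g \<in> Arr C A B"
  using abelian_monoid.a_closed[OF abelian_group.axioms(1)[OF hom_grp]] by simp

lemma hom_neg_closed [simp]:
  "\<lbrakk>A \<in> Obj C; B \<in> Obj C; f \<in> Arr C A B\<rbrakk> \<Longrightarrow> \<ominus>\<^bsub>Hom C A B\<^esub> f \<in> Arr C A B"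
  using abelian_group.a_inv_closed[OF hom_grp] by simp

lemma hom_zero_closed [simp]:
  "\<lbrakk>A \<in> Obj C; B \<in> Obj C\<rbrakk> \<Longrightarrow> \<zero>\<^bsub>Hom C A B\<^esub> \<in> Arr C A B"
  using abelian_monoid.zero_closed[OF abelian_group.axioms(1)[OF hom_grp]] by simp

lemma hom_smult_closed [simp]:
  "\<lbrakk>A \<in> Obj C; B \<in> Obj C; c \<in> carrier k; f \<in> Arr C A B\<rbrakk> \<Longrightarrow> c \<odot>\<^bsub>Hom C A B\<^esub> f \<in> Arr C A B"
  using module.smult_closed[OF hom_module] by simp

lemma mul_typed:
  assumes "A \<in> Obj C" "B \<in> Obj C" "E \<in> Obj C" "f \<in> Arr C A B" "g \<in> Arr C B E"
  shows "typed B E g \<star> typed A B f = typed A E (g \<cdot> f)"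
  using assms by (simp add: mul_def)

lemma pls_typed:
  assumes "A \<in> Obj C" "B \<in> Obj C" "f \<in> Arr C A B" "g \<in> Arr C A B"
  shows "typed A B f \<boxplus> typed A B g = typed A B (f \<oplus>\<^bsub>Hom C A B\<^esub> g)"
  using assms by (simp add: pls_def)

lemma valid_mul [simp]: "valid (x \<star> y) \<longleftrightarrow> valid x \<and> valid y \<and> src x = tgt y"
  by (auto simp: mul_def intro: comp_arr[of _ "tgt y"] elim!: validE)

lemma src_mul [simp]: "valid (x \<star> y) \<Longrightarrow> src (x \<star> y) = src y"
  and tgt_mul [simp]: "valid (x \<star> y) \<Longrightarrow> tgt (x \<star> y) = tgt x"
  by (auto simp: mul_def split: if_splits)

lemma valid_pls [simp]: "valid (x \<boxplus> y) \<longleftrightarrow> valid x \<and> valid y \<and> src x = src y \<and> tgt x = tgt y"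
  by (auto simp: pls_def elim!: validE)

lemma src_pls [simp]: "valid (x \<boxplus> y) \<Longrightarrow> src (x \<boxplus> y) = src x"
  and tgt_pls [simp]: "valid (x \<boxplus> y) \<Longrightarrow> tgt (x \<boxplus> y) = tgt x"
  by (auto simp: pls_def split: if_splits)

lemma valid_neg [simp]: "valid (neg x) \<longleftrightarrow> valid x"
  by (auto simp: neg_def elim!: validE)

lemma src_neg [simp]: "valid x \<Longrightarrow> src (neg x) = src x"
  and tgt_neg [simp]: "valid x \<Longrightarrow> tgt (neg x) = tgt x"
  by (auto simp: neg_def)

lemma valid_scal [simp]: "c \<in> carrier k \<Longrightarrow> valid (scal c x) \<longleftrightarrow> valid x"
  by (auto simp: scal_def elim!: validE)

lemma src_scal [simp]: "valid x \<Longrightarrow> src (scal c x) = src x"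
  and tgt_scal [simp]: "valid x \<Longrightarrow> tgt (scal c x) = tgt x"
  by (auto simp: scal_def)

lemma valid_one [simp]: "valid (ident A) \<longleftrightarrow> A \<in> Obj C"
  by (auto simp: ident_def Id_arr)

lemma src_one [simp]: "src (ident A) = A" and tgt_one [simp]: "tgt (ident A) = A"
  by (auto simp: ident_def)

lemma valid_nil [simp]: "valid (nil A B) \<longleftrightarrow> A \<in> Obj C \<and> B \<in> Obj C"
  by (auto simp: nil_def)

lemma src_nil [simp]: "src (nil A B) = A" and tgt_nil [simp]: "tgt (nil A B) = B"
  by (auto simp: nil_def)

text \<open>
  Both sides of an algebraic law are defined under the same conditions; where they are not, they
  are both \<open>None\<close>. This reduces each unconditional law to an axiom of the category.
\<close>

lemma None_if_not_valid:
  "\<not> valid (x \<star> y) \<Longrightarrow> x \<star> y = None" "\<not> valid (x \<boxplus> y) \<Longrightarrow> x \<boxplus> y = None"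
  by (simp_all only: valid_mul valid_pls) (auto simp: mul_def pls_def)

lemma mul_None [simp]: "None \<star> x = None" "x \<star> None = None"
  and pls_None [simp]: "None \<boxplus> x = None" "x \<boxplus> None = None"
  and neg_None [simp]: "neg None = None"
  and scal_None [simp]: "scal c None = None"
  by (simp_all add: mul_def pls_def neg_def scal_def)

lemma mul_assoc: "(x \<star> y) \<star> z = x \<star> (y \<star> z)"
proof (cases "valid x \<and> valid y \<and> valid z \<and> src x = tgt y \<and> src y = tgt z")
  case True
  then obtain A B E P f g h where *: "x = typed E P h" "y = typed B E g" "z = typed A B f"
    and o: "A \<in> Obj C" "B \<in> Obj C" "E \<in> Obj C" "P \<in> Obj C"
    and a: "f \<in> Arr C A B" "g \<in> Arr C B E" "h \<in> Arr C E P"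
    by (auto elim!: validE)
  from o a show ?thesis
    by (simp add: * mul_typed comp_assoc[OF o a] comp_arr[OF o(1-3) a(1,2)]
        comp_arr[OF o(2-4) a(2,3)])
next
  case False
  then show ?thesis
    by (metis None_if_not_valid(1) src_mul tgt_mul valid_mul)
qed

lemma pls_mul: "(x \<boxplus> y) \<star> z = x \<star> z \<boxplus> y \<star> z"
proof (cases "valid ((x \<boxplus> y) \<star> z)")
  case True
  then obtain A B E f g h where *: "x = typed B E g" "y = typed B E h" "z = typed A B f"
    and o: "A \<in> Obj C" "B \<in> Obj C" "E \<in> Obj C"
    and a: "f \<in> Arr C A B" "g \<in> Arr C B E" "h \<in> Arr C B E"
    by (auto elim!: validE)
  from o a show ?thesis
    by (simp add: * mul_typed pls_typed comp_add_left[OF o a] comp_arr[OF o a(1,2)]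
        comp_arr[OF o a(1,3)])
next
  case False
  then have "\<not> valid (x \<star> z \<boxplus> y \<star> z)"
    by auto
  with False show ?thesis by (metis None_if_not_valid)
qed

lemma mul_pls: "z \<star> (x \<boxplus> y) = z \<star> x \<boxplus> z \<star> y"
proof (cases "valid (z \<star> (x \<boxplus> y))")
  case True
  then obtain A B E f g h where *: "x = typed A B f" "y = typed A B g" "z = typed B E h"
    and o: "A \<in> Obj C" "B \<in> Obj C" "E \<in> Obj C"
    and a: "f \<in> Arr C A B" "g \<in> Arr C A B" "h \<in> Arr C B E"
    by (auto elim!: validE)
  from o a show ?thesis
    by (simp add: * mul_typed pls_typed comp_add_right[OF o a] comp_arr[OF o a(1,3)]
        comp_arr[OF o a(2,3)])
next
  case False
  then have "\<not> valid (z \<star> x \<boxplus> z \<star> y)"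
    by auto
  with False show ?thesis by (metis None_if_not_valid)
qed

lemma pls_comm: "x \<boxplus> y = y \<boxplus> x"
proof (cases "valid (x \<boxplus> y)")
  case True
  then show ?thesis
    by (auto elim!: validE)
      (auto simp: pls_def abelian_monoid.a_comm[OF abelian_group.axioms(1)[OF hom_grp]])
next
  case False
  then show ?thesis by (metis None_if_not_valid(2) valid_pls)
qed

lemma pls_assoc: "(x \<boxplus> y) \<boxplus> z = x \<boxplus> (y \<boxplus> z)"
proof (cases "valid ((x \<boxplus> y) \<boxplus> z)")
  case True
  then have *: "valid x" "valid y" "valid z" "src x = src y" "tgt x = tgt y" "src z = src y"
    "tgt z = tgt y" by auto
  then have "valid (x \<boxplus> y)" "valid (y \<boxplus> z)" by simp_all
  with * show ?thesis
    by (auto elim!: validE)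
      (auto simp: pls_def abelian_monoid.a_assoc[OF abelian_group.axioms(1)[OF hom_grp]])
next
  case False
  then have "\<not> valid (x \<boxplus> (y \<boxplus> z))" by auto
  with False show ?thesis by (metis None_if_not_valid)
qed

lemma pls_lcomm: "x \<boxplus> (y \<boxplus> z) = y \<boxplus> (x \<boxplus> z)"
  by (metis pls_assoc pls_comm)

lemma pls_nil [simp]: "valid x \<Longrightarrow> src x = A \<Longrightarrow> tgt x = B \<Longrightarrow> x \<boxplus> nil A B = x"
  and nil_pls [simp]: "valid x \<Longrightarrow> src x = A \<Longrightarrow> tgt x = B \<Longrightarrow> nil A B \<boxplus> x = x"
  using abelian_monoid.r_zero[OF abelian_group.axioms(1)[OF hom_grp]]
  by (auto elim!: validE simp: pls_def nil_def) (metis carrier_Hom abelian_monoid.l_zero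
    abelian_group.axioms(1) hom_grp)

lemma pls_neg [simp]: "valid x \<Longrightarrow> x \<boxplus> neg x = nil (src x) (tgt x)"
  by (auto elim!: validE simp: pls_def neg_def nil_def abelian_group.r_neg[OF hom_grp])

lemma neg_pls_self [simp]: "valid x \<Longrightarrow> neg x \<boxplus> x = nil (src x) (tgt x)"
  using pls_neg pls_comm by metis

lemma neg_unique:
  assumes "valid x" "valid y" "src y = src x" "tgt y = tgt x" "x \<boxplus> y = nil (src x) (tgt x)"
  shows "y = neg x"
proof -
  have "neg x = neg x \<boxplus> (x \<boxplus> y)" using assms by simp
  also have "\<dots> = (neg x \<boxplus> x) \<boxplus> y" by (simp only: pls_assoc)
  also have "\<dots> = y" using assms by simp
  finally show ?thesis by simp
qed

lemma add_self_nil: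
  assumes "valid x" "x \<boxplus> x = x" shows "x = nil (src x) (tgt x)"
proof -
  have "nil (src x) (tgt x) = (x \<boxplus> x) \<boxplus> neg x" using assms by simp
  also have "\<dots> = x" using assms(1) by (simp add: pls_assoc)
  finally show ?thesis by simp
qed

lemma mul_nil [simp]:
  assumes "valid x" "src x = B" "A \<in> Obj C" shows "x \<star> nil A B = nil A (tgt x)"
proof -
  have "x \<star> nil A B \<boxplus> x \<star> nil A B = x \<star> nil A B"
    using assms by (auto simp flip: mul_pls)
  moreover have "B \<in> Obj C" using assms by auto
  ultimately show ?thesis using add_self_nil[of "x \<star> nil A B"] assms by simp
qed

lemma nil_mul [simp]:
  assumes "valid x" "tgt x = A" "B \<in> Obj C" shows "nil A B \<star> x = nil (src x) B"
proof -
  have "nil A B \<star> x \<boxplus> nil A B \<star> x = nil A B \<star> x"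
    using assms by (auto simp flip: pls_mul)
  moreover have "A \<in> Obj C" using assms by auto
  ultimately show ?thesis using add_self_nil[of "nil A B \<star> x"] assms by simp
qed

lemma mul_neg [simp]: "x \<star> neg y = neg (x \<star> y)"
proof (cases "valid (x \<star> y)")
  case True
  then have "x \<star> y \<boxplus> x \<star> neg y = nil (src (x \<star> y)) (tgt (x \<star> y))"
    by (simp flip: mul_pls)
  with True show ?thesis by (intro neg_unique) auto
next
  case False
  then have "\<not> valid (x \<star> neg y)" by auto
  with False show ?thesis by (metis None_if_not_valid neg_None)
qed

lemma neg_mul [simp]: "neg x \<star> y = neg (x \<star> y)"
proof (cases "valid (x \<star> y)")
  case True
  then have "x \<star> y \<boxplus> neg x \<star> y = nil (src (x \<star> y)) (tgt (x \<star> y))"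
    by (simp flip: pls_mul)
  with True show ?thesis by (intro neg_unique) auto
next
  case False
  then have "\<not> valid (neg x \<star> y)" by auto
  with False show ?thesis by (metis None_if_not_valid neg_None)
qed

lemma neg_neg [simp]: "valid x \<Longrightarrow> neg (neg x) = x"
  by (rule neg_unique[symmetric]) auto

lemma neg_pls [simp]: "neg (x \<boxplus> y) = neg x \<boxplus> neg y"
proof (cases "valid (x \<boxplus> y)")
  case True
  then have "(x \<boxplus> y) \<boxplus> (neg x \<boxplus> neg y) = (x \<boxplus> neg x) \<boxplus> (y \<boxplus> neg y)"
    by (simp only: pls_assoc pls_comm pls_lcomm)
  with True show ?thesis by (intro neg_unique[symmetric]) auto
next
  case False
  then have "\<not> valid (neg x \<boxplus> neg y)" by auto
  with False show ?thesis by (metis None_if_not_valid neg_None)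
qed

lemma neg_nil [simp]: "A \<in> Obj C \<Longrightarrow> B \<in> Obj C \<Longrightarrow> neg (nil A B) = nil A B"
  by (rule neg_unique[symmetric]) auto

lemma one_mul [simp]: "valid x \<Longrightarrow> tgt x = A \<Longrightarrow> ident A \<star> x = x"
  and mul_one [simp]: "valid x \<Longrightarrow> src x = A \<Longrightarrow> x \<star> ident A = x"
  by (auto elim!: validE simp: ident_def mul_def Id_arr Id_comp comp_Id)

lemma scal_mul [simp]: "c \<in> carrier k \<Longrightarrow> scal c x \<star> y = scal c (x \<star> y)"
  by (cases "valid x \<and> valid y \<and> src x = tgt y")
    (auto simp: scal_def mul_def comp_smult_left None_if_not_valid comp_arr elim!: validE)

lemma mul_scal [simp]: "c \<in> carrier k \<Longrightarrow> x \<star> scal c y = scal c (x \<star> y)"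
  by (cases "valid x \<and> valid y \<and> src x = tgt y")
    (auto simp: scal_def mul_def comp_smult_right None_if_not_valid comp_arr elim!: validE)

lemma scal_pls: "c \<in> carrier k \<Longrightarrow> scal c (x \<boxplus> y) = scal c x \<boxplus> scal c y"
  by (cases "valid x \<and> valid y \<and> src x = src y \<and> tgt x = tgt y")
    (auto simp: scal_def pls_typed None_if_not_valid module.smult_r_distr[OF hom_module] elim!: validE)

lemma scal_nil: "\<lbrakk>c \<in> carrier k; A \<in> Obj C; B \<in> Obj C\<rbrakk> \<Longrightarrow> scal c (nil A B) = nil A B"
  by (simp add: scal_def nil_def module.smult_r_null[OF hom_module])

lemma scal_neg:
  assumes "c \<in> carrier k" shows "scal c (neg x) = neg (scal c x)"
proof (cases "valid x")
  case True
  then have "scal c x \<boxplus> scal c (neg x) = nil (src x) (tgt x)"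
    using assms by (simp add: scal_nil flip: scal_pls)
  with True assms show ?thesis by (intro neg_unique) auto
next
  case False
  then show ?thesis by (simp add: scal_def neg_def)
qed

lemma scal_half:
  assumes "c \<in> carrier k" "c \<oplus>\<^bsub>k\<^esub> c = \<one>\<^bsub>k\<^esub>" "valid x"
  shows "scal c x \<boxplus> scal c x = x"
proof -
  obtain A B f where x: "x = typed A B f" "A \<in> Obj C" "B \<in> Obj C" "f \<in> Arr C A B"
    using assms(3) by (rule validE)
  then have "f = (c \<oplus>\<^bsub>k\<^esub> c) \<odot>\<^bsub>Hom C A B\<^esub> f"
    using module.smult_one[OF hom_module] assms by simp
  also have "\<dots> = c \<odot>\<^bsub>Hom C A B\<^esub> f \<oplus>\<^bsub>Hom C A B\<^esub> c \<odot>\<^bsub>Hom C A B\<^esub> f"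
    using module.smult_l_distr[OF hom_module] x assms(1) by simp
  finally show ?thesis using x assms by (simp add: scal_def pls_typed)
qed

text \<open>
  The two parts that come from \<open>P + Q\<close> and \<open>P - Q\<close> in the treatment of a difference of
  forms are recombined by this identity.
\<close>

lemma scal_half_sum:
  assumes "c \<in> carrier k" "c \<oplus>\<^bsub>k\<^esub> c = \<one>\<^bsub>k\<^esub>" "valid (x \<boxplus> y)"
  shows "scal c (x \<boxplus> y) \<boxplus> scal c (x \<boxplus> neg y) = x"
proof -
  have "scal c (x \<boxplus> y) \<boxplus> scal c (x \<boxplus> neg y)
    = (scal c x \<boxplus> scal c x) \<boxplus> (scal c y \<boxplus> neg (scal c y))"
    using assms by (simp only: scal_pls scal_neg pls_assoc pls_comm pls_lcomm)
  also have "\<dots> = x" using assms by (simp add: scal_half)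
  finally show ?thesis .
qed

section \<open>Invertible arrows\<close>

definition invertible where
  "invertible x \<longleftrightarrow> valid x \<and> raw x \<in> Isos C (src x) (tgt x)"

definition arrinv where
  "arrinv x = (if invertible x then typed (tgt x) (src x) (inverse_arr C (src x) (tgt x) (raw x)) else None)"

lemma iso_valid [simp]: "invertible x \<Longrightarrow> valid x"
  by (simp add: invertible_def)

lemma is_inverse_typed:
  assumes "A \<in> Obj C" "B \<in> Obj C" "f \<in> Arr C A B"
  shows "is_inverse C A B f g \<longleftrightarrow> valid (typed B A g) \<and> typed B A g \<star> typed A B f = ident A
    \<and> typed A B f \<star> typed B A g = ident B"
  using assms by (auto simp: is_inverse_def mul_typed ident_def)

lemma inverse_unique:
  assumes "y \<star> x = ident (src x)" "x \<star> z = ident (tgt x)" "valid x"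
  shows "y = z"
proof -
  have v: "valid y" "src y = tgt x" "valid z" "tgt z = src x"
    using assms valid_mul[of y x] valid_mul[of x z] by auto
  have "y = y \<star> (x \<star> z)" using v assms(2,3) by simp
  also have "\<dots> = (y \<star> x) \<star> z" by (simp only: mul_assoc)
  also have "\<dots> = z" using v assms by simp
  finally show ?thesis .
qed

lemma inverse_arr_eq:
  assumes "A \<in> Obj C" "B \<in> Obj C" "f \<in> Arr C A B" "is_inverse C A B f g"
  shows "inverse_arr C A B f = g"
  unfolding inverse_arr_def
proof (rule the_equality)
  show "is_inverse C A B f g" by fact
next
  fix g' assume g': "is_inverse C A B f g'"
  have "typed B A g' = typed B A g"
    by (rule inverse_unique[of _ "typed A B f"])
      (use assms g' in \<open>simp_all add: is_inverse_typed[OF assms(1-3)]\<close>)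
  then show "g' = g" by simp
qed

lemma isoI:
  assumes "valid x" "y \<star> x = ident (src x)" "x \<star> y = ident (tgt x)"
  shows "invertible x" "arrinv x = y"
proof -
  obtain A B f where x: "x = typed A B f" "A \<in> Obj C" "B \<in> Obj C" "f \<in> Arr C A B"
    using assms(1) by (rule validE)
  have "valid (y \<star> x)" using assms x by simp
  then have vy: "valid y" "src y = B" using x by simp_all
  have "valid (x \<star> y)" using assms x by simp
  then have "tgt y = A" using x by simp
  with vy obtain g where g: "y = typed B A g" "g \<in> Arr C B A" by (auto elim!: validE)
  have i: "is_inverse C A B f g" using x g assms by (simp add: is_inverse_typed)
  then show "invertible x" using x by (auto simp: invertible_def Isos_def)
  then show "arrinv x = y" using x g inverse_arr_eq[OF _ _ _ i] by (simp add: arrinv_def)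
qed

lemma
  assumes "invertible x"
  shows inv_mul: "arrinv x \<star> x = ident (src x)" and mul_inv: "x \<star> arrinv x = ident (tgt x)"
    and valid_inv [simp]: "valid (arrinv x)"
proof -
  obtain A B f where x: "x = typed A B f" "A \<in> Obj C" "B \<in> Obj C" "f \<in> Arr C A B"
    using assms iso_valid by (blast elim: validE)
  with assms obtain g where g: "is_inverse C A B f g" by (auto simp: invertible_def Isos_def)
  then have "arrinv x = typed B A g"
    using assms x inverse_arr_eq by (simp add: arrinv_def)
  with x g show "arrinv x \<star> x = ident (src x)" "x \<star> arrinv x = ident (tgt x)" "valid (arrinv x)"
    by (auto simp: is_inverse_typed)
qed

lemma src_inv [simp]: "invertible x \<Longrightarrow> src (arrinv x) = tgt x"
  and tgt_inv [simp]: "invertible x \<Longrightarrow> tgt (arrinv x) = src x"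
  by (auto simp: arrinv_def)

lemma typed_inverse_arr:
  "\<lbrakk>A \<in> Obj C; B \<in> Obj C; f \<in> Isos C A B\<rbrakk> \<Longrightarrow> typed B A (inverse_arr C A B f) = arrinv (typed A B f)"
  by (auto simp: arrinv_def invertible_def Isos_def)

lemma mul_cancel: "\<lbrakk>x \<star> y = ident A; valid z; tgt z = A\<rbrakk> \<Longrightarrow> x \<star> (y \<star> z) = z"
  by (simp flip: mul_assoc)

lemma inv_cancel [simp]:
  "\<lbrakk>invertible x; valid z; tgt z = src x\<rbrakk> \<Longrightarrow> arrinv x \<star> (x \<star> z) = z"
  "\<lbrakk>invertible x; valid z; tgt z = tgt x\<rbrakk> \<Longrightarrow> x \<star> (arrinv x \<star> z) = z"
  by (simp_all add: mul_cancel inv_mul mul_inv)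

lemma iso_inv_iso [simp]: "invertible x \<Longrightarrow> invertible (arrinv x)" "invertible x \<Longrightarrow> arrinv (arrinv x) = x"
  by (auto intro!: isoI(1)[of "arrinv x" x] isoI(2) simp: inv_mul mul_inv)

lemma
  assumes "invertible x" "invertible y" "src x = tgt y"
  shows iso_mul_iso [simp]: "invertible (x \<star> y)" and inv_mul_eq: "arrinv (x \<star> y) = arrinv y \<star> arrinv x"
  using assms by (auto intro!: isoI(1)[of "x \<star> y" "arrinv y \<star> arrinv x"] isoI(2)
    simp: mul_assoc inv_mul mul_inv)

lemma
  assumes "invertible x" shows iso_neg_iso [simp]: "invertible (neg x)" and inv_neg: "arrinv (neg x) = neg (arrinv x)"
  using assms by (auto intro!: isoI(1)[of "neg x" "neg (arrinv x)"] isoI(2)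
    simp: inv_mul mul_inv)

lemma mul_left_eq: "\<lbrakk>invertible x; x \<star> y = x \<star> z; valid (x \<star> y)\<rbrakk> \<Longrightarrow> y = z"
  by (metis inv_cancel(1) valid_mul)

lemma mul_right_eq:
  assumes "invertible x" "y \<star> x = z \<star> x" "valid (y \<star> x)" shows "y = z"
proof -
  have v: "valid z" "src z = tgt x" using assms by (metis valid_mul)+
  have "y \<star> (x \<star> arrinv x) = z \<star> (x \<star> arrinv x)"
    by (simp only: mul_assoc[symmetric] assms(2))
  with assms(1,3) v show ?thesis by (simp add: mul_inv)
qed

section \<open>Functors on typed arrows\<close>

definition fmap :: "('o, 'm, 'o, 'm) func \<Rightarrow> _" where
  "fmap R x = (if valid x
     then typed (ob R (src x)) (ob R (tgt x)) (ar R (src x) (tgt x) (raw x)) else None)"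

definition cmap :: "('o, 'm, 'o, 'm) func \<Rightarrow> _" where
  "cmap R x = (if valid x
     then typed (ob R (tgt x)) (ob R (src x)) (ar R (src x) (tgt x) (raw x)) else None)"

lemma fmap_None [simp]: "fmap R None = None" and cmap_None [simp]: "cmap R None = None"
  by (simp_all add: fmap_def cmap_def)

context
  fixes R :: "('o, 'm, 'o, 'm) func"
  assumes R: "is_functor k C C R"
begin

lemma ob_functor [simp]: "A \<in> Obj C \<Longrightarrow> ob R A \<in> Obj C"
  using R by (simp add: is_functor_def)

lemma valid_fmap [simp]: "valid (fmap R x) \<longleftrightarrow> valid x"
  using R by (auto simp: fmap_def is_functor_def elim!: validE)

lemma src_fmap [simp]: "valid x \<Longrightarrow> src (fmap R x) = ob R (src x)"
  and tgt_fmap [simp]: "valid x \<Longrightarrow> tgt (fmap R x) = ob R (tgt x)"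
  by (auto simp: fmap_def)

lemma fmap_one [simp]: "A \<in> Obj C \<Longrightarrow> fmap R (ident A) = ident (ob R A)"
  using R by (simp add: fmap_def ident_def is_functor_def Id_arr)

lemma fmap_mul:
  assumes "valid x" "valid y" "src x = tgt y" shows "fmap R (x \<star> y) = fmap R x \<star> fmap R y"
proof -
  obtain A B E f g where *: "x = typed B E g" "y = typed A B f"
    and o: "A \<in> Obj C" "B \<in> Obj C" "E \<in> Obj C"
    and a: "f \<in> Arr C A B" "g \<in> Arr C B E"
    using assms by (auto elim!: validE)
  from o a R show ?thesis
    by (simp add: * mul_typed fmap_def comp_arr[OF o a]) (simp add: is_functor_def mul_typed)
qed

lemma fmap_pls:
  assumes "valid x" "valid y" "src x = src y" "tgt x = tgt y"
  shows "fmap R (x \<boxplus> y) = fmap R x \<boxplus> fmap R y"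
proof -
  obtain A B f g where *: "x = typed A B g" "y = typed A B f"
    and o: "A \<in> Obj C" "B \<in> Obj C"
    and a: "f \<in> Arr C A B" "g \<in> Arr C A B"
    using assms by (auto elim!: validE)
  from o a R show ?thesis
    by (simp add: * pls_typed fmap_def) (simp add: is_functor_def pls_typed)
qed

lemma fmap_scal: "c \<in> carrier k \<Longrightarrow> fmap R (scal c x) = scal c (fmap R x)"
proof (cases "valid x")
  case True
  then obtain A B f where "x = typed A B f" "A \<in> Obj C" "B \<in> Obj C" "f \<in> Arr C A B"
    by (rule validE)
  with R show "c \<in> carrier k \<Longrightarrow> ?thesis" by (simp add: fmap_def scal_def) (simp add: is_functor_def)
qed (simp add: fmap_def scal_def)

lemma fmap_nil [simp]:
  assumes "A \<in> Obj C" "B \<in> Obj C" shows "fmap R (nil A B) = nil (ob R A) (ob R B)"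
proof -
  have "fmap R (nil A B) \<boxplus> fmap R (nil A B) = fmap R (nil A B)"
    using assms by (subst fmap_pls[symmetric]) simp_all
  from add_self_nil[OF _ this] assms show ?thesis by simp
qed

lemma fmap_neg: "fmap R (neg x) = neg (fmap R x)"
proof (cases "valid x")
  case True
  then have "fmap R x \<boxplus> fmap R (neg x) = nil (src (fmap R x)) (tgt (fmap R x))"
    by (subst fmap_pls[symmetric]) simp_all
  with True show ?thesis by (intro neg_unique) auto
qed (simp add: fmap_def neg_def)

lemma
  assumes "invertible x"
  shows iso_fmap_iso [simp]: "invertible (fmap R x)" and fmap_inv: "fmap R (arrinv x) = arrinv (fmap R x)"
proof -
  have "fmap R (arrinv x) \<star> fmap R x = ident (src (fmap R x))"
    "fmap R x \<star> fmap R (arrinv x) = ident (tgt (fmap R x))"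
    using assms by (simp_all add: inv_mul mul_inv flip: fmap_mul)
  with isoI[of "fmap R x"] assms show "invertible (fmap R x)" "fmap R (arrinv x) = arrinv (fmap R x)" by simp_all
qed

lemmas fmap_simps = fmap_mul fmap_pls fmap_scal fmap_neg fmap_inv

end

context
  fixes D :: "('o, 'm, 'o, 'm) func"
  assumes D: "is_contrafunctor k C C D"
begin

lemma ob_contrafunctor [simp]: "A \<in> Obj C \<Longrightarrow> ob D A \<in> Obj C"
  using D by (simp add: is_contrafunctor_def)

lemma valid_cmap [simp]: "valid (cmap D x) \<longleftrightarrow> valid x"
  using D by (auto simp: cmap_def is_contrafunctor_def elim!: validE)

lemma src_cmap [simp]: "valid x \<Longrightarrow> src (cmap D x) = ob D (tgt x)"
  and tgt_cmap [simp]: "valid x \<Longrightarrow> tgt (cmap D x) = ob D (src x)"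
  by (auto simp: cmap_def)

lemma cmap_one [simp]: "A \<in> Obj C \<Longrightarrow> cmap D (ident A) = ident (ob D A)"
  using D by (simp add: cmap_def ident_def is_contrafunctor_def Id_arr)

lemma cmap_mul:
  assumes "valid x" "valid y" "src x = tgt y" shows "cmap D (x \<star> y) = cmap D y \<star> cmap D x"
proof -
  obtain A B E f g where *: "x = typed B E g" "y = typed A B f"
    and o: "A \<in> Obj C" "B \<in> Obj C" "E \<in> Obj C"
    and a: "f \<in> Arr C A B" "g \<in> Arr C B E"
    using assms by (auto elim!: validE)
  from o a D show ?thesis
    by (simp add: * mul_typed cmap_def comp_arr[OF o a]) (simp add: is_contrafunctor_def mul_typed)
qed

lemma cmap_pls:
  assumes "valid x" "valid y" "src x = src y" "tgt x = tgt y"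
  shows "cmap D (x \<boxplus> y) = cmap D x \<boxplus> cmap D y"
proof -
  obtain A B f g where *: "x = typed A B g" "y = typed A B f"
    and o: "A \<in> Obj C" "B \<in> Obj C"
    and a: "f \<in> Arr C A B" "g \<in> Arr C A B"
    using assms by (auto elim!: validE)
  from o a D show ?thesis
    by (simp add: * pls_typed cmap_def) (simp add: is_contrafunctor_def pls_typed)
qed

lemma cmap_scal: "c \<in> carrier k \<Longrightarrow> cmap D (scal c x) = scal c (cmap D x)"
proof (cases "valid x")
  case True
  then obtain A B f where "x = typed A B f" "A \<in> Obj C" "B \<in> Obj C" "f \<in> Arr C A B"
    by (rule validE)
  with D show "c \<in> carrier k \<Longrightarrow> ?thesis"
    by (simp add: cmap_def scal_def) (simp add: is_contrafunctor_def)
qed (simp add: cmap_def scal_def)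

lemma cmap_nil [simp]:
  assumes "A \<in> Obj C" "B \<in> Obj C" shows "cmap D (nil A B) = nil (ob D B) (ob D A)"
proof -
  have "cmap D (nil A B) \<boxplus> cmap D (nil A B) = cmap D (nil A B)"
    using assms by (subst cmap_pls[symmetric]) simp_all
  from add_self_nil[OF _ this] assms show ?thesis by simp
qed

lemma cmap_neg: "cmap D (neg x) = neg (cmap D x)"
proof (cases "valid x")
  case True
  then have "cmap D x \<boxplus> cmap D (neg x) = nil (src (cmap D x)) (tgt (cmap D x))"
    by (subst cmap_pls[symmetric]) simp_all
  with True show ?thesis by (intro neg_unique) auto
qed (simp add: cmap_def neg_def)

lemma
  assumes "invertible x"
  shows iso_cmap_iso [simp]: "invertible (cmap D x)" and cmap_inv: "cmap D (arrinv x) = arrinv (cmap D x)"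
proof -
  have "cmap D (arrinv x) \<star> cmap D x = ident (src (cmap D x))"
    "cmap D x \<star> cmap D (arrinv x) = ident (tgt (cmap D x))"
    using assms by (simp_all add: inv_mul mul_inv flip: cmap_mul)
  with isoI[of "cmap D x"] assms show "invertible (cmap D x)" "cmap D (arrinv x) = arrinv (cmap D x)" by simp_all
qed

lemmas cmap_simps = cmap_mul cmap_pls cmap_scal cmap_neg cmap_inv

end

lemma fmap_cmap_comp:
  assumes "is_functor k C C R" "is_contrafunctor k C C D"
  shows "cmap (R \<circ>\<^sub>C D) x = fmap R (cmap D x)"
proof (cases "valid x")
  case True
  then have "valid (cmap D x)" using assms by simp
  with True show ?thesis by (simp add: cmap_def fmap_def func_comp_contra_def)
qed (simp add: cmap_def fmap_def)

lemma comp_contrafunctor: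
  assumes R: "is_functor k C C R" and D: "is_contrafunctor k C C D"
  shows "is_contrafunctor k C C (R \<circ>\<^sub>C D)"
  using R D unfolding is_functor_def is_contrafunctor_def func_comp_contra_def by simp

section \<open>Direct sums and matrices\<close>

definition i1 where "i1 A B = typed A (DSum C A B) (In1 C A B)"
definition i2 where "i2 A B = typed B (DSum C A B) (In2 C A B)"
definition p1 where "p1 A B = typed (DSum C A B) A (Pr1 C A B)"
definition p2 where "p2 A B = typed (DSum C A B) B (Pr2 C A B)"

lemma src_sum [simp]: "src (i1 A B) = A" "src (i2 A B) = B"
  "src (p1 A B) = DSum C A B" "src (p2 A B) = DSum C A B"
  and tgt_sum [simp]: "tgt (i1 A B) = DSum C A B" "tgt (i2 A B) = DSum C A B"
  "tgt (p1 A B) = A" "tgt (p2 A B) = B"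
  by (simp_all add: i1_def i2_def p1_def p2_def)

context
  fixes A B assumes AB: "A \<in> Obj C" "B \<in> Obj C"
begin

lemma valid_sum [simp]: "valid (i1 A B)" "valid (i2 A B)" "valid (p1 A B)" "valid (p2 A B)"
  and DSum_Obj [simp]: "DSum C A B \<in> Obj C"
  using AB by (simp_all add: i1_def i2_def p1_def p2_def DSum_obj In1_arr In2_arr Pr1_arr Pr2_arr)

lemma sum_eqs [simp]: "p1 A B \<star> i1 A B = ident A" "p2 A B \<star> i2 A B = ident B"
  "p1 A B \<star> i2 A B = nil B A" "p2 A B \<star> i1 A B = nil A B"
  using AB by (simp_all add: i1_def i2_def p1_def p2_def mul_typed ident_def nil_def DSum_obj In1_arr
      In2_arr Pr1_arr Pr2_arr Pr1_In1 Pr2_In1 Pr1_In2 Pr2_In2)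

lemma sum_cancel [simp]:
  "valid x \<Longrightarrow> tgt x = A \<Longrightarrow> p1 A B \<star> (i1 A B \<star> x) = x"
  "valid x \<Longrightarrow> tgt x = B \<Longrightarrow> p2 A B \<star> (i2 A B \<star> x) = x"
  "valid x \<Longrightarrow> tgt x = B \<Longrightarrow> p1 A B \<star> (i2 A B \<star> x) = nil (src x) A"
  "valid x \<Longrightarrow> tgt x = A \<Longrightarrow> p2 A B \<star> (i1 A B \<star> x) = nil (src x) B"
  using AB by (simp_all flip: mul_assoc)

lemma sum_one: "i1 A B \<star> p1 A B \<boxplus> i2 A B \<star> p2 A B = ident (DSum C A B)"
  using AB In1_Pr1_In2_Pr2[of A B]
  by (simp add: i1_def i2_def p1_def p2_def mul_typed ident_def DSum_obj In1_arr
      In2_arr Pr1_arr Pr2_arr pls_typed comp_arr[of _ A] comp_arr[of _ B])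

end

lemma typed_mul:
  assumes "valid (typed B E g)" "valid (typed A B f)"
  shows "typed A E (g \<cdot> f) = typed B E g \<star> typed A B f"
  using assms by (simp add: mul_typed)

lemma typed_mul3:
  assumes "A \<in> Obj C" "B \<in> Obj C" "E \<in> Obj C" "P \<in> Obj C"
    "f \<in> Arr C A B" "g \<in> Arr C B E" "h \<in> Arr C E P"
  shows "h \<cdot> g \<cdot> f \<in> Arr C A P"
    "typed E P h \<star> typed B E g \<star> typed A B f = typed A P (h \<cdot> g \<cdot> f)"
  using assms comp_arr[OF assms(1-3,5,6)] comp_arr[OF assms(1,3,4) _ assms(7), of "g \<cdot> f"]
  by (simp_all add: mul_typed)

lemma typed_matrix:
  assumes o: "A1 \<in> Obj C" "A2 \<in> Obj C" "B1 \<in> Obj C" "B2 \<in> Obj C"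
    and a: "a \<in> Arr C A1 B1" "b \<in> Arr C A2 B1" "c \<in> Arr C A1 B2" "d \<in> Arr C A2 B2"
  shows "typed (DSum C A1 A2) (DSum C B1 B2) (matrix C A1 A2 B1 B2 a b c d) =
     (i1 B1 B2 \<star> typed A1 B1 a \<star> p1 A1 A2 \<boxplus> i1 B1 B2 \<star> typed A2 B1 b \<star> p2 A1 A2) \<boxplus>
     (i2 B1 B2 \<star> typed A1 B2 c \<star> p1 A1 A2 \<boxplus> i2 B1 B2 \<star> typed A2 B2 d \<star> p2 A1 A2)"
proof -
  note S = DSum_obj[OF o(1,2)] DSum_obj[OF o(3,4)]
  note ma = typed_mul3[OF S(1) o(1) o(3) S(2) Pr1_arr[OF o(1,2)] a(1) In1_arr[OF o(3,4)]]
  note mb = typed_mul3[OF S(1) o(2) o(3) S(2) Pr2_arr[OF o(1,2)] a(2) In1_arr[OF o(3,4)]]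
  note mc = typed_mul3[OF S(1) o(1) o(4) S(2) Pr1_arr[OF o(1,2)] a(3) In2_arr[OF o(3,4)]]
  note md = typed_mul3[OF S(1) o(2) o(4) S(2) Pr2_arr[OF o(1,2)] a(4) In2_arr[OF o(3,4)]]
  show ?thesis
    unfolding i1_def i2_def p1_def p2_def ma(2) mb(2) mc(2) md(2)
    by (simp add: matrix_def Let_def pls_typed S ma(1) mb(1) mc(1) md(1))
qed

end

section \<open>Dualities and hyperbolic spaces\<close>

text \<open>
  Composites are normalised to the right, so an equation between composites of two arrows has to be
  applied in front of a further factor.
\<close>

lemma (in additive_category) mul_lift: "x \<star> y = z \<Longrightarrow> x \<star> (y \<star> w) = z \<star> w"
  by (simp flip: mul_assoc)

context additive_category
begin

text \<open>
  The passage from expressions in the category to typed arrows: a typed expression that has the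
  given source, target and underlying morphism is the typed version of that morphism.
\<close>

lemma typed_eqI: "\<lbrakk>valid x; src x = A; tgt x = B; raw x = f\<rbrakk> \<Longrightarrow> typed A B f = x"
  by (auto simp: typed_raw)

lemma raw_mul: "valid (x \<star> y) \<Longrightarrow> raw (x \<star> y) = raw x \<cdot> raw y"
  and raw_pls: "valid (x \<boxplus> y) \<Longrightarrow> raw (x \<boxplus> y) = raw x \<oplus>\<^bsub>Hom C (src x) (tgt x)\<^esub> raw y"
  and raw_neg: "valid x \<Longrightarrow> raw (neg x) = \<ominus>\<^bsub>Hom C (src x) (tgt x)\<^esub> raw x"
  and raw_inv: "invertible x \<Longrightarrow> raw (arrinv x) = inverse_arr C (src x) (tgt x) (raw x)"
  and raw_fmap: "valid x \<Longrightarrow> raw (fmap R x) = ar R (src x) (tgt x) (raw x)"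
  and raw_cmap: "valid x \<Longrightarrow> raw (cmap R x) = ar R (src x) (tgt x) (raw x)"
proof -
  show "valid (x \<star> y) \<Longrightarrow> raw (x \<star> y) = raw x \<cdot> raw y"
    by (simp only: valid_mul) (simp add: mul_def)
  show "valid (x \<boxplus> y) \<Longrightarrow> raw (x \<boxplus> y) = raw x \<oplus>\<^bsub>Hom C (src x) (tgt x)\<^esub> raw y"
    by (simp only: valid_pls) (simp add: pls_def)
qed (simp_all add: neg_def arrinv_def fmap_def cmap_def)

lemma raw_sum: "raw (p1 A B) = Pr1 C A B" "raw (p2 A B) = Pr2 C A B"
  "raw (i1 A B) = In1 C A B" "raw (i2 A B) = In2 C A B"
  by (simp_all add: p1_def p2_def i1_def i2_def)

lemmas raw_simps = raw_mul raw_pls raw_neg raw_inv raw_fmap raw_cmap raw_sum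

lemma typed_sum_join:
  assumes "is_contrafunctor k C C D" "A \<in> Obj C" "B \<in> Obj C"
  shows "typed (DSum C (ob D A) (ob D B)) (ob D (DSum C A B)) (sum_join C D A B)
    = cmap D (p1 A B) \<star> p1 (ob D A) (ob D B) \<boxplus> cmap D (p2 A B) \<star> p2 (ob D A) (ob D B)"
  using assms ob_contrafunctor[OF assms(1)] valid_cmap[OF assms(1)]
  by (intro typed_eqI) (simp_all add: raw_simps sum_join_def)

lemma typed_sum_split:
  assumes "is_functor k C C R" "A \<in> Obj C" "B \<in> Obj C"
  shows "typed (ob R (DSum C A B)) (DSum C (ob R A) (ob R B)) (sum_split C R A B)
    = i1 (ob R A) (ob R B) \<star> fmap R (p1 A B) \<boxplus> i2 (ob R A) (ob R B) \<star> fmap R (p2 A B)"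
  using assms ob_functor[OF assms(1)] valid_fmap[OF assms(1)]
  by (intro typed_eqI) (simp_all add: raw_simps sum_split_def)

lemma typed_zero: "typed A B (\<zero>\<^bsub>Hom C A B\<^esub>) = nil A B"
  by (simp add: nil_def)

lemma typed_Id: "typed A A (Id C A) = ident A"
  by (simp add: ident_def)

lemma typed_neg: "A \<in> Obj C \<Longrightarrow> B \<in> Obj C \<Longrightarrow> f \<in> Arr C A B \<Longrightarrow>
    typed A B (\<ominus>\<^bsub>Hom C A B\<^esub> f) = neg (typed A B f)"
  by (simp add: neg_def)

lemma typed_diag:
  assumes "A1 \<in> Obj C" "A2 \<in> Obj C" "B1 \<in> Obj C" "B2 \<in> Obj C"
    "a \<in> Arr C A1 B1" "b \<in> Arr C A2 B2"
  shows "typed (DSum C A1 A2) (DSum C B1 B2)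
      (matrix C A1 A2 B1 B2 a \<zero>\<^bsub>Hom C A2 B1\<^esub> \<zero>\<^bsub>Hom C A1 B2\<^esub> b) =
     i1 B1 B2 \<star> typed A1 B1 a \<star> p1 A1 A2 \<boxplus> i2 B1 B2 \<star> typed A2 B2 b \<star> p2 A1 A2"
  using assms by (simp add: typed_matrix typed_zero)

lemma typed_antidiag:
  assumes "A1 \<in> Obj C" "A2 \<in> Obj C" "B1 \<in> Obj C" "B2 \<in> Obj C"
    "a \<in> Arr C A2 B1" "b \<in> Arr C A1 B2"
  shows "typed (DSum C A1 A2) (DSum C B1 B2)
      (matrix C A1 A2 B1 B2 \<zero>\<^bsub>Hom C A1 B1\<^esub> a b \<zero>\<^bsub>Hom C A2 B2\<^esub>) =
     i1 B1 B2 \<star> typed A2 B1 a \<star> p2 A1 A2 \<boxplus> i2 B1 B2 \<star> typed A1 B2 b \<star> p1 A1 A2"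
  using assms by (simp add: typed_matrix typed_zero)

lemma Isos_typed: "A \<in> Obj C \<Longrightarrow> B \<in> Obj C \<Longrightarrow> f \<in> Isos C A B \<longleftrightarrow> invertible (typed A B f)"
  by (auto simp: invertible_def Isos_def)

end

locale dual_category = additive_category k C
  for k :: "('k, 'r) ring_scheme" and C :: "('k, 'o, 'm) addcat" (structure) +
  fixes D :: "('o, 'm, 'o, 'm) func" and \<delta> :: "'o \<Rightarrow> 'm"
  assumes duality: "duality k C D \<delta>"
begin

abbreviation d where "d \<equiv> cmap D"

text \<open>
  The isomorphism \<open>\<delta>\<close> as a typed arrow; likewise \<open>lm\<close>, \<open>al\<close> and \<open>eps\<close> below are \<open>\<lambda>\<close>, \<open>\<alpha>\<close> and \<open>\<delta>\<^sub>\<alpha>\<close>.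
\<close>

definition bid where "bid A = typed A (ob D (ob D A)) (\<delta> A)"

lemma contra: "is_contrafunctor k C C D"
  using duality by (simp add: duality_def)

lemmas contra_simps [simp] = ob_contrafunctor[OF contra] valid_cmap[OF contra] src_cmap[OF contra]
  tgt_cmap[OF contra] cmap_one[OF contra] cmap_nil[OF contra] iso_cmap_iso[OF contra]
lemmas d_simps = cmap_simps[OF contra]

lemma iso_bid [simp]: "A \<in> Obj C \<Longrightarrow> invertible (bid A)"
  and valid_bid [simp]: "A \<in> Obj C \<Longrightarrow> valid (bid A)"
  and src_bid [simp]: "src (bid A) = A" and tgt_bid [simp]: "tgt (bid A) = ob D (ob D A)"
  using duality contra_simps(1)
  by (auto simp: duality_def nat_iso_def bid_def invertible_def func_comp_contra_def id_func_def Isos_def)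

lemma bid_natural:
  assumes "valid x" shows "d (d x) \<star> bid (src x) = bid (tgt x) \<star> x"
proof -
  obtain A B f where x: "x = typed A B f" "A \<in> Obj C" "B \<in> Obj C" "f \<in> Arr C A B"
    using assms by (rule validE)
  have f: "ar D A B f \<in> Arr C (ob D B) (ob D A)"
    using contra x by (simp add: is_contrafunctor_def)
  then have ff: "ar D (ob D B) (ob D A) (ar D A B f) \<in> Arr C (ob D (ob D A)) (ob D (ob D B))"
    using contra x by (simp add: is_contrafunctor_def)
  have n: "\<delta> B \<cdot> f = ar D (ob D B) (ob D A) (ar D A B f) \<cdot> \<delta> A"
    using duality x by (simp add: duality_def nat_iso_def func_comp_contra_def id_func_def)
  have "\<delta> A \<in> Arr C A (ob D (ob D A))" "\<delta> B \<in> Arr C B (ob D (ob D B))"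
    using valid_bid[of A] valid_bid[of B] x by (simp_all add: bid_def)
  with x f ff show ?thesis by (simp add: cmap_def bid_def mul_typed n)
qed

lemma bid_triangle: "A \<in> Obj C \<Longrightarrow> d (bid A) \<star> bid (ob D A) = ident (ob D A)"
proof -
  assume A: "A \<in> Obj C"
  let ?x = "d (bid A)"
  have x: "?x = typed (ob D (ob D (ob D A))) (ob D A) (ar D A (ob D (ob D A)) (\<delta> A))"
    using A valid_bid[OF A] by (simp add: cmap_def) (simp add: bid_def)
  have "\<delta> (ob D A) = inverse_arr C (ob D (ob D (ob D A))) (ob D A) (ar D A (ob D (ob D A)) (\<delta> A))"
    using duality A by (simp add: duality_def)
  then have "bid (ob D A) = typed (ob D A) (ob D (ob D (ob D A)))
      (inverse_arr C (ob D (ob D (ob D A))) (ob D A) (ar D A (ob D (ob D A)) (\<delta> A)))"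
    by (simp add: bid_def)
  also have "\<dots> = arrinv ?x"
    using A iso_cmap_iso[OF contra iso_bid[OF A]] unfolding x
    by (intro typed_inverse_arr) (simp_all add: invertible_def)
  finally show ?thesis using A by (simp add: mul_inv)
qed

lemma arr_bid: "A \<in> Obj C \<Longrightarrow> \<delta> A \<in> Arr C A (ob D (ob D A))"
  using valid_bid[of A] by (simp add: bid_def)

end

text \<open>
  The axiom \<open>\<delta>\<^bsub>D(A)\<^esub> = D(\<delta>\<^bsub>A\<^esub>)\<^bsup>-1\<^esup>\<close> follows from a one-sided equation, because \<open>D(\<delta>\<^bsub>A\<^esub>)\<close> is already
  invertible.
\<close>

lemma (in additive_category) dualityI:
  assumes D: "is_contrafunctor k C C D"
    and iso: "\<And>A. A \<in> Obj C \<Longrightarrow> invertible (typed A (ob D (ob D A)) (\<delta> A))"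
    and nat: "\<And>x. valid x \<Longrightarrow> cmap D (cmap D x) \<star> typed (src x) (ob D (ob D (src x))) (\<delta> (src x))
      = typed (tgt x) (ob D (ob D (tgt x))) (\<delta> (tgt x)) \<star> x"
    and tri: "\<And>A. A \<in> Obj C \<Longrightarrow> cmap D (typed A (ob D (ob D A)) (\<delta> A)) \<star>
      typed (ob D A) (ob D (ob D (ob D A))) (\<delta> (ob D A)) = ident (ob D A)"
  shows "duality k C D \<delta>"
proof -
  note [simp] = ob_contrafunctor[OF D]
  have a: "\<delta> A \<in> Arr C A (ob D (ob D A))" "\<delta> A \<in> Isos C A (ob D (ob D A))" if "A \<in> Obj C" for A
    using iso[OF that] by (auto simp: invertible_def)
  have "\<delta> B \<cdot> f = ar D (ob D B) (ob D A) (ar D A B f) \<cdot> \<delta> A"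
    if x: "A \<in> Obj C" "B \<in> Obj C" "f \<in> Arr C A B" for A B f
  proof -
    have f: "ar D A B f \<in> Arr C (ob D B) (ob D A)"
      using D x by (simp add: is_contrafunctor_def)
    then have ff: "ar D (ob D B) (ob D A) (ar D A B f) \<in> Arr C (ob D (ob D A)) (ob D (ob D B))"
      using D x by (simp add: is_contrafunctor_def)
    show ?thesis using nat[of "typed A B f"] x f ff a by (simp add: cmap_def mul_typed)
  qed
  moreover have "\<delta> (ob D A) =
     inverse_arr C (ob D (ob D (ob D A))) (ob D A) (ar D A (ob D (ob D A)) (\<delta> A))"
    if A: "A \<in> Obj C" for A
  proof -
    let ?x = "typed A (ob D (ob D A)) (\<delta> A)"
    let ?y = "typed (ob D A) (ob D (ob D (ob D A))) (\<delta> (ob D A))"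
    have x: "invertible (cmap D ?x)" using iso A by (intro iso_cmap_iso[OF D])
    have e: "cmap D ?x = typed (ob D (ob D (ob D A))) (ob D A) (ar D A (ob D (ob D A)) (\<delta> A))"
      using A a by (simp add: cmap_def)
    have "?y = arrinv (cmap D ?x) \<star> (cmap D ?x \<star> ?y)"
      using x A a by (simp add: valid_cmap[OF D] src_cmap[OF D] tgt_cmap[OF D])
    also have "\<dots> = arrinv (cmap D ?x)" using x A unfolding tri[OF A] by (simp add: e)
    finally show ?thesis using x by (simp add: e arrinv_def)
  qed
  ultimately show ?thesis
    using D a by (simp add: duality_def nat_iso_def func_comp_contra_def id_func_def)
qed

context dual_category
begin

lemma typed_neg_bidual:
  "A \<in> Obj C \<Longrightarrow> typed A (ob D (ob D A)) (neg_bidual C D \<delta> A) = neg (bid A)"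
  by (simp add: neg_def) (simp add: bid_def neg_bidual_def)

lemma neg_duality: "duality k C D (neg_bidual C D \<delta>)"
proof (rule dualityI)
  fix x assume "valid x"
  then show "d (d x) \<star> typed (src x) (ob D (ob D (src x))) (neg_bidual C D \<delta> (src x))
      = typed (tgt x) (ob D (ob D (tgt x))) (neg_bidual C D \<delta> (tgt x)) \<star> x"
    by (simp add: typed_neg_bidual bid_natural)
qed (simp_all add: contra typed_neg_bidual bid_triangle d_simps)

lemma typed_hyperbolic_form:
  assumes L: "L \<in> Obj C"
  shows "typed (DSum C L (ob D L)) (ob D (DSum C L (ob D L))) (snd (hyperbolic_space C D \<delta> L))
    = d (p1 L (ob D L)) \<star> p2 L (ob D L) \<boxplus> d (p2 L (ob D L)) \<star> bid L \<star> p1 L (ob D L)"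
proof -
  let ?S = "DSum C L (ob D L)" and ?T = "DSum C (ob D L) (ob D (ob D L))"
  let ?M = "matrix C L (ob D L) (ob D L) (ob D (ob D L))
        \<zero>\<^bsub>Hom C L (ob D L)\<^esub> (Id C (ob D L)) (\<delta> L) \<zero>\<^bsub>Hom C (ob D L) (ob D (ob D L))\<^esub>"
  note j = typed_sum_join[OF contra L contra_simps(1)[OF L]]
  have m: "typed ?S ?T ?M = i1 (ob D L) (ob D (ob D L)) \<star> p2 L (ob D L)
      \<boxplus> i2 (ob D L) (ob D (ob D L)) \<star> bid L \<star> p1 L (ob D L)"
    using L arr_bid[OF L] by (subst typed_antidiag) (simp_all add: typed_Id Id_arr bid_def)
  have "valid (typed ?T (ob D ?S) (sum_join C D L (ob D L)))" "valid (typed ?S ?T ?M)"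
    unfolding j m using L by simp_all
  from typed_mul[OF this] show ?thesis
    unfolding j m using L by (simp add: hyperbolic_space_def mul_pls pls_mul mul_assoc)
qed

lemma symmetric_space_typed:
  assumes "A \<in> Obj C"
  shows "symmetric_space C D \<delta> (A, h) \<longleftrightarrow> invertible (typed A (ob D A) h) \<and>
    d (typed A (ob D A) h) \<star> bid A = typed A (ob D A) h"
proof -
  have "d (typed A (ob D A) h) \<star> bid A = typed A (ob D A) (ar D A (ob D A) h \<cdot> \<delta> A)"
    if "h \<in> Arr C A (ob D A)"
    using that assms arr_bid[OF assms] valid_cmap[OF contra, of "typed A (ob D A) h"]
    by (simp add: cmap_def bid_def mul_typed)
  then show ?thesis
    using assms by (auto simp: symmetric_space_def Isos_typed invertible_def Isos_def)
qed

text \<open>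
  The arrow \<open>x\<close> with components \<open>r\<close> and \<open>q\<close> is an isomorphism from \<open>V\<close> to \<open>L \<oplus> D(L)\<close> with inverse
  given by \<open>s\<close> and \<open>t\<close>, and \<open>b = D(x) H x\<close> for the hyperbolic form \<open>H\<close>. The symmetry of \<open>b\<close>
  holds because \<open>D(\<delta>\<^bsub>L\<^esub>) \<delta>\<^bsub>D(L)\<^esub> = 1\<close> makes the two summands of \<open>b\<close> each other's transposes, and
  the inverse of \<open>b\<close> is \<open>t D(s) + s \<delta>\<^bsub>L\<^esub>\<^bsup>-1\<^esup> D(t)\<close>. The isomorphism itself is part of the conclusion
  since it has to be shown to lie in the double category in \<open>difference_hyperbolic\<close>.
\<close>

lemma pullback_of_hyperbolic:
  assumes V: "V \<in> Obj C" and L: "L \<in> Obj C"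
    and r: "valid r" "src r = V" "tgt r = L" and q: "valid q" "src q = V" "tgt q = ob D L"
    and s: "valid s" "src s = L" "tgt s = V" and t: "valid t" "src t = ob D L" "tgt t = V"
    and rs: "r \<star> s = ident L" and rt: "r \<star> t = nil (ob D L) L"
    and qs: "q \<star> s = nil L (ob D L)" and qt: "q \<star> t = ident (ob D L)"
    and sum: "s \<star> r \<boxplus> t \<star> q = ident V"
    and b: "typed V (ob D V) b = d r \<star> q \<boxplus> d q \<star> bid L \<star> r"
  defines "x \<equiv> i1 L (ob D L) \<star> r \<boxplus> i2 L (ob D L) \<star> q"
    and "x' \<equiv> s \<star> p1 L (ob D L) \<boxplus> t \<star> p2 L (ob D L)"
  shows "symmetric_space C D \<delta> (V, b)" (is ?sym)
    and "x' \<star> x = ident V" and "x \<star> x' = ident (DSum C L (ob D L))"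
    and "raw x \<in> Arr (herm_cat C D \<delta>) (V, b) (hyperbolic_space C D \<delta> L)" (is ?isom)
proof -
  note [simp] = V L r q s t
  note lift = mul_lift
  have px: "p1 L (ob D L) \<star> x = r" "p2 L (ob D L) \<star> x = q"
    by (simp_all add: x_def mul_pls)
  show 1: "x' \<star> x = ident V"
    by (simp add: x'_def px pls_mul mul_assoc sum)
  show 2: "x \<star> x' = ident (DSum C L (ob D L))"
    by (simp add: x'_def x_def mul_pls pls_mul mul_assoc lift[OF rs] lift[OF rt] lift[OF qs]
        lift[OF qt] sum_one)
  have vx: "valid x" "src x = V" "tgt x = DSum C L (ob D L)"
    by (simp_all add: x_def)
  have ix: "invertible x" using isoI[of x x'] 1 2 vx by simp
  let ?H = "typed (DSum C L (ob D L)) (ob D (DSum C L (ob D L))) (snd (hyperbolic_space C D \<delta> L))"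
  have vH: "valid ?H" by (subst typed_hyperbolic_form) simp_all
  have dx: "d x \<star> d (p1 L (ob D L)) = d r" "d x \<star> d (p2 L (ob D L)) = d q"
    by (simp_all add: vx px flip: cmap_mul[OF contra])
  have B: "d x \<star> ?H \<star> x = typed V (ob D V) b"
    by (simp add: typed_hyperbolic_form b mul_pls pls_mul mul_assoc px lift[OF dx(1)] lift[OF dx(2)])
  have bb: "valid (typed V (ob D V) b)" unfolding b by simp
  show ?isom
  proof -
    have "ar D V (DSum C L (ob D L)) (raw x) \<cdot> snd (hyperbolic_space C D \<delta> L) \<cdot> raw x
      = raw (d x \<star> ?H \<star> x)"
      using vH vx by (simp add: raw_simps)
    also have "\<dots> = b" by (simp add: B)
    finally have "ar D V (DSum C L (ob D L)) (raw x) \<cdot> snd (hyperbolic_space C D \<delta> L) \<cdot> raw x = b" .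
    with ix vx show ?thesis
      by (simp add: herm_cat_def hyperbolic_space_def invertible_def)
  qed
  have ds: "d s \<star> d r = ident (ob D L)" "d t \<star> d r = nil (ob D L) (ob D (ob D L))"
    "d s \<star> d q = nil (ob D (ob D L)) (ob D L)" "d t \<star> d q = ident (ob D (ob D L))"
    using rs rt qs qt by (simp_all flip: cmap_mul[OF contra])
  have dsum: "d r \<star> d s \<boxplus> d q \<star> d t = ident (ob D V)"
    using sum by (simp flip: cmap_mul[OF contra] cmap_pls[OF contra])
  let ?B = "d r \<star> q \<boxplus> d q \<star> bid L \<star> r"
  let ?B' = "t \<star> d s \<boxplus> s \<star> arrinv (bid L) \<star> d t"
  have "?B' \<star> ?B = ident V"
    using sum
    by (simp add: mul_pls pls_mul mul_assoc lift[OF ds(1)] lift[OF ds(2)] lift[OF ds(3)] lift[OF ds(4)]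
        pls_comm)
  moreover have "?B \<star> ?B' = ident (ob D V)"
    by (simp add: mul_pls pls_mul mul_assoc lift[OF rs] lift[OF rt] lift[OF qs]
        lift[OF qt] dsum)
  ultimately have i: "invertible ?B" using isoI[of ?B ?B'] by simp
  have nat: "d (d r) \<star> bid V = bid L \<star> r" "d (d q) \<star> bid V = bid (ob D L) \<star> q"
    using bid_natural[of r] bid_natural[of q] by simp_all
  have "d ?B \<star> bid V = ?B"
    by (simp add: d_simps mul_pls pls_mul mul_assoc nat lift[OF bid_triangle[OF L]] pls_comm)
  with i show ?sym by (simp add: symmetric_space_typed b)
qed

lemma hyperbolicI:
  assumes "V \<in> Obj C" "L \<in> Obj C"
    "valid r" "src r = V" "tgt r = L" "valid q" "src q = V" "tgt q = ob D L"
    "valid s" "src s = L" "tgt s = V" "valid t" "src t = ob D L" "tgt t = V"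
    "r \<star> s = ident L" "r \<star> t = nil (ob D L) L" "q \<star> s = nil L (ob D L)" "q \<star> t = ident (ob D L)"
    "s \<star> r \<boxplus> t \<star> q = ident V"
    "typed V (ob D V) b = d r \<star> q \<boxplus> d q \<star> bid L \<star> r"
  shows "hyperbolic C D \<delta> (V, b)"
  using pullback_of_hyperbolic[OF assms] assms(2) by (auto simp: hyperbolic_def)

text \<open>
  The isomorphism \<open>\<kappa>\<close> identifies \<open>A \<oplus> B\<close> with \<open>A \<oplus> D(A)\<close>; the two off-diagonal entries of a symmetric
  form determine each other, which is why one of them appears as \<open>D(\<kappa>) \<delta>\<^bsub>A\<^esub>\<close>.
\<close>

lemma off_diagonal_hyperbolic:
  assumes A: "A \<in> Obj C" and B: "B \<in> Obj C"
    and \<kappa>: "invertible \<kappa>" "src \<kappa> = B" "tgt \<kappa> = ob D A"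
    and b: "typed (DSum C A B) (ob D (DSum C A B)) b
      = d (p1 A B) \<star> \<kappa> \<star> p2 A B \<boxplus> d (p2 A B) \<star> (d \<kappa> \<star> bid A) \<star> p1 A B"
  shows "hyperbolic C D \<delta> (DSum C A B, b)"
proof (rule hyperbolicI[of _ A "p1 A B" "\<kappa> \<star> p2 A B" "i1 A B" "i2 A B \<star> arrinv \<kappa>"])
  note [simp] = A B \<kappa>
  show "typed (DSum C A B) (ob D (DSum C A B)) b = d (p1 A B) \<star> \<kappa> \<star> p2 A B \<boxplus>
      d (\<kappa> \<star> p2 A B) \<star> bid A \<star> p1 A B"
    by (simp add: b d_simps mul_assoc)
  show "i1 A B \<star> p1 A B \<boxplus> (i2 A B \<star> arrinv \<kappa>) \<star> \<kappa> \<star> p2 A B = ident (DSum C A B)"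
    by (simp add: mul_assoc sum_one)
qed (use A B \<kappa> in \<open>simp_all add: mul_assoc mul_inv\<close>)

end

section \<open>The double category\<close>

lemma (in additive_category) proj_pair:
  assumes "valid r" "tgt r = A" "valid q" "tgt q = B" "src r = src q"
  shows "p1 A B \<star> (i1 A B \<star> r \<boxplus> i2 A B \<star> q) = r" "p2 A B \<star> (i1 A B \<star> r \<boxplus> i2 A B \<star> q) = q"
  using assms by (auto simp: mul_pls)

locale conj_category = additive_category k C
  for k :: "('k, 'r) ring_scheme" and C :: "('k, 'o, 'm) addcat" (structure) +
  fixes \<iota> :: "('o, 'm, 'o, 'm) func" and lam :: "'o \<Rightarrow> 'm"
  assumes conjugation: "conjugation k C \<iota> lam"
begin

abbreviation I where "I \<equiv> fmap \<iota>"

definition lm where "lm A = typed (ob \<iota> (ob \<iota> A)) A (lam A)"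

definition struct where "struct X = typed (ob \<iota> (fst X)) (fst X) (snd X)"

lemma conj_functor: "is_functor k C C \<iota>"
  using conjugation by (simp add: conjugation_def)

lemmas I_simp [simp] = ob_functor[OF conj_functor] valid_fmap[OF conj_functor]
  src_fmap[OF conj_functor] tgt_fmap[OF conj_functor] fmap_one[OF conj_functor]
  fmap_nil[OF conj_functor] iso_fmap_iso[OF conj_functor]
lemmas I_simps = fmap_simps[OF conj_functor]

lemma iso_lm [simp]: "A \<in> Obj C \<Longrightarrow> invertible (lm A)"
  and valid_lm [simp]: "A \<in> Obj C \<Longrightarrow> valid (lm A)"
  and src_lm [simp]: "src (lm A) = ob \<iota> (ob \<iota> A)" and tgt_lm [simp]: "tgt (lm A) = A"
  using conjugation I_simp(1)
  by (auto simp: conjugation_def nat_iso_def lm_def invertible_def func_comp_def id_func_def Isos_def)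

lemma lm_natural: assumes "valid x" shows "lm (tgt x) \<star> I (I x) = x \<star> lm (src x)"
proof -
  obtain A B f where x: "x = typed A B f" "A \<in> Obj C" "B \<in> Obj C" "f \<in> Arr C A B"
    using assms by (rule validE)
  have n: "lam B \<cdot> ar \<iota> (ob \<iota> A) (ob \<iota> B) (ar \<iota> A B f) = f \<cdot> lam A"
    using conjugation x by (simp add: conjugation_def nat_iso_def func_comp_def id_func_def)
  have v: "valid (I (I x))" "valid (lm A)" "valid (lm B)" using x by simp_all
  have "lm (tgt x) \<star> I (I x) = typed (ob \<iota> (ob \<iota> A)) B (lam B \<cdot> raw (I (I x)))"
    using v x by (subst typed_eqI[symmetric, of "lm (tgt x) \<star> I (I x)"])
      (simp_all add: raw_mul, simp add: lm_def)
  also have "raw (I (I x)) = ar \<iota> (ob \<iota> A) (ob \<iota> B) (ar \<iota> A B f)"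
    using x by (simp add: raw_fmap)
  also have "typed (ob \<iota> (ob \<iota> A)) B (lam B \<cdot> \<dots>) = x \<star> lm (src x)"
    unfolding n using v x by (intro typed_eqI) (simp_all add: raw_mul, simp add: lm_def)
  finally show ?thesis .
qed

lemma lm_conj: "A \<in> Obj C \<Longrightarrow> lm (ob \<iota> A) = I (lm A)"
  using conjugation valid_lm[of A] by (simp add: conjugation_def fmap_def) (simp add: lm_def)

abbreviation CC where "CC \<equiv> double_cat C \<iota> lam"

lemma double_Obj:
  "X \<in> Obj CC \<longleftrightarrow> fst X \<in> Obj C \<and> invertible (struct X) \<and> struct X \<star> I (struct X) = lm (fst X)"
proof -
  have "struct X \<star> I (struct X) = typed (ob \<iota> (ob \<iota> (fst X))) (fst X)
     (snd X \<cdot> ar \<iota> (ob \<iota> (fst X)) (fst X) (snd X))" if "fst X \<in> Obj C" "valid (struct X)"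
    using that valid_fmap[OF conj_functor, of "struct X"]
    by (simp add: struct_def fmap_def mul_typed)
  then show ?thesis
    by (cases X) (auto simp: double_cat_def Isos_typed lm_def struct_def invertible_def Isos_def)
qed

lemma double_Arr:
  assumes "fst X \<in> Obj C" "fst Y \<in> Obj C" "valid (struct X)" "valid (struct Y)"
  shows "\<phi> \<in> Arr CC X Y \<longleftrightarrow> valid (typed (fst X) (fst Y) \<phi>) \<and>
    typed (fst X) (fst Y) \<phi> \<star> struct X = struct Y \<star> I (typed (fst X) (fst Y) \<phi>)"
proof -
  have "typed (fst X) (fst Y) \<phi> \<star> struct X = typed (ob \<iota> (fst X)) (fst Y) (\<phi> \<cdot> snd X)"
    "struct Y \<star> I (typed (fst X) (fst Y) \<phi>) = typed (ob \<iota> (fst X)) (fst Y) (snd Y \<cdot> ar \<iota> (fst X) (fst Y) \<phi>)"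
    if "\<phi> \<in> Arr C (fst X) (fst Y)"
    using that assms valid_fmap[OF conj_functor, of "typed (fst X) (fst Y) \<phi>"]
    by (simp_all add: struct_def mul_typed fmap_def)
  then show ?thesis
    using assms by (cases X, cases Y) (auto simp: double_cat_def)
qed

lemma src_str [simp]: "src (struct X) = ob \<iota> (fst X)" and tgt_str [simp]: "tgt (struct X) = fst X"
  by (simp_all add: struct_def)

lemma double_Comp [simp]: "Comp CC = Comp C" and double_Id: "Id CC X = Id C (fst X)"
  by (simp_all add: double_cat_def case_prod_beta)

text \<open>
  Multiplying the equation that makes \<open>\<phi>\<close> a morphism of the double category by the inverse on both
  sides gives the same equation for the inverse; so inverses may be computed in \<open>C\<close>.
\<close>

lemma double_inverse:
  assumes "fst X \<in> Obj C" "fst Y \<in> Obj C" "valid (struct X)" "valid (struct Y)"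
    and "invertible (typed (fst X) (fst Y) \<phi>)" "\<phi> \<in> Arr CC X Y"
  shows "is_inverse CC X Y \<phi> (raw (arrinv (typed (fst X) (fst Y) \<phi>)))"
proof -
  let ?x = "typed (fst X) (fst Y) \<phi>"
  have e: "?x \<star> struct X = struct Y \<star> I ?x" using assms double_Arr by blast
  have [simp]: "\<phi> \<in> Arr C (fst X) (fst Y)" using assms iso_valid[OF assms(5)] by simp
  have x: "?x \<star> (arrinv ?x \<star> struct Y) = ?x \<star> (struct X \<star> I (arrinv ?x))"
    using assms mul_lift[OF e, of "I (arrinv ?x)"]
    by (simp add: mul_assoc I_simps mul_inv)
  then have "arrinv ?x \<star> struct Y = struct X \<star> I (arrinv ?x)"
    by (rule mul_left_eq[OF assms(5)]) (use assms in simp)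
  moreover have t: "typed (fst Y) (fst X) (raw (arrinv ?x)) = arrinv ?x"
    using assms by (intro typed_eqI) simp_all
  ultimately have "raw (arrinv ?x) \<in> Arr CC Y X"
    using assms by (simp add: double_Arr)
  moreover have "is_inverse C (fst X) (fst Y) \<phi> (raw (arrinv ?x))"
    using assms iso_valid[OF assms(5)]
    by (simp add: is_inverse_typed t inv_mul mul_inv)
  ultimately show ?thesis by (simp add: is_inverse_def double_Id)
qed

lemma double_Isos:
  assumes "fst X \<in> Obj C" "fst Y \<in> Obj C" "valid (struct X)" "valid (struct Y)"
    and "invertible (typed (fst X) (fst Y) \<phi>)" "\<phi> \<in> Arr CC X Y"
  shows "\<phi> \<in> Isos CC X Y"
  using double_inverse[OF assms] assms(6) by (auto simp: Isos_def)

lemma double_inverse_arr: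
  assumes "fst X \<in> Obj C" "fst Y \<in> Obj C" "valid (struct X)" "valid (struct Y)"
    and "invertible (typed (fst X) (fst Y) \<phi>)" "\<phi> \<in> Arr CC X Y"
  shows "inverse_arr CC X Y \<phi> = raw (arrinv (typed (fst X) (fst Y) \<phi>))"
  unfolding inverse_arr_def
proof (rule the_equality)
  show "is_inverse CC X Y \<phi> (raw (arrinv (typed (fst X) (fst Y) \<phi>)))"
    by (rule double_inverse[OF assms])
  fix g assume g: "is_inverse CC X Y \<phi> g"
  then have gA: "g \<in> Arr C (fst Y) (fst X)"
    using assms double_Arr[of Y X g] by (simp add: is_inverse_def)
  have "is_inverse C (fst X) (fst Y) \<phi> g"
    using g gA by (simp add: is_inverse_def double_Id)
  then have "typed (fst Y) (fst X) g = arrinv (typed (fst X) (fst Y) \<phi>)"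
    using assms iso_valid[OF assms(5)]
    by (simp add: is_inverse_typed isoI(2)[of _ "typed (fst Y) (fst X) g"])
  then show "g = raw (arrinv (typed (fst X) (fst Y) \<phi>))"
    by (metis raw_typed)
qed

text \<open>
  Negation in a group of morphisms is defined by a description relative to its carrier, and the
  carrier in the double category is smaller. The two negations agree because the set of
  morphisms compatible with the structure morphisms is closed under the negation of \<open>C\<close>.
\<close>

lemma double_a_inv:
  assumes "fst X \<in> Obj C" "fst Y \<in> Obj C" "valid (struct X)" "valid (struct Y)" "\<phi> \<in> Arr CC X Y"
  shows "\<ominus>\<^bsub>Hom CC X Y\<^esub> \<phi> = \<ominus>\<^bsub>Hom C (fst X) (fst Y)\<^esub> \<phi>"
proof -
  let ?t = "typed (fst X) (fst Y)"
  have v: "valid (?t \<phi>)" "?t \<phi> \<star> struct X = struct Y \<star> I (?t \<phi>)"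
    using assms double_Arr by blast+
  then have t: "?t (\<ominus>\<^bsub>Hom C (fst X) (fst Y)\<^esub> \<phi>) = neg (?t \<phi>)" using assms by (simp add: typed_neg)
  have n: "\<ominus>\<^bsub>Hom C (fst X) (fst Y)\<^esub> \<phi> \<in> Arr CC X Y"
    using assms v by (simp add: double_Arr t I_simps del: valid_typed)
  have plus: "hom_add CC X Y = hom_add C (fst X) (fst Y)" "hom_zero CC X Y = hom_zero C (fst X) (fst Y)"
    by (simp_all add: double_cat_def case_prod_beta)
  interpret abelian_group "Hom C (fst X) (fst Y)" using hom_grp assms by blast
  show ?thesis
    unfolding a_inv_def[of "Hom CC X Y"] m_inv_def
  proof (rule the_equality)
    show "\<ominus>\<^bsub>Hom C (fst X) (fst Y)\<^esub> \<phi> \<in> carrier (add_monoid (Hom CC X Y)) \<and>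
        \<phi> \<otimes>\<^bsub>add_monoid (Hom CC X Y)\<^esub> (\<ominus>\<^bsub>Hom C (fst X) (fst Y)\<^esub> \<phi>) = \<one>\<^bsub>add_monoid (Hom CC X Y)\<^esub> \<and>
        (\<ominus>\<^bsub>Hom C (fst X) (fst Y)\<^esub> \<phi>) \<otimes>\<^bsub>add_monoid (Hom CC X Y)\<^esub> \<phi> = \<one>\<^bsub>add_monoid (Hom CC X Y)\<^esub>"
      using n v r_neg[of \<phi>] l_neg[of \<phi>] by (simp add: Hom_def plus)
  next
    fix y assume y: "y \<in> carrier (add_monoid (Hom CC X Y)) \<and>
        \<phi> \<otimes>\<^bsub>add_monoid (Hom CC X Y)\<^esub> y = \<one>\<^bsub>add_monoid (Hom CC X Y)\<^esub> \<and>
        y \<otimes>\<^bsub>add_monoid (Hom CC X Y)\<^esub> \<phi> = \<one>\<^bsub>add_monoid (Hom CC X Y)\<^esub>"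
    then have "y \<in> Arr C (fst X) (fst Y)"
      using assms double_Arr[of X Y y] by (simp add: Hom_def)
    moreover have "y \<oplus>\<^bsub>Hom C (fst X) (fst Y)\<^esub> \<phi> = \<zero>\<^bsub>Hom C (fst X) (fst Y)\<^esub>"
      using y by (simp add: Hom_def plus)
    ultimately show "y = \<ominus>\<^bsub>Hom C (fst X) (fst Y)\<^esub> \<phi>"
      using v minus_equality by simp
  qed
qed

end

text \<open>
  A functor \<open>DD\<close> and a family \<open>\<delta>\<delta>\<close> on the double category that lie over a duality \<open>(D, \<delta>)\<close> of \<open>C\<close>.
  The assumption \<open>lift_str\<close> with \<open>u = v\<close> says that \<open>DD\<close> maps morphisms to morphisms; the version with
  two arrows is needed for the coordinates \<open>P\<close> and \<open>Q\<close>, which the structure morphism of \<open>F(A)\<close>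
  interchanges.
\<close>

locale lifted_duality = dual_category k C D \<delta> + conj_category k C \<iota> lam
  for k :: "('k, 'r) ring_scheme" and C :: "('k, 'o, 'm) addcat" (structure)
    and D :: "('o, 'm, 'o, 'm) func" and \<delta> :: "'o \<Rightarrow> 'm"
    and \<iota> :: "('o, 'm, 'o, 'm) func" and lam :: "'o \<Rightarrow> 'm" +
  fixes DD :: "('o \<times> 'm, 'm, 'o \<times> 'm, 'm) func" and \<delta>\<delta> :: "'o \<times> 'm \<Rightarrow> 'm"
  assumes lift_Obj: "X \<in> Obj CC \<Longrightarrow> ob DD X \<in> Obj CC"
    and lift_ob: "fst (ob DD X) = ob D (fst X)"
    and lift_ar: "ar DD X Y \<phi> = ar D (fst X) (fst Y) \<phi>"
    and lift_bid: "X \<in> Obj CC \<Longrightarrow> \<delta>\<delta> X = \<delta> (fst X)"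
    and lift_str: "\<lbrakk>X \<in> Obj CC; Y \<in> Obj CC; valid u; valid v; src u = fst X; src v = fst X;
      tgt u = fst Y; tgt v = fst Y; u \<star> struct X = struct Y \<star> I v\<rbrakk>
      \<Longrightarrow> d u \<star> struct (ob DD Y) = struct (ob DD X) \<star> I (d v)"
begin

lemma lift_symmetric:
  assumes "symmetric_space CC DD \<delta>\<delta> (Y, h)"
  shows "invertible (typed (fst Y) (ob D (fst Y)) h)"
    and "d (typed (fst Y) (ob D (fst Y)) h) \<star> bid (fst Y) = typed (fst Y) (ob D (fst Y)) h"
    and "typed (fst Y) (ob D (fst Y)) h \<star> struct Y = struct (ob DD Y) \<star> I (typed (fst Y) (ob D (fst Y)) h)"
proof -
  have Y: "Y \<in> Obj CC" and h: "h \<in> Isos CC Y (ob DD Y)"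
    and s: "ar D (fst Y) (ob D (fst Y)) h \<cdot> \<delta> (fst Y) = h"
    using assms by (auto simp: symmetric_space_def lift_ar lift_ob lift_bid)
  have o: "fst Y \<in> Obj C" "valid (struct Y)" "fst (ob DD Y) \<in> Obj C" "valid (struct (ob DD Y))"
    using Y lift_Obj[OF Y] by (simp_all add: double_Obj)
  obtain g where g: "is_inverse CC Y (ob DD Y) h g" and hA: "h \<in> Arr CC Y (ob DD Y)"
    using h by (auto simp: Isos_def)
  have ha: "h \<in> Arr C (fst Y) (fst (ob DD Y))"
    and e: "typed (fst Y) (fst (ob DD Y)) h \<star> struct Y = struct (ob DD Y) \<star> I (typed (fst Y) (fst (ob DD Y)) h)"
    using hA o by (simp_all add: double_Arr)
  have "g \<in> Arr C (fst (ob DD Y)) (fst Y)"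
    using g o double_Arr[of "ob DD Y" Y g] by (simp add: is_inverse_def)
  then have "is_inverse C (fst Y) (fst (ob DD Y)) h g"
    using g by (simp add: is_inverse_def double_Id)
  with ha have "h \<in> Isos C (fst Y) (fst (ob DD Y))" by (auto simp: Isos_def)
  with s o(1) have "symmetric_space C D \<delta> (fst Y, h)" by (simp add: symmetric_space_def lift_ob)
  then show "invertible (typed (fst Y) (ob D (fst Y)) h)"
    "d (typed (fst Y) (ob D (fst Y)) h) \<star> bid (fst Y) = typed (fst Y) (ob D (fst Y)) h"
    using o by (simp_all add: symmetric_space_typed)
  from e show "typed (fst Y) (ob D (fst Y)) h \<star> struct Y = struct (ob DD Y) \<star> I (typed (fst Y) (ob D (fst Y)) h)"
    by (simp add: lift_ob)
qed

text \<open>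
  Direct sums, zero morphisms and the canonical isomorphisms of the double category are those of
  \<open>C\<close>, so hyperbolic forms of the double category are hyperbolic forms of \<open>C\<close>.
\<close>

lemma lift_hyperbolic_space:
  assumes "X \<in> Obj CC"
  shows "hyperbolic_space CC DD \<delta>\<delta> X
    = (DSum CC X (ob DD X), snd (hyperbolic_space C D \<delta> (fst X)))"
  using assms lift_ob lift_ar lift_bid[OF assms]
  by (simp add: hyperbolic_space_def sum_join_def matrix_def Let_def)
    (simp add: double_cat_def case_prod_beta Hom_def)

lemma str_DSum:
  assumes "fst X \<in> Obj C" "fst Y \<in> Obj C" "valid (struct X)" "valid (struct Y)"
  shows "fst (DSum CC X Y) = DSum C (fst X) (fst Y)"
    and "struct (DSum CC X Y) = i1 (fst X) (fst Y) \<star> struct X \<star> I (p1 (fst X) (fst Y))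
      \<boxplus> i2 (fst X) (fst Y) \<star> struct Y \<star> I (p2 (fst X) (fst Y))"
proof -
  let ?A = "fst X" and ?B = "fst Y"
  show 1: "fst (DSum CC X Y) = DSum C ?A ?B" by (simp add: double_cat_def case_prod_beta)
  let ?S = "DSum C (ob \<iota> ?A) (ob \<iota> ?B)"
  let ?M = "matrix C (ob \<iota> ?A) (ob \<iota> ?B) ?A ?B (snd X) \<zero>\<^bsub>Hom C (ob \<iota> ?B) ?A\<^esub>
    \<zero>\<^bsub>Hom C (ob \<iota> ?A) ?B\<^esub> (snd Y)"
  have m: "typed ?S (DSum C ?A ?B) ?M = i1 ?A ?B \<star> struct X \<star> p1 (ob \<iota> ?A) (ob \<iota> ?B)
     \<boxplus> i2 ?A ?B \<star> struct Y \<star> p2 (ob \<iota> ?A) (ob \<iota> ?B)"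
    using assms unfolding struct_def by (intro typed_diag) simp_all
  note s = typed_sum_split[OF conj_functor assms(1,2)]
  have "valid (typed ?S (DSum C ?A ?B) ?M)"
    "valid (typed (ob \<iota> (DSum C ?A ?B)) ?S (sum_split C \<iota> ?A ?B))"
    unfolding m s using assms by simp_all
  from typed_mul[OF this]
  have "struct (DSum CC X Y) = typed ?S (DSum C ?A ?B) ?M \<star> typed (ob \<iota> (DSum C ?A ?B)) ?S (sum_split C \<iota> ?A ?B)"
    unfolding struct_def 1 by (simp add: double_cat_def case_prod_beta)
  then show "struct (DSum CC X Y) = i1 ?A ?B \<star> struct X \<star> I (p1 ?A ?B) \<boxplus> i2 ?A ?B \<star> struct Y \<star> I (p2 ?A ?B)"
    unfolding m s using assms by (simp add: mul_pls pls_mul mul_assoc)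
qed

text \<open>
  With \<open>P = p\<^sub>1\<close> and \<open>Q = f p\<^sub>2\<close>, where \<open>f\<close> is the structure morphism of \<open>X\<close>, the form is
  \<open>D(P) b\<^sub>0 P - D(Q) b\<^sub>0 Q\<close>, the orthogonal sum of \<open>b\<^sub>0\<close> and \<open>-b\<^sub>0\<close>. It is hyperbolic through
  \<open>r = P + Q\<close> and \<open>q = c b\<^sub>0 (P - Q)\<close>, where \<open>c\<close> is one half, because
  \<open>(P + Q)(P - Q) + (P - Q)(P + Q)\<close> is twice \<open>P P - Q Q\<close>. The structure morphism of \<open>Y\<close> exchanges \<open>P\<close>
  and \<open>Q\<close>, hence fixes \<open>P + Q\<close> and negates \<open>P - Q\<close>; by hypothesis \<open>anti\<close> the arrow \<open>b\<^sub>0\<close> absorbs the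
  sign, and \<open>r\<close> and \<open>q\<close> are morphisms of the double category.
\<close>

lemma difference_hyperbolic:
  assumes X: "X \<in> Obj CC" and Y: "Y \<in> Obj CC"
    and A: "fst X = A" and S: "fst Y = DSum C A (ob \<iota> A)"
    and strY: "struct Y = i1 A (ob \<iota> A) \<star> lm A \<star> I (p2 A (ob \<iota> A))
      \<boxplus> i2 A (ob \<iota> A) \<star> I (p1 A (ob \<iota> A))"
    and h: "c \<in> carrier k" "c \<oplus>\<^bsub>k\<^esub> c = \<one>\<^bsub>k\<^esub>"
    and b0: "invertible b0" "src b0 = A" "tgt b0 = ob D A" "d b0 \<star> bid A = b0"
    and anti: "b0 \<star> struct X = neg (struct (ob DD X) \<star> I b0)"
    and b: "typed (fst Y) (ob D (fst Y)) b = d (p1 A (ob \<iota> A)) \<star> b0 \<star> p1 A (ob \<iota> A)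
      \<boxplus> neg (d (struct X \<star> p2 A (ob \<iota> A)) \<star> b0 \<star> (struct X \<star> p2 A (ob \<iota> A)))"
  shows "hyperbolic CC DD \<delta>\<delta> (Y, b)"
proof -
  let ?S = "DSum C A (ob \<iota> A)"
  have A' [simp]: "A \<in> Obj C" and fX [simp]: "invertible (struct X)" and ff: "struct X \<star> I (struct X) = lm A"
    using X A by (simp_all add: double_Obj)
  note [simp] = A S b0(1-3) h(1)
  \<comment> \<open>\<open>i\<close> and \<open>j\<close> are the injections dual to the coordinates \<open>P\<close> and \<open>Q\<close>.\<close>
  define i j P Q where "i = i1 A (ob \<iota> A)" and "j = i2 A (ob \<iota> A) \<star> arrinv (struct X)"
    and "P = p1 A (ob \<iota> A)" and "Q = struct X \<star> p2 A (ob \<iota> A)"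
  have [simp]: "valid i" "src i = A" "tgt i = ?S" "valid j" "src j = A" "tgt j = ?S"
    "valid P" "src P = ?S" "tgt P = A" "valid Q" "src Q = ?S" "tgt Q = A"
    by (simp_all add: i_def j_def P_def Q_def)
  have coords: "P \<star> i = ident A" "Q \<star> j = ident A" "P \<star> j = nil A A" "Q \<star> i = nil A A"
    "i \<star> P \<boxplus> j \<star> Q = ident ?S"
    by (simp_all add: i_def j_def P_def Q_def mul_assoc mul_inv sum_one)
  \<comment> \<open>\<open>\<lambda> = f \<iota>(f)\<close> turns the entry \<open>\<lambda>\<close> of \<open>\<Lambda>\<close> into \<open>f \<iota>(Q)\<close>.\<close>
  have swap: "P \<star> struct Y = struct X \<star> I Q" "Q \<star> struct Y = struct X \<star> I P"
    by (simp_all add: strY P_def Q_def mul_pls mul_assoc I_simps mul_lift[OF ff])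
  let ?r = "P \<boxplus> Q" and ?q = "scal c (b0 \<star> (P \<boxplus> neg Q))"
  let ?s = "scal c (i \<boxplus> j)" and ?t = "(i \<boxplus> neg j) \<star> arrinv b0"
  have form: "typed (fst Y) (ob D (fst Y)) b = d P \<star> b0 \<star> P \<boxplus> neg (d Q \<star> b0 \<star> Q)"
    unfolding b by (simp add: P_def Q_def)
  have b': "typed ?S (ob D ?S) b = d ?r \<star> ?q \<boxplus> d ?q \<star> bid A \<star> ?r"
  proof -
    let ?x = "d P \<star> b0 \<star> P \<boxplus> neg (d Q \<star> b0 \<star> Q)" and ?y = "d Q \<star> b0 \<star> P \<boxplus> neg (d P \<star> b0 \<star> Q)"
    have "d ?r \<star> ?q = scal c (?x \<boxplus> ?y)"
      by (simp add: d_simps mul_pls pls_mul mul_assoc scal_pls scal_neg pls_assoc pls_comm pls_lcomm)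
    moreover have "d ?q \<star> bid A \<star> ?r = scal c (?x \<boxplus> neg ?y)"
      by (simp add: d_simps mul_pls pls_mul mul_assoc scal_pls scal_neg pls_assoc pls_comm pls_lcomm
          mul_lift[OF b0(4)])
    ultimately show ?thesis using form h scal_half_sum[of c ?x ?y] by simp
  qed
  have rs: "?r \<star> ?s = ident A"
    using h by (simp add: mul_pls pls_mul coords scal_pls scal_nil scal_half)
  have rt: "?r \<star> ?t = nil (ob D A) A"
    by (simp add: mul_pls pls_mul coords mul_lift[OF coords(1)] mul_lift[OF coords(2)]
        mul_lift[OF coords(3)] mul_lift[OF coords(4)] mul_assoc)
  have qs: "?q \<star> ?s = nil A (ob D A)"
    by (simp add: mul_pls pls_mul coords mul_assoc scal_nil scal_pls scal_neg)
  have qt: "?q \<star> ?t = ident (ob D A)"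
    using h by (simp add: mul_pls pls_mul mul_assoc mul_lift[OF coords(1)] mul_lift[OF coords(2)]
        mul_lift[OF coords(3)] mul_lift[OF coords(4)] mul_inv scal_pls scal_neg scal_nil scal_half)
  have sum: "?s \<star> ?r \<boxplus> ?t \<star> ?q = ident ?S"
  proof -
    have "?s \<star> ?r = scal c ((i \<star> P \<boxplus> j \<star> Q) \<boxplus> (i \<star> Q \<boxplus> j \<star> P))"
      by (simp add: mul_pls pls_mul mul_assoc scal_pls scal_neg pls_assoc pls_comm pls_lcomm)
    moreover have "?t \<star> ?q = scal c ((i \<star> P \<boxplus> j \<star> Q) \<boxplus> neg (i \<star> Q \<boxplus> j \<star> P))"
      by (simp add: mul_pls pls_mul mul_assoc scal_pls scal_neg pls_assoc pls_comm pls_lcomm)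
    ultimately show ?thesis
      using h scal_half_sum[of c "i \<star> P \<boxplus> j \<star> Q" "i \<star> Q \<boxplus> j \<star> P"] by (simp add: coords)
  qed
  define x where "x = i1 A (ob D A) \<star> ?r \<boxplus> i2 A (ob D A) \<star> ?q"
  have *: "symmetric_space C D \<delta> (?S, b)"
    "raw x \<in> Arr (herm_cat C D \<delta>) (?S, b) (hyperbolic_space C D \<delta> A)"
    unfolding x_def
    by (rule pullback_of_hyperbolic[where s = ?s and t = ?t and L = A and V = ?S];
        (rule rs rt qs qt sum b')?; simp)+
  have Y': "invertible (struct Y)" "valid (struct Y)" using Y by (simp_all add: double_Obj)
  have DY: "ob DD Y \<in> Obj CC" "fst (ob DD Y) = ob D ?S" "ob DD X \<in> Obj CC" "fst (ob DD X) = ob D A"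
    using lift_Obj X Y by (simp_all add: lift_ob)
  have vDY [simp]: "valid (struct (ob DD Y))" "valid (struct (ob DD X))" using DY by (simp_all add: double_Obj)
  have ds: "d P \<star> struct (ob DD X) = struct (ob DD Y) \<star> I (d Q)"
    "d Q \<star> struct (ob DD X) = struct (ob DD Y) \<star> I (d P)"
    using lift_str[OF Y X, of P Q] lift_str[OF Y X, of Q P] swap by simp_all
  have vb: "valid (typed ?S (ob D ?S) b)" using form S by simp
  have sb: "b \<in> Isos CC Y (ob DD Y)"
  proof (rule double_Isos)
    have "typed ?S (ob D ?S) b \<star> struct Y = struct (ob DD Y) \<star> I (typed ?S (ob D ?S) b)"
      using form by (simp add: pls_mul mul_pls mul_assoc swap mul_lift[OF anti] mul_lift[OF ds(1)]
        mul_lift[OF ds(2)] I_simps pls_comm DY(2,4))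
    then show "b \<in> Arr CC Y (ob DD Y)"
      using vb by (subst double_Arr) (simp_all add: DY Y' del: valid_typed)
    show "invertible (typed (fst Y) (fst (ob DD Y)) b)"
      using *(1) by (simp add: DY symmetric_space_typed)
  qed (simp_all add: DY Y')
  have sym: "symmetric_space CC DD \<delta>\<delta> (Y, b)"
    using *(1) Y sb by (simp add: symmetric_space_def lift_ar lift_bid DY)
  let ?T = "DSum CC X (ob DD X)"
  have T: "fst ?T = DSum C A (ob D A)" "struct ?T = i1 A (ob D A) \<star> struct X \<star> I (p1 A (ob D A))
      \<boxplus> i2 A (ob D A) \<star> struct (ob DD X) \<star> I (p2 A (ob D A))"
    using str_DSum[of X "ob DD X"] by (simp_all add: DY)
  have vx [simp]: "valid x" "src x = ?S" "tgt x = DSum C A (ob D A)" by (simp_all add: x_def)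
  have tx: "typed (fst Y) (fst ?T) (raw x) = x" by (rule typed_eqI) (simp_all add: T)
  have vT: "valid (struct ?T)" by (simp add: T DY)
  have "raw x \<in> Isos CC Y ?T"
  proof (rule double_Isos)
    have px: "p1 A (ob D A) \<star> x = ?r" "p2 A (ob D A) \<star> x = ?q"
      unfolding x_def by (rule proj_pair; simp)+
    have Ix: "I (p1 A (ob D A)) \<star> I x = I ?r" "I (p2 A (ob D A)) \<star> I x = I ?q"
      by (simp_all add: px flip: fmap_mul[OF conj_functor])
    have "?r \<star> struct Y = struct X \<star> I ?r" "?q \<star> struct Y = struct (ob DD X) \<star> I ?q"
      by (simp_all add: pls_mul mul_pls mul_assoc swap I_simps pls_comm mul_lift[OF anti] DY(4))
    then have "x \<star> struct Y = struct ?T \<star> I x"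
      unfolding T(2) by (simp only: pls_mul mul_assoc Ix) (simp only: x_def pls_mul mul_assoc)
    then show "raw x \<in> Arr CC Y ?T"
      using double_Arr[of Y ?T "raw x"] Y' vT tx valid_objs(3)[OF vx(1)]
      by (simp add: T(1))
    have "invertible (typed ?S (DSum C A (ob D A)) (raw x))"
      using *(2) by (simp add: herm_cat_def hyperbolic_space_def Isos_typed)
    then show "invertible (typed (fst Y) (fst ?T) (raw x))" by (simp add: T)
  qed (simp_all add: T(1) Y' vT)
  then have isom: "raw x \<in> Arr (herm_cat CC DD \<delta>\<delta>) (Y, b) (hyperbolic_space CC DD \<delta>\<delta> X)"
  proof -
    obtain H where H: "hyperbolic_space C D \<delta> A = (DSum C A (ob D A), H)"
      by (simp add: hyperbolic_space_def)
    assume "raw x \<in> Isos CC Y ?T"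
    with *(2) H show ?thesis
      by (simp add: lift_hyperbolic_space[OF X] herm_cat_def lift_ar T(1))
  qed
  from isom X sym show ?thesis by (auto simp: hyperbolic_def)
qed

end

section \<open>The twisted duality and the induced dualities on the double category\<close>

locale octagon = dual_category k C D \<delta> + conj_category k C \<iota> lam
  for k :: "('k, 'r) ring_scheme" and C :: "('k, 'o, 'm) addcat" (structure)
    and D :: "('o, 'm, 'o, 'm) func" and \<delta> :: "'o \<Rightarrow> 'm"
    and \<iota> :: "('o, 'm, 'o, 'm) func" and lam :: "'o \<Rightarrow> 'm" +
  fixes \<alpha> :: "'o \<Rightarrow> 'm"
  assumes commutation: "commutation C \<iota> lam D \<delta> \<alpha>"
begin

definition al where "al A = typed (ob \<iota> (ob D A)) (ob D (ob \<iota> A)) (\<alpha> A)"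

lemma iso_al [simp]: "A \<in> Obj C \<Longrightarrow> invertible (al A)"
  and valid_al [simp]: "A \<in> Obj C \<Longrightarrow> valid (al A)"
  and src_al [simp]: "src (al A) = ob \<iota> (ob D A)" and tgt_al [simp]: "tgt (al A) = ob D (ob \<iota> A)"
  using commutation I_simp(1) contra_simps(1)
  by (auto simp: commutation_def nat_iso_contra_def al_def invertible_def func_comp_def
    func_comp_contra_def Isos_def)

lemma raw_consts: "raw (al A) = \<alpha> A" "raw (bid A) = \<delta> A" "raw (lm A) = lam A"
  by (simp_all add: al_def bid_def lm_def)

lemma al_natural: assumes "valid x" shows "al (src x) \<star> I (d x) = d (I x) \<star> al (tgt x)"
proof -
  obtain A B f where x: "x = typed A B f" "A \<in> Obj C" "B \<in> Obj C" "f \<in> Arr C A B"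
    using assms by (rule validE)
  have n: "\<alpha> A \<cdot> ar \<iota> (ob D B) (ob D A) (ar D A B f) = ar D (ob \<iota> A) (ob \<iota> B) (ar \<iota> A B f) \<cdot> \<alpha> B"
    using commutation x
    by (simp add: commutation_def nat_iso_contra_def func_comp_def func_comp_contra_def)
  have v: "valid (al A \<star> I (d x))" "valid (d (I x) \<star> al B)" using x by simp_all
  have "raw (al A \<star> I (d x)) = raw (d (I x) \<star> al B)"
    unfolding raw_mul[OF v(1)] raw_mul[OF v(2)] using x by (simp add: raw_fmap raw_cmap raw_consts n)
  then have "al A \<star> I (d x) = d (I x) \<star> al B"
    using typed_raw[OF v(1)] typed_raw[OF v(2)] v x by simp
  with x show ?thesis by simp
qed

lemma al_bid:
  assumes A: "A \<in> Obj C" shows "al (ob D A) \<star> I (bid A) = d (al A) \<star> bid (ob \<iota> A)"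
proof -
  have n: "\<alpha> (ob D A) \<cdot> ar \<iota> A (ob D (ob D A)) (\<delta> A) =
        ar D (ob \<iota> (ob D A)) (ob D (ob \<iota> A)) (\<alpha> A) \<cdot> \<delta> (ob \<iota> A)"
    using commutation A by (simp add: commutation_def)
  have v: "valid (al (ob D A) \<star> I (bid A))" "valid (d (al A) \<star> bid (ob \<iota> A))" using A by simp_all
  have "raw (al (ob D A) \<star> I (bid A)) = raw (d (al A) \<star> bid (ob \<iota> A))"
    unfolding raw_mul[OF v(1)] raw_mul[OF v(2)] using A by (simp add: raw_fmap raw_cmap raw_consts n)
  then show ?thesis
    using typed_raw[OF v(1)] typed_raw[OF v(2)] v A by simp
qed

lemma al_lm:
  assumes A: "A \<in> Obj C"
  shows "arrinv (al (ob \<iota> A)) \<star> d (lm A) = I (al A) \<star> arrinv (lm (ob D A))"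
proof -
  have n: "inverse_arr C (ob \<iota> (ob D (ob \<iota> A))) (ob D (ob \<iota> (ob \<iota> A))) (\<alpha> (ob \<iota> A))
          \<cdot> ar D (ob \<iota> (ob \<iota> A)) A (lam A) =
        ar \<iota> (ob \<iota> (ob D A)) (ob D (ob \<iota> A)) (\<alpha> A)
          \<cdot> inverse_arr C (ob \<iota> (ob \<iota> (ob D A))) (ob D A) (lam (ob D A))"
    using commutation A by (simp add: commutation_def)
  have v: "valid (arrinv (al (ob \<iota> A)) \<star> d (lm A))" "valid (I (al A) \<star> arrinv (lm (ob D A)))"
    using A by simp_all
  have "raw (arrinv (al (ob \<iota> A)) \<star> d (lm A)) = raw (I (al A) \<star> arrinv (lm (ob D A)))"
    unfolding raw_mul[OF v(1)] raw_mul[OF v(2)]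
    using A by (simp add: raw_inv raw_fmap raw_cmap raw_consts n)
  then show ?thesis
    using typed_raw[OF v(1)] typed_raw[OF v(2)] v A by simp
qed

abbreviation E where "E \<equiv> \<iota> \<circ>\<^sub>C D"
abbreviation \<epsilon> where "\<epsilon> \<equiv> twisted_bidual C \<iota> lam D \<delta> \<alpha>"

lemma ob_E: "ob E A = ob \<iota> (ob D A)" and map_E: "cmap E x = I (d x)"
  using fmap_cmap_comp[OF conj_functor contra] by (simp_all add: func_comp_contra_def)

definition eps where "eps A = I (al (ob D A)) \<star> arrinv (lm (ob D (ob D A))) \<star> bid A"

lemma eps_simps [simp]: assumes "A \<in> Obj C"
  shows "invertible (eps A)" "valid (eps A)" "src (eps A) = A" "tgt (eps A) = ob \<iota> (ob D (ob \<iota> (ob D A)))"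
  using assms by (simp_all add: eps_def)

lemma typed_eps: assumes A: "A \<in> Obj C" shows "typed A (ob E (ob E A)) (\<epsilon> A) = eps A"
  by (rule typed_eqI)
    (use A in \<open>simp_all add: eps_def ob_E twisted_bidual_def raw_mul raw_fmap raw_inv raw_consts\<close>)

lemma lm_inv_natural:
  assumes "valid x" shows "I (I x) \<star> arrinv (lm (src x)) = arrinv (lm (tgt x)) \<star> x"
proof (rule mul_left_eq[of "lm (tgt x)"])
  show "lm (tgt x) \<star> I (I x) \<star> arrinv (lm (src x)) = lm (tgt x) \<star> arrinv (lm (tgt x)) \<star> x"
    using assms mul_lift[OF lm_natural[OF assms], of "arrinv (lm (src x))"]
    by (simp add: mul_assoc mul_inv)
qed (use assms in simp_all)

lemma eps_natural:
  assumes x: "valid x" shows "I (d (I (d x))) \<star> eps (src x) = eps (tgt x) \<star> x"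
proof -
  have 1: "d (I (d x)) \<star> al (ob D (src x)) = al (ob D (tgt x)) \<star> I (d (d x))"
    using al_natural[of "d x"] x by simp
  have 2: "I (d (I (d x))) \<star> I (al (ob D (src x))) = I (al (ob D (tgt x))) \<star> I (I (d (d x)))"
    using arg_cong[OF 1, of I] x by (simp add: I_simps)
  have 3: "I (I (d (d x))) \<star> arrinv (lm (ob D (ob D (src x)))) = arrinv (lm (ob D (ob D (tgt x)))) \<star> d (d x)"
    using lm_inv_natural[of "d (d x)"] x by simp
  show ?thesis
    using bid_natural[OF x] by (simp add: eps_def mul_lift[OF 2] mul_assoc mul_lift[OF 3])
qed

text \<open>
  In \<open>\<iota>D(\<epsilon>\<^bsub>A\<^esub>) \<epsilon>\<^bsub>\<iota>D(A)\<^esub>\<close>, naturality and the second commutation axiom move all factors \<open>\<alpha>\<close> past \<open>\<lambda>\<close>;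
  then \<open>\<lambda>\<close> and its inverse meet by \<open>\<lambda>\<^bsub>\<iota>(X)\<^esub> = \<iota>(\<lambda>\<^bsub>X\<^esub>)\<close>, the factors \<open>\<alpha>\<close> disappear by the first
  commutation axiom, and \<open>\<iota>(D(\<delta>\<^bsub>A\<^esub>) \<delta>\<^bsub>D(A)\<^esub>) = 1\<close> is left.
\<close>

lemma eps_triangle:
  assumes A: "A \<in> Obj C" shows "I (d (eps A)) \<star> eps (ob \<iota> (ob D A)) = ident (ob \<iota> (ob D A))"
proof -
  note [simp] = A
  let ?X = "ob D (ob D A)"
  have 1: "d (I (al (ob D A))) \<star> al (ob D (ob \<iota> (ob D A))) = al (ob \<iota> ?X) \<star> I (d (al (ob D A)))"
    using al_natural[of "al (ob D A)"] by simp
  have 2: "arrinv (d (lm ?X)) \<star> al (ob \<iota> ?X) = lm (ob D ?X) \<star> arrinv (I (al ?X))"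
    using arg_cong[OF al_lm[of ?X], of arrinv] by (simp add: inv_mul_eq)
  let ?y = "arrinv (al ?X) \<star> d (al (ob D A))"
  have 3: "I (I ?y) \<star> arrinv (lm (ob D (ob D (ob \<iota> (ob D A))))) = arrinv (lm (ob \<iota> (ob D ?X))) \<star> ?y"
    using lm_inv_natural[of ?y] by simp
  have 4: "?y \<star> bid (ob \<iota> (ob D A)) = I (bid (ob D A))"
    using al_bid[of "ob D A"] by (simp add: mul_assoc flip: al_bid)
  have "I (d (eps A)) \<star> I (al (ob D (ob \<iota> (ob D A))))
     = I (d (bid A) \<star> arrinv (d (lm ?X)) \<star> d (I (al (ob D A))) \<star> al (ob D (ob \<iota> (ob D A))))"
    by (simp add: eps_def d_simps I_simps mul_assoc)
  also have "\<dots> = I (d (bid A)) \<star> I (lm (ob D ?X)) \<star> I (I ?y)"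
    unfolding 1 mul_lift[OF 2] by (simp add: I_simps mul_assoc)
  finally have 5: "I (d (eps A)) \<star> I (al (ob D (ob \<iota> (ob D A))))
     = I (d (bid A)) \<star> I (lm (ob D ?X)) \<star> I (I ?y)" .
  have "I (d (eps A)) \<star> eps (ob \<iota> (ob D A))
    = I (d (bid A)) \<star> lm (ob \<iota> (ob D ?X)) \<star> (I (I ?y) \<star> arrinv (lm (ob D (ob D (ob \<iota> (ob D A)))))) \<star> bid (ob \<iota> (ob D A))"
    unfolding eps_def[of "ob \<iota> (ob D A)"] mul_lift[OF 5] by (simp add: mul_assoc lm_conj)
  also have "\<dots> = I (d (bid A)) \<star> (?y \<star> bid (ob \<iota> (ob D A)))"
    unfolding 3 by (simp add: mul_assoc)
  also have "\<dots> = I (d (bid A) \<star> bid (ob D A))"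
    unfolding 4 by (simp add: I_simps)
  also have "\<dots> = ident (ob \<iota> (ob D A))" by (simp add: bid_triangle)
  finally show ?thesis .
qed

lemma twisted_duality: "duality k C E \<epsilon>"
proof (rule dualityI)
  show "is_contrafunctor k C C E" by (rule comp_contrafunctor[OF conj_functor contra])
next
  fix A assume "A \<in> Obj C"
  then show "invertible (typed A (ob E (ob E A)) (\<epsilon> A))" by (simp add: typed_eps)
next
  fix x assume "valid x"
  then show "cmap E (cmap E x) \<star> typed (src x) (ob E (ob E (src x))) (\<epsilon> (src x)) =
         typed (tgt x) (ob E (ob E (tgt x))) (\<epsilon> (tgt x)) \<star> x"
    by (simp add: typed_eps map_E eps_natural)
next
  fix A assume "A \<in> Obj C"
  then show "cmap E (typed A (ob E (ob E A)) (\<epsilon> A)) \<star>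
         typed (ob E A) (ob E (ob E (ob E A))) (\<epsilon> (ob E A)) = ident (ob E A)"
    using typed_eps[unfolded ob_E, of "ob \<iota> (ob D A)"]
    by (simp add: typed_eps map_E ob_E) (simp add: eps_triangle typed_eps[unfolded ob_E])
qed

text \<open>
  The prefixes are \<open>T\<close> for the twisted duality \<open>(\<iota>D, \<delta>\<^sub>\<alpha>)\<close> and \<open>N\<close> for a negated one; in the same way \<open>LD\<close>,
  \<open>LN\<close> and \<open>LTN\<close> below are the lifts to the double category.
\<close>

sublocale T: dual_category k C E \<epsilon>
  by unfold_locales (rule twisted_duality)

sublocale TN: dual_category k C E "neg_bidual C E \<epsilon>"
  by unfold_locales (rule T.neg_duality)

sublocale N: dual_category k C D "neg_bidual C D \<delta>"
  by unfold_locales (rule neg_duality)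

lemma T_bid: "A \<in> Obj C \<Longrightarrow> T.bid A = eps A"
  by (simp add: T.bid_def typed_eps)

lemma TN_bid: "A \<in> Obj C \<Longrightarrow> TN.bid A = neg (eps A)"
  by (simp add: TN.bid_def T.typed_neg_bidual T_bid)

lemma N_bid: "A \<in> Obj C \<Longrightarrow> N.bid A = neg (bid A)"
  by (simp add: N.bid_def typed_neg_bidual)

abbreviation D' where "D' \<equiv> double_dual C \<iota> D \<alpha>"
abbreviation \<iota>' where "\<iota>' \<equiv> double_conj C \<iota>"
abbreviation lam' where "lam' \<equiv> double_lam C \<iota> lam"
abbreviation \<delta>' where "\<delta>' \<equiv> double_bidual \<delta>"
abbreviation \<alpha>' where "\<alpha>' \<equiv> double_comm C \<iota> D \<alpha>"
abbreviation E' where "E' \<equiv> \<iota>' \<circ>\<^sub>C D'"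
abbreviation \<epsilon>' where "\<epsilon>' \<equiv> twisted_bidual CC \<iota>' lam' D' \<delta>' \<alpha>'"

lemma fst_lifts: "fst (ob D' X) = ob D (fst X)" "fst (ob \<iota>' X) = ob \<iota> (fst X)"
  "fst (ob E' X) = ob E (fst X)"
  by (simp_all add: double_dual_def double_conj_def func_comp_contra_def case_prod_beta)

lemma ar_lifts: "ar D' X Y \<phi> = ar D (fst X) (fst Y) \<phi>" "ar \<iota>' X Y \<phi> = ar \<iota> (fst X) (fst Y) \<phi>"
  "ar E' X Y \<phi> = ar E (fst X) (fst Y) \<phi>"
  by (simp_all add: double_dual_def double_conj_def func_comp_contra_def case_prod_beta)

lemma double_ObjD:
  assumes "X \<in> Obj CC"
  shows "fst X \<in> Obj C" "invertible (struct X)" "valid (struct X)" "struct X \<star> I (struct X) = lm (fst X)"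
  using assms by (simp_all add: double_Obj)

lemma str_conj: "valid (struct X) \<Longrightarrow> fst X \<in> Obj C \<Longrightarrow> struct (ob \<iota>' X) = neg (I (struct X))"
  unfolding struct_def[of "ob \<iota>' X"]
  by (rule typed_eqI) (simp_all add: fst_lifts raw_neg raw_fmap,
    simp add: struct_def double_conj_def case_prod_beta)

lemma str_dual: "invertible (struct X) \<Longrightarrow> fst X \<in> Obj C \<Longrightarrow>
    struct (ob D' X) = neg (arrinv (d (struct X)) \<star> al (fst X))"
  unfolding struct_def[of "ob D' X"]
  by (rule typed_eqI) (simp_all add: fst_lifts raw_neg raw_mul raw_inv raw_cmap raw_consts,
    simp add: struct_def double_dual_def case_prod_beta)

lemma al_inv:
  assumes "invertible F"
  shows "al (tgt F) \<star> arrinv (I (d F)) = arrinv (d (I F)) \<star> al (src F)"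
proof (rule mul_left_eq[of "d (I F)"])
  have "d (I F) \<star> al (tgt F) \<star> arrinv (I (d F)) = al (src F)"
    using assms mul_lift[OF al_natural[of F, symmetric], of "arrinv (I (d F))"]
    by (simp add: mul_assoc mul_inv)
  then show "d (I F) \<star> al (tgt F) \<star> arrinv (I (d F)) = d (I F) \<star> arrinv (d (I F)) \<star> al (src F)"
    using assms by simp
qed (use assms in simp_all)

text \<open>
  The second commutation axiom, solved for \<open>\<lambda>\<close>.
\<close>

lemma al_lm': 
  assumes A: "A \<in> Obj C" shows "arrinv (d (lm A)) \<star> al (ob \<iota> A) \<star> I (al A) = lm (ob D A)"
proof -
  note [simp] = A
  have "al (ob \<iota> A) \<star> (arrinv (al (ob \<iota> A)) \<star> d (lm A)) \<star> lm (ob D A)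
     = al (ob \<iota> A) \<star> I (al A)"
    unfolding al_lm[OF A] by (simp add: mul_assoc inv_mul)
  then have "al (ob \<iota> A) \<star> I (al A) = d (lm A) \<star> lm (ob D A)" by (simp add: mul_assoc)
  then show ?thesis by simp
qed

lemma dual_Obj: assumes X: "X \<in> Obj CC" shows "ob D' X \<in> Obj CC"
proof -
  note [simp] = double_ObjD(1-3)[OF X]
  have 1: "al (fst X) \<star> arrinv (I (d (struct X))) = arrinv (d (I (struct X))) \<star> al (ob \<iota> (fst X))"
    using al_inv[of "struct X"] by simp
  have 2: "arrinv (d (struct X)) \<star> arrinv (d (I (struct X))) = arrinv (d (lm (fst X)))"
    by (simp add: d_simps flip: inv_mul_eq double_ObjD(4)[OF X])
  have "struct (ob D' X) \<star> I (struct (ob D' X)) = lm (ob D (fst X))"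
    by (simp add: str_dual I_simps mul_assoc mul_lift[OF 1] mul_lift[OF 2] al_lm')
  then show ?thesis by (simp add: double_Obj fst_lifts str_dual)
qed

lemma conj_Obj: assumes X: "X \<in> Obj CC" shows "ob \<iota>' X \<in> Obj CC"
proof -
  note [simp] = double_ObjD(1-3)[OF X]
  have "I (struct X) \<star> I (I (struct X)) = lm (ob \<iota> (fst X))"
    using lm_conj[of "fst X"] double_ObjD(4)[OF X] by (simp flip: fmap_mul[OF conj_functor])
  then show ?thesis by (simp add: double_Obj fst_lifts str_conj I_simps)
qed

lemma twisted_Obj: "X \<in> Obj CC \<Longrightarrow> ob E' X \<in> Obj CC"
  using conj_Obj dual_Obj by (simp add: func_comp_contra_def)

lemma str_twisted:
  assumes "X \<in> Obj CC" shows "struct (ob E' X) = neg (I (struct (ob D' X)))"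
  using str_conj[of "ob D' X"] double_ObjD[OF dual_Obj[OF assms]] by (simp add: func_comp_contra_def)

text \<open>
  Apply \<open>D\<close> to the equation between \<open>u\<close> and \<open>v\<close> and use the naturality of \<open>\<alpha>\<close> at \<open>v\<close>.
\<close>

lemma dual_str:
  assumes X: "X \<in> Obj CC" and Y: "Y \<in> Obj CC"
    and u: "valid u" "src u = fst X" "tgt u = fst Y"
    and v: "valid v" "src v = fst X" "tgt v = fst Y"
    and uv: "u \<star> struct X = struct Y \<star> I v"
  shows "d u \<star> struct (ob D' Y) = struct (ob D' X) \<star> I (d v)"
proof -
  note [simp] = double_ObjD(1-3)[OF X] double_ObjD(1-3)[OF Y] u v
  have "d (struct X) \<star> d u = d (I v) \<star> d (struct Y)"
    using arg_cong[OF uv, of d] by (simp add: d_simps)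
  from mul_lift[OF this, of "arrinv (d (struct Y))"]
  have 1: "d (struct X) \<star> d u \<star> arrinv (d (struct Y)) = d (I v)" by (simp add: mul_assoc mul_inv)
  have "d u \<star> arrinv (d (struct Y)) = arrinv (d (struct X)) \<star> d (I v)"
    unfolding 1[symmetric] by simp
  from mul_lift[OF this, of "al (fst Y)"] al_natural[of v]
  have "d u \<star> arrinv (d (struct Y)) \<star> al (fst Y) = arrinv (d (struct X)) \<star> al (fst X) \<star> I (d v)"
    by (simp add: mul_assoc)
  then show ?thesis by (simp add: str_dual mul_assoc)
qed

lemma bid_str:
  assumes X: "X \<in> Obj CC"
  shows "bid (fst X) \<star> struct X = struct (ob D' (ob D' X)) \<star> I (bid (fst X))"
proof -
  note [simp] = double_ObjD(1-3)[OF X]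
  have [simp]: "invertible (struct (ob D' X))" using double_ObjD[OF dual_Obj[OF X]] by simp
  have "struct (ob D' (ob D' X)) = d (d (struct X)) \<star> arrinv (d (al (fst X))) \<star> al (ob D (fst X))"
    by (simp add: str_dual fst_lifts) (simp add: str_dual fst_lifts d_simps inv_neg inv_mul_eq mul_assoc)
  then show ?thesis
    using bid_natural[of "struct X"] by (simp add: mul_assoc al_bid)
qed

lemma lm_str:
  assumes X: "X \<in> Obj CC" shows "lm (fst X) \<star> struct (ob \<iota>' (ob \<iota>' X)) = struct X \<star> I (lm (fst X))"
proof -
  note [simp] = double_ObjD(1-3)[OF X]
  have "struct (ob \<iota>' (ob \<iota>' X)) = I (I (struct X))"
    by (simp add: str_conj fst_lifts I_simps)
  then show ?thesis using lm_natural[of "struct X"] by (simp add: lm_conj)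
qed

lemma lm_arr:
  assumes X: "X \<in> Obj CC"
  shows "inverse_arr CC (ob \<iota>' (ob \<iota>' X)) X (lam' X) = raw (neg (arrinv (lm (fst X))))"
proof -
  note [simp] = double_ObjD(1-3)[OF X] double_ObjD(1-3)[OF conj_Obj[OF conj_Obj[OF X]]]
  have t: "typed (ob \<iota> (ob \<iota> (fst X))) (fst X) (lam' X) = neg (lm (fst X))"
    by (rule typed_eqI) (simp_all add: raw_neg raw_consts double_lam_def case_prod_beta)
  have v: "valid (typed (ob \<iota> (ob \<iota> (fst X))) (fst X) (lam' X))" unfolding t by simp
  have "lam' X \<in> Arr CC (ob \<iota>' (ob \<iota>' X)) X"
    using v double_Arr[of "ob \<iota>' (ob \<iota>' X)" X "lam' X"] lm_str[OF X]
    by (simp add: fst_lifts t I_simps)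
  then show ?thesis
    by (subst double_inverse_arr) (simp_all add: fst_lifts t inv_neg)
qed

text \<open>
  The sign of \<open>\<alpha>'\<close> cancels against that of \<open>\<lambda>'\<close>.
\<close>

lemma twisted_lift: assumes X: "X \<in> Obj CC" shows "\<epsilon>' X = \<epsilon> (fst X)"
proof -
  let ?A = "fst X"
  note [simp] = double_ObjD(1)[OF X]
  have "\<epsilon>' X = ar \<iota> (ob \<iota> (ob D (ob D ?A))) (ob D (ob \<iota> (ob D ?A)))
      (\<ominus>\<^bsub>Hom C (ob \<iota> (ob D (ob D ?A))) (ob D (ob \<iota> (ob D ?A)))\<^esub> \<alpha> (ob D ?A))
      \<cdot> raw (neg (arrinv (lm (ob D (ob D ?A))))) \<cdot> \<delta> ?A"
    by (simp add: twisted_bidual_def lm_arr[OF dual_Obj[OF dual_Obj[OF X]]] fst_lifts ar_lifts)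
      (simp add: double_comm_def double_bidual_def case_prod_beta fst_lifts)
  also have "\<dots> = raw (I (neg (al (ob D ?A))) \<star> neg (arrinv (lm (ob D (ob D ?A)))) \<star> bid ?A)"
    by (subst raw_mul, simp, subst raw_mul, simp, subst raw_fmap, simp)
      (simp add: raw_neg[of "al (ob D ?A)"] raw_consts)
  also have "I (neg (al (ob D ?A))) \<star> neg (arrinv (lm (ob D (ob D ?A)))) \<star> bid ?A = eps ?A"
    by (simp add: I_simps eps_def)
  also have "raw (eps ?A) = \<epsilon> ?A"
    by (simp flip: typed_eps)
  finally show ?thesis .
qed

text \<open>
  The three factors of \<open>\<epsilon>\<close> are compatible with the structure morphisms, the one that involves
  \<open>\<alpha>\<close> up to a sign that the sign in the definition of \<open>\<iota>'\<close> compensates. This compatibility is needed to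
  negate \<open>\<epsilon>\<close> in the double category.
\<close>

lemma eps_str:
  assumes X: "X \<in> Obj CC"
  shows "eps (fst X) \<star> struct X = struct (ob E' (ob E' X)) \<star> I (eps (fst X))"
proof -
  let ?A = "fst X" and ?Z = "ob D' X"
  note [simp] = double_ObjD(1-3)[OF X]
  have Z [simp]: "?Z \<in> Obj CC" "ob D' ?Z \<in> Obj CC" "ob E' X \<in> Obj CC" "ob \<iota>' ?Z \<in> Obj CC"
    using X dual_Obj twisted_Obj conj_Obj by blast+
  note [simp] = double_ObjD(1-3)[OF Z(1)] double_ObjD(1-3)[OF Z(2)] double_ObjD(1-3)[OF Z(4)] fst_lifts
  have 1: "al (ob D ?A) \<star> arrinv (I (d (struct ?Z))) = arrinv (d (I (struct ?Z))) \<star> al (ob \<iota> (ob D ?A))"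
    using al_inv[of "struct ?Z"] by simp
  have dE: "struct (ob D' (ob E' X)) = arrinv (d (I (struct ?Z))) \<star> al (ob \<iota> (ob D ?A))"
    using str_dual[of "ob \<iota>' ?Z"] str_conj[of ?Z]
    by (simp add: func_comp_contra_def d_simps inv_neg)
  have "al (ob D ?A) \<star> I (struct (ob D' ?Z)) = neg (struct (ob D' (ob E' X)) \<star> I (al (ob D ?A)))"
    unfolding dE using str_dual[of ?Z] by (simp add: I_simps mul_lift[OF 1] mul_assoc)
  from arg_cong[OF this, of I] have 2: "I (al (ob D ?A)) \<star> I (I (struct (ob D' ?Z)))
      = struct (ob E' (ob E' X)) \<star> I (I (al (ob D ?A)))"
    using double_ObjD[OF dual_Obj[OF Z(3)]] str_twisted[OF Z(3)] by (simp add: I_simps ob_E)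
  have 3: "arrinv (lm (ob D (ob D ?A))) \<star> struct (ob D' ?Z)
     = I (I (struct (ob D' ?Z))) \<star> arrinv (I (lm (ob D (ob D ?A))))"
    using lm_inv_natural[of "struct (ob D' ?Z)"] by (simp add: lm_conj)
  show ?thesis
    using bid_str[OF X]
    by (simp add: eps_def mul_assoc mul_lift[OF 3]) (simp add: mul_lift[OF 2] I_simps mul_assoc)
qed

lemma neg_bidual_dual:
  assumes X: "X \<in> Obj CC" shows "neg_bidual CC D' \<delta>' X = neg_bidual C D \<delta> (fst X)"
proof -
  note [simp] = double_ObjD(1-3)[OF X] double_ObjD(1-3)[OF dual_Obj[OF dual_Obj[OF X]]]
  have "\<delta> (fst X) \<in> Arr CC X (ob D' (ob D' X))"
    using double_Arr[of X "ob D' (ob D' X)" "\<delta> (fst X)"] bid_str[OF X] arr_bid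
    by (simp add: fst_lifts bid_def)
  then show ?thesis
    by (simp add: neg_bidual_def double_bidual_def case_prod_beta double_a_inv fst_lifts)
qed

lemma neg_bidual_twisted:
  assumes X: "X \<in> Obj CC" shows "neg_bidual CC E' \<epsilon>' X = neg_bidual C E \<epsilon> (fst X)"
proof -
  note [simp] = double_ObjD(1-3)[OF X] double_ObjD(1-3)[OF twisted_Obj[OF twisted_Obj[OF X]]]
  have "\<epsilon> (fst X) \<in> Arr CC X (ob E' (ob E' X))"
    using double_Arr[of X "ob E' (ob E' X)" "\<epsilon> (fst X)"] eps_str[OF X] T.arr_bid[of "fst X"]
    by (simp add: fst_lifts typed_eps)
  then show ?thesis
    by (simp add: neg_bidual_def twisted_lift[OF X] double_a_inv fst_lifts)
qed

sublocale LD: lifted_duality k C D \<delta> \<iota> lam D' \<delta>'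
  by unfold_locales
    (simp_all add: fst_lifts ar_lifts dual_Obj dual_str double_bidual_def case_prod_beta)

sublocale LN: lifted_duality k C D "neg_bidual C D \<delta>" \<iota> lam D' "neg_bidual CC D' \<delta>'"
  by unfold_locales
    (simp_all add: fst_lifts ar_lifts dual_Obj dual_str neg_bidual_dual)

sublocale LTN: lifted_duality k C E "neg_bidual C E \<epsilon>" \<iota> lam E' "neg_bidual CC E' \<epsilon>'"
proof unfold_locales
  fix X Y u v
  assume a: "X \<in> Obj CC" "Y \<in> Obj CC" "valid u" "valid v" "src u = fst X" "src v = fst X"
      "tgt u = fst Y" "tgt v = fst Y" "u \<star> struct X = struct Y \<star> I v"
  note [simp] = double_ObjD(1-3)[OF dual_Obj[OF a(1)]] double_ObjD(1-3)[OF dual_Obj[OF a(2)]]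
    double_ObjD(1)[OF a(1)]  double_ObjD(1)[OF a(2)]
  have "d u \<star> struct (ob D' Y) = struct (ob D' X) \<star> I (d v)"
    using a by (intro dual_str) simp_all
  from arg_cong[OF this, of I] a show "cmap E u \<star> struct (ob E' Y) = struct (ob E' X) \<star> I (cmap E v)"
    by (simp add: map_E str_twisted I_simps fst_lifts)
qed (simp_all add: fst_lifts ar_lifts twisted_Obj neg_bidual_twisted)

end

section \<open>The functors of the octagon and their compositions\<close>

context octagon
begin

abbreviation F where "F \<equiv> F_func C \<iota> lam"

lemma Fob_fst: "fst (ob F A) = DSum C A (ob \<iota> A)"
  by (simp add: F_func_def)

lemma str_F:
  assumes A: "A \<in> Obj C"
  shows "struct (ob F A) = i1 A (ob \<iota> A) \<star> lm A \<star> I (p2 A (ob \<iota> A))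
    \<boxplus> i2 A (ob \<iota> A) \<star> I (p1 A (ob \<iota> A))"
proof -
  note [simp] = A
  let ?S = "DSum C A (ob \<iota> A)" and ?T = "DSum C (ob \<iota> A) (ob \<iota> (ob \<iota> A))"
  let ?M = "matrix C (ob \<iota> A) (ob \<iota> (ob \<iota> A)) A (ob \<iota> A)
          \<zero>\<^bsub>Hom C (ob \<iota> A) A\<^esub> (lam A) (Id C (ob \<iota> A)) \<zero>\<^bsub>Hom C (ob \<iota> (ob \<iota> A)) (ob \<iota> A)\<^esub>"
  have m: "typed ?T ?S ?M = i1 A (ob \<iota> A) \<star> lm A \<star> p2 (ob \<iota> A) (ob \<iota> (ob \<iota> A))
      \<boxplus> i2 A (ob \<iota> A) \<star> p1 (ob \<iota> A) (ob \<iota> (ob \<iota> A))"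
    using valid_lm[OF A] by (subst typed_antidiag) (simp_all add: typed_Id Id_arr lm_def)
  note s = typed_sum_split[OF conj_functor A I_simp(1)[OF A]]
  have "valid (typed ?T ?S ?M)" "valid (typed (ob \<iota> ?S) ?T (sum_split C \<iota> A (ob \<iota> A)))"
    unfolding m s by simp_all
  from typed_mul[OF this] have "struct (ob F A) = typed ?T ?S ?M \<star> typed (ob \<iota> ?S) ?T (sum_split C \<iota> A (ob \<iota> A))"
    unfolding struct_def by (simp add: F_func_def)
  then show ?thesis unfolding m s by (simp add: mul_pls pls_mul mul_assoc pls_comm)
qed

lemma proj_str_F:
  assumes A: "A \<in> Obj C"
  shows "p1 A (ob \<iota> A) \<star> struct (ob F A) = lm A \<star> I (p2 A (ob \<iota> A))"
    and "p2 A (ob \<iota> A) \<star> struct (ob F A) = I (p1 A (ob \<iota> A))"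
  using A by (simp_all add: str_F mul_pls)

text \<open>
  The inverse of \<open>\<Lambda>\<close> is off-diagonal with entries \<open>1\<close> and \<open>\<lambda>\<^bsup>-1\<^esup>\<close>, up to the identification of
  \<open>\<iota>(A \<oplus> \<iota>(A))\<close> with a direct sum.
\<close>

lemma inv_str_F:
  assumes A: "A \<in> Obj C"
  shows "invertible (struct (ob F A))"
    and "arrinv (struct (ob F A)) = I (i1 A (ob \<iota> A)) \<star> p2 A (ob \<iota> A)
      \<boxplus> I (i2 A (ob \<iota> A)) \<star> arrinv (lm A) \<star> p1 A (ob \<iota> A)"
proof -
  note [simp] = A Fob_fst
  let ?a = "A" and ?b = "ob \<iota> A"
  let ?g = "I (i1 ?a ?b) \<star> p2 ?a ?b \<boxplus> I (i2 ?a ?b) \<star> arrinv (lm A) \<star> p1 ?a ?b"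
  have I_eqs: "I (p1 ?a ?b) \<star> I (i1 ?a ?b) = ident (ob \<iota> A)" "I (p2 ?a ?b) \<star> I (i2 ?a ?b) = ident (ob \<iota> (ob \<iota> A))"
    "I (p1 ?a ?b) \<star> I (i2 ?a ?b) = nil (ob \<iota> (ob \<iota> A)) (ob \<iota> A)" "I (p2 ?a ?b) \<star> I (i1 ?a ?b) = nil (ob \<iota> A) (ob \<iota> (ob \<iota> A))"
    by (simp_all flip: fmap_mul[OF conj_functor])
  have I_sum: "I (i1 ?a ?b) \<star> I (p1 ?a ?b) \<boxplus> I (i2 ?a ?b) \<star> I (p2 ?a ?b) = ident (ob \<iota> (DSum C ?a ?b))"
    using arg_cong[OF sum_one[of ?a ?b], of I] by (simp add: I_simps)
  have 1: "struct (ob F A) \<star> ?g = ident (DSum C ?a ?b)"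
    by (simp add: str_F mul_pls pls_mul mul_assoc mul_lift[OF I_eqs(1)] mul_lift[OF I_eqs(2)]
        mul_lift[OF I_eqs(3)] mul_lift[OF I_eqs(4)]) (subst pls_comm, simp add: sum_one)
  have 2: "?g \<star> struct (ob F A) = ident (ob \<iota> (DSum C ?a ?b))"
    by (simp add: pls_mul mul_assoc proj_str_F I_sum)
  have "valid (struct (ob F A))" by (simp add: str_F)
  then show "invertible (struct (ob F A))" "arrinv (struct (ob F A)) = ?g"
    using isoI[of "struct (ob F A)" ?g] 1 2 by simp_all
qed

lemma F_Obj: assumes A: "A \<in> Obj C" shows "ob F A \<in> Obj CC"
proof -
  note [simp] = A Fob_fst
  let ?a = "A" and ?b = "ob \<iota> A"
  note [simp] = inv_str_F(1)[OF A]
  have 1: "I (p1 ?a ?b) \<star> I (struct (ob F A)) = I (lm A) \<star> I (I (p2 ?a ?b))"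
    using arg_cong[OF proj_str_F(1)[OF A], of I] by (simp add: I_simps)
  have 2: "I (p2 ?a ?b) \<star> I (struct (ob F A)) = I (I (p1 ?a ?b))"
    using arg_cong[OF proj_str_F(2)[OF A], of I] by (simp add: I_simps)
  have "struct (ob F A) \<star> I (struct (ob F A))
     = i1 ?a ?b \<star> lm A \<star> I (I (p1 ?a ?b)) \<boxplus> i2 ?a ?b \<star> lm ?b \<star> I (I (p2 ?a ?b))"
    by (subst str_F) (simp_all add: pls_mul mul_assoc 1 2 lm_conj)
  also have "\<dots> = (i1 ?a ?b \<star> p1 ?a ?b \<boxplus> i2 ?a ?b \<star> p2 ?a ?b) \<star> lm (DSum C ?a ?b)"
    using lm_natural[of "p1 ?a ?b"] lm_natural[of "p2 ?a ?b"] by (simp add: pls_mul mul_assoc)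
  finally show ?thesis by (simp add: double_Obj sum_one)
qed

lemma typed_F_ar:
  assumes "A \<in> Obj C" "B \<in> Obj C" "\<phi> \<in> Arr C A B"
  shows "typed (DSum C A (ob \<iota> A)) (DSum C B (ob \<iota> B)) (ar F A B \<phi>)
    = i1 B (ob \<iota> B) \<star> typed A B \<phi> \<star> p1 A (ob \<iota> A)
      \<boxplus> i2 B (ob \<iota> B) \<star> I (typed A B \<phi>) \<star> p2 A (ob \<iota> A)"
proof -
  have "I (typed A B \<phi>) = typed (ob \<iota> A) (ob \<iota> B) (ar \<iota> A B \<phi>)" using assms by (simp add: fmap_def)
  with assms valid_fmap[OF conj_functor, of "typed A B \<phi>"] show ?thesis
    by (simp add: F_func_def typed_diag)
qed

lemma typed_hat_form:
  assumes A: "A \<in> Obj C" and h: "h \<in> Arr C A (ob D A)"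
  defines "H \<equiv> typed A (ob D A) h"
  shows "typed (DSum C A (ob \<iota> A)) (ob D (DSum C A (ob \<iota> A))) (phi_hat C \<iota> D \<alpha> A \<cdot> ar F A (ob D A) h)
    = d (p1 A (ob \<iota> A)) \<star> H \<star> p1 A (ob \<iota> A)
      \<boxplus> neg (d (p2 A (ob \<iota> A)) \<star> al A \<star> I H \<star> p2 A (ob \<iota> A))"
proof -
  note [simp] = A
  have [simp]: "valid H" "src H = A" "tgt H = ob D A" using h by (simp_all add: H_def)
  let ?S = "DSum C A (ob \<iota> A)" and ?T = "DSum C (ob D A) (ob D (ob \<iota> A))"
    and ?U = "DSum C (ob D A) (ob \<iota> (ob D A))"
  let ?M = "matrix C (ob D A) (ob \<iota> (ob D A)) (ob D A) (ob D (ob \<iota> A))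
       (Id C (ob D A)) \<zero>\<^bsub>Hom C (ob \<iota> (ob D A)) (ob D A)\<^esub> \<zero>\<^bsub>Hom C (ob D A) (ob D (ob \<iota> A))\<^esub>
       (\<ominus>\<^bsub>Hom C (ob \<iota> (ob D A)) (ob D (ob \<iota> A))\<^esub> \<alpha> A)"
  note j = typed_sum_join[OF contra A I_simp(1)[OF A]]
  have a: "\<alpha> A \<in> Arr C (ob \<iota> (ob D A)) (ob D (ob \<iota> A))" using valid_al[OF A] by (simp add: al_def)
  have m: "typed ?U ?T ?M = i1 (ob D A) (ob D (ob \<iota> A)) \<star> p1 (ob D A) (ob \<iota> (ob D A))
     \<boxplus> neg (i2 (ob D A) (ob D (ob \<iota> A)) \<star> al A \<star> p2 (ob D A) (ob \<iota> (ob D A)))"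
    using a by (subst typed_diag) (simp_all add: typed_Id Id_arr typed_neg al_def)
  note f = typed_F_ar[OF A contra_simps(1)[OF A] h, folded H_def]
  have v: "valid (typed ?T (ob D ?S) (sum_join C D A (ob \<iota> A)))" "valid (typed ?U ?T ?M)"
    "valid (typed ?S ?U (ar F A (ob D A) h))"
    unfolding j m f by simp_all
  have "typed ?U (ob D ?S) (phi_hat C \<iota> D \<alpha> A) = typed ?T (ob D ?S) (sum_join C D A (ob \<iota> A)) \<star> typed ?U ?T ?M"
    unfolding phi_hat_def by (rule typed_mul[OF v(1,2)])
  also have "\<dots> = d (p1 A (ob \<iota> A)) \<star> p1 (ob D A) (ob \<iota> (ob D A))
    \<boxplus> neg (d (p2 A (ob \<iota> A)) \<star> al A \<star> p2 (ob D A) (ob \<iota> (ob D A)))"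
    unfolding j m by (simp add: mul_pls pls_mul mul_assoc)
  finally have p: "typed ?U (ob D ?S) (phi_hat C \<iota> D \<alpha> A) = \<dots>" .
  have "valid (typed ?U (ob D ?S) (phi_hat C \<iota> D \<alpha> A))" unfolding p by simp
  from typed_mul[OF this v(3)] show ?thesis
    unfolding p f by (simp add: mul_pls pls_mul mul_assoc)
qed

lemma typed_check_form:
  assumes A: "A \<in> Obj C" and h: "h \<in> Arr C A (ob E A)"
  defines "H \<equiv> typed A (ob E A) h"
  shows "typed (DSum C A (ob \<iota> A)) (ob E (DSum C A (ob \<iota> A))) (phi_check C \<iota> D \<alpha> A \<cdot> ar F A (ob E A) h)
    = I (d (p1 A (ob \<iota> A))) \<star> H \<star> p1 A (ob \<iota> A)
      \<boxplus> I (d (p2 A (ob \<iota> A))) \<star> I (al A) \<star> I H \<star> p2 A (ob \<iota> A)"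
proof -
  note [simp] = A ob_E
  have [simp]: "valid H" "src H = A" "tgt H = ob \<iota> (ob D A)" using h by (simp_all add: H_def)
  let ?E = "ob \<iota> (ob D A)" and ?G = "ob \<iota> (ob D (ob \<iota> A))"
  let ?S = "DSum C A (ob \<iota> A)" and ?T = "DSum C ?E ?G" and ?U = "DSum C ?E (ob \<iota> ?E)"
  let ?M = "matrix C ?E (ob \<iota> ?E) ?E ?G (Id C ?E) \<zero>\<^bsub>Hom C (ob \<iota> ?E) ?E\<^esub> \<zero>\<^bsub>Hom C ?E ?G\<^esub>
       (ar \<iota> ?E (ob D (ob \<iota> A)) (\<alpha> A))"
  note j = typed_sum_join[OF T.contra A I_simp(1)[OF A], unfolded map_E ob_E]
  have a: "I (al A) = typed (ob \<iota> ?E) ?G (ar \<iota> ?E (ob D (ob \<iota> A)) (\<alpha> A))"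
    using valid_al[OF A] by (simp add: fmap_def) (simp add: al_def)
  have a': "ar \<iota> ?E (ob D (ob \<iota> A)) (\<alpha> A) \<in> Arr C (ob \<iota> ?E) ?G"
    using valid_fmap[OF conj_functor, of "al A"] unfolding a by simp
  have m: "typed ?U ?T ?M = i1 ?E ?G \<star> p1 ?E (ob \<iota> ?E) \<boxplus> i2 ?E ?G \<star> I (al A) \<star> p2 ?E (ob \<iota> ?E)"
    using a' by (subst typed_diag) (simp_all add: typed_Id Id_arr a)
  note f = typed_F_ar[OF A T.contra_simps(1)[OF A] h, unfolded ob_E, folded H_def[unfolded ob_E]]
  have v: "valid (typed ?T (ob \<iota> (ob D ?S)) (sum_join C E A (ob \<iota> A)))" "valid (typed ?U ?T ?M)"
    "valid (typed ?S ?U (ar F A ?E h))"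
    unfolding j m f by simp_all
  have "typed ?U (ob \<iota> (ob D ?S)) (phi_check C \<iota> D \<alpha> A)
      = typed ?T (ob \<iota> (ob D ?S)) (sum_join C E A (ob \<iota> A)) \<star> typed ?U ?T ?M"
    unfolding phi_check_def by (rule typed_mul[OF v(1,2)])
  also have "\<dots> = I (d (p1 A (ob \<iota> A))) \<star> p1 ?E (ob \<iota> ?E)
      \<boxplus> I (d (p2 A (ob \<iota> A))) \<star> I (al A) \<star> p2 ?E (ob \<iota> ?E)"
    unfolding j m by (simp add: mul_pls pls_mul mul_assoc)
  finally have p: "typed ?U (ob \<iota> (ob D ?S)) (phi_check C \<iota> D \<alpha> A) = \<dots>" .
  have "valid (typed ?U (ob \<iota> (ob D ?S)) (phi_check C \<iota> D \<alpha> A))" unfolding p by simp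
  from typed_mul[OF this v(3)] show ?thesis
    unfolding p ob_E f by (simp add: mul_pls pls_mul mul_assoc)
qed

lemma typed_gamma_hat:
  assumes "fst X \<in> Obj C" "invertible (struct X)"
  shows "typed (ob D (fst X)) (ob E (fst X)) (gamma_hat C \<iota> D \<alpha> X)
    = arrinv (al (fst X)) \<star> d (struct X)"
  using assms
  by (intro typed_eqI) (simp_all add: ob_E raw_mul raw_inv raw_cmap raw_consts,
    simp add: gamma_hat_def case_prod_beta struct_def)

lemma typed_gamma_check:
  assumes "fst X \<in> Obj C" "invertible (struct X)"
  shows "typed (ob E (fst X)) (ob D (fst X)) (gamma_check C \<iota> D \<alpha> X)
    = d (arrinv (struct X)) \<star> al (fst X)"
  using assms
  by (intro typed_eqI) (simp_all add: ob_E raw_mul raw_inv raw_cmap raw_consts,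
    simp add: gamma_check_def case_prod_beta struct_def)

text \<open>
  The \<open>\<delta>\<^sub>\<alpha>\<close>-transpose of \<open>\<iota>(H)\<close>, computed from the \<open>\<delta>\<close>-transpose of \<open>H\<close>.
\<close>

lemma twisted_conj:
  assumes "valid H" "src H = A" "tgt H = ob D A"
  shows "I (d (I H)) \<star> eps A = I (al A) \<star> arrinv (lm (ob D A)) \<star> d H \<star> bid A"
proof -
  have [simp]: "A \<in> Obj C" using assms valid_objs(1) by blast
  note [simp] = assms
  have 1: "I (d (I H)) \<star> I (al (ob D A)) = I (al A) \<star> I (I (d H))"
    using arg_cong[OF al_natural[of H], of I] by (simp add: I_simps)
  have 2: "I (I (d H)) \<star> arrinv (lm (ob D (ob D A))) = arrinv (lm (ob D A)) \<star> d H"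
    using lm_inv_natural[of "d H"] by simp
  show ?thesis by (simp add: eps_def mul_lift[OF 1] mul_assoc mul_lift[OF 2])
qed

text \<open>
  The \<open>\<delta>\<close>-transpose of \<open>\<lambda> \<iota>(H)\<close>, computed from the \<open>\<delta>\<^sub>\<alpha>\<close>-transpose of \<open>H\<close>.
\<close>

lemma untwist:
  assumes "valid H" "src H = A" "tgt H = ob \<iota> (ob D A)"
  shows "d (lm (ob D A) \<star> I H) \<star> bid A = al A \<star> I (d H) \<star> eps A"
proof -
  have [simp]: "A \<in> Obj C" using assms valid_objs(1) by blast
  note [simp] = assms
  have 1: "al A \<star> I (d H) = d (I H) \<star> al (ob \<iota> (ob D A))"
    using al_natural[of H] by simp
  have "al (ob \<iota> (ob D A)) \<star> I (al (ob D A)) = d (lm (ob D A)) \<star> lm (ob D (ob D A))"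
    using al_lm'[of "ob D A", symmetric] by simp
  from mul_lift[OF this, of "arrinv (lm (ob D (ob D A)))"]
  have 2: "al (ob \<iota> (ob D A)) \<star> I (al (ob D A)) \<star> arrinv (lm (ob D (ob D A))) = d (lm (ob D A))"
    by (simp add: mul_assoc mul_inv)
  from mul_lift[OF this[folded mul_assoc], of "bid A"]
  have "al (ob \<iota> (ob D A)) \<star> I (al (ob D A)) \<star> arrinv (lm (ob D (ob D A))) \<star> bid A = d (lm (ob D A)) \<star> bid A"
    by (simp add: mul_assoc)
  then show ?thesis by (simp add: d_simps mul_assoc mul_lift[OF 1] eps_def)
qed

abbreviation SFhat where "SFhat \<equiv> herm_func D CC F (phi_hat C \<iota> D \<alpha>)"
abbreviation SGhat where "SGhat \<equiv> herm_func D' C G_func (gamma_hat C \<iota> D \<alpha>)"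
abbreviation SFcheck where "SFcheck \<equiv> herm_func E CC F (phi_check C \<iota> D \<alpha>)"
abbreviation SGcheck where "SGcheck \<equiv> herm_func E' C G_func (gamma_check C \<iota> D \<alpha>)"

text \<open>
  The dual of \<open>\<Lambda>\<close> moves the diagonal form to the off-diagonal entries, the one on \<open>\<iota>(A)\<close> being
  \<open>-\<iota>(h)\<close>; the other entry is its transpose by \<open>twisted_conj\<close> and the symmetry of \<open>h\<close>. The sign
  of \<open>-\<delta>\<^sub>\<alpha>\<close> comes from the entry \<open>-\<alpha>\<close> in the isomorphism attached to \<open>F\<close>.
\<close>

lemma Ghat_Fhat_hyperbolic:
  assumes "X \<in> Obj (herm_cat C D \<delta>)"
  shows "hyperbolic C E (neg_bidual C E \<epsilon>) (ob (SGhat \<circ>\<^sub>F SFhat) X)"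
proof -
  obtain A h where X: "X = (A, h)" by fastforce
  have A [simp]: "A \<in> Obj C" and sym: "symmetric_space C D \<delta> (A, h)"
    using assms by (simp_all add: X herm_cat_def symmetric_space_def)
  define H where "H = typed A (ob D A) h"
  have H [simp]: "invertible H" "src H = A" "tgt H = ob D A" "d H \<star> bid A = H"
    using sym by (simp_all add: H_def symmetric_space_typed)
  have h: "h \<in> Arr C A (ob D A)" using iso_valid[OF H(1)] by (simp add: H_def)
  let ?b = "ob \<iota> A" let ?S = "DSum C A ?b"
  note hat = typed_hat_form[OF A h, folded H_def]
  have [simp]: "fst (ob F A) \<in> Obj C" "invertible (struct (ob F A))" by (simp_all add: Fob_fst inv_str_F)
  note g = typed_gamma_hat[of "ob F A", simplified, unfolded Fob_fst]
  have f: "d (struct (ob F A)) \<star> d (p1 A ?b) = d (I (p2 A ?b)) \<star> d (lm A)"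
    "d (struct (ob F A)) \<star> d (p2 A ?b) = d (I (p1 A ?b))"
    using arg_cong[OF proj_str_F(1)[OF A], of d] arg_cong[OF proj_str_F(2)[OF A], of d]
    by (simp_all add: d_simps Fob_fst)
  have n: "arrinv (al ?S) \<star> d (I p) = I (d p) \<star> arrinv (al (tgt p))" if "valid p" "src p = ?S" for p
  proof (rule mul_left_eq[of "al ?S"])
    show "al ?S \<star> arrinv (al ?S) \<star> d (I p) = al ?S \<star> I (d p) \<star> arrinv (al (tgt p))"
      using that mul_lift[OF al_natural[of p], of "arrinv (al (tgt p))"] by (simp add: mul_assoc mul_inv)
  qed (use that in simp_all)
  note n1 = n[of "p1 A ?b", simplified] and n2 = n[of "p2 A ?b", simplified]
  let ?\<beta> = "gamma_hat C \<iota> D \<alpha> (ob F A) \<cdot> phi_hat C \<iota> D \<alpha> A \<cdot> ar F A (ob D A) h"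
  have v: "valid (typed (ob D ?S) (ob E ?S) (gamma_hat C \<iota> D \<alpha> (ob F A)))"
    "valid (typed ?S (ob D ?S) (phi_hat C \<iota> D \<alpha> A \<cdot> ar F A (ob D A) h))"
    unfolding g hat by (simp_all add: Fob_fst)
  have "typed ?S (ob E ?S) ?\<beta> = I (d (p2 A ?b)) \<star> arrinv (al ?b) \<star> d (lm A) \<star> H \<star> p1 A ?b
      \<boxplus> neg (I (d (p1 A ?b)) \<star> I H \<star> p2 A ?b)"
    unfolding typed_mul[OF v] g hat
    by (simp add: mul_pls mul_assoc mul_lift[OF f(1)] mul_lift[OF f(2)] mul_lift[OF n1] mul_lift[OF n2] Fob_fst)
  also have "arrinv (al ?b) \<star> d (lm A) \<star> H \<star> p1 A ?b = I (d (I H)) \<star> eps A \<star> p1 A ?b"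
    using mul_lift[OF twisted_conj[of H A], of "p1 A ?b"] mul_lift[OF al_lm[OF A], of "H \<star> p1 A ?b"]
    by (simp add: mul_assoc)
  finally have b: "typed ?S (ob E ?S) ?\<beta> = I (d (p1 A ?b)) \<star> neg (I H) \<star> p2 A ?b
      \<boxplus> I (d (p2 A ?b)) \<star> (I (d (neg (I H))) \<star> neg (eps A)) \<star> p1 A ?b"
    by (simp add: mul_assoc pls_comm d_simps I_simps)
  have "hyperbolic C E (neg_bidual C E \<epsilon>) (?S, ?\<beta>)"
    by (rule TN.off_diagonal_hyperbolic[of _ _ "neg (I H)"])
      (simp_all add: b map_E TN_bid, simp_all add: ob_E)
  then show ?thesis by (simp add: X func_comp_def herm_func_def G_func_def Fob_fst)
qed

text \<open>
  The form \<open>b\<^sub>0 = \<alpha>\<^bsup>-1\<^esup> D(f) h\<close> satisfies \<open>b\<^sub>0 f = -\<iota>(h)\<close>, because \<open>h\<close> is a morphism to \<open>D'(A, f)\<close>. From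
  this equation follow its symmetry for \<open>-\<delta>\<^sub>\<alpha>\<close>, its compatibility with the structure morphisms up to
  sign, and the shape of the form on \<open>F(A)\<close> as a difference.
\<close>

lemma Fcheck_Ghat_hyperbolic:
  assumes c: "c \<in> carrier k" "c \<oplus>\<^bsub>k\<^esub> c = \<one>\<^bsub>k\<^esub>"
    and X: "X \<in> Obj (herm_cat CC D' \<delta>')"
  shows "hyperbolic CC E' (neg_bidual CC E' \<epsilon>') (ob (SFcheck \<circ>\<^sub>F SGhat) X)"
proof -
  obtain Y h where Y: "X = (Y, h)" by fastforce
  define A Ft where "A = fst Y" and "Ft = struct Y"
  have YC: "Y \<in> Obj CC" and sym: "symmetric_space CC D' \<delta>' (Y, h)"
    using X by (simp_all add: Y herm_cat_def symmetric_space_def)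
  note O = double_ObjD[OF YC, folded A_def Ft_def]
  have Ft [simp]: "src Ft = ob \<iota> A" "tgt Ft = A" by (simp_all add: Ft_def A_def)
  note [simp] = O(1-3)
  define H where "H = typed A (ob D A) h"
  have H [simp]: "invertible H" "src H = A" "tgt H = ob D A" "d H \<star> bid A = H"
    and HF: "H \<star> Ft = struct (ob D' Y) \<star> I H"
    using LD.lift_symmetric[OF sym] by (simp_all add: H_def A_def Ft_def)
  define B where "B = arrinv (al A) \<star> d Ft \<star> H"
  have B [simp]: "invertible B" "src B = A" "tgt B = ob \<iota> (ob D A)" by (simp_all add: B_def)
  have HF': "H \<star> Ft = neg (arrinv (d Ft) \<star> al A \<star> I H)"
    using HF str_dual[of Y] by (simp add: mul_assoc flip: A_def Ft_def)
  have BF: "B \<star> Ft = neg (I H)"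
    by (simp add: B_def mul_assoc HF')
  have sE: "struct (ob E' Y) = I (arrinv (d Ft)) \<star> I (al A)"
    using str_twisted[OF YC] str_dual[of Y] by (simp add: I_simps flip: A_def Ft_def)
  have anti: "B \<star> Ft = neg (struct (ob E' Y) \<star> I B)"
    unfolding BF sE by (simp add: B_def I_simps mul_assoc)
  have symB: "cmap E B \<star> TN.bid A = B"
  proof -
    have 1: "I (d Ft) \<star> I (d B) = neg (I (d (I H)))"
      using arg_cong[OF BF, of "\<lambda>x. I (d x)"] by (simp add: d_simps I_simps)
    have 2: "al (ob \<iota> A) \<star> I (d Ft) = d (I Ft) \<star> al A" using al_natural[of Ft] by simp
    have 3: "d (lm A) = d (I Ft) \<star> d Ft" using O(4) by (simp flip: cmap_mul[OF contra])
    have 4: "I (d (I H)) \<star> eps A = arrinv (al (ob \<iota> A)) \<star> d (lm A) \<star> H"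
      using twisted_conj[of H A] mul_lift[OF al_lm[of A], of H] by (simp add: mul_assoc)
    have "al (ob \<iota> A) \<star> I (d Ft) \<star> cmap E B \<star> TN.bid A = al (ob \<iota> A) \<star> I (d (I H)) \<star> eps A"
      by (simp add: map_E TN_bid mul_lift[OF 1] mul_assoc)
    also have "\<dots> = d (lm A) \<star> H"
      by (simp add: 4)
    also have "\<dots> = al (ob \<iota> A) \<star> I (d Ft) \<star> B"
      unfolding 3 by (simp add: B_def mul_lift[OF 2] mul_assoc)
    finally have e: "al (ob \<iota> A) \<star> I (d Ft) \<star> cmap E B \<star> TN.bid A = al (ob \<iota> A) \<star> I (d Ft) \<star> B" .
    have "I (d Ft) \<star> cmap E B \<star> TN.bid A = I (d Ft) \<star> B"
      by (rule mul_left_eq[OF _ e]) (simp_all add: map_E TN_bid)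
    then show ?thesis
      by (rule mul_left_eq[rotated]) (simp_all add: map_E TN_bid)
  qed
  let ?b = "ob \<iota> A" let ?S = "DSum C A ?b"
  have h: "h \<in> Arr C A (ob D A)" using iso_valid[OF H(1)] by (simp add: H_def)
  note g = typed_gamma_hat[of Y, folded A_def Ft_def, simplified]
  let ?g = "gamma_hat C \<iota> D \<alpha> Y \<cdot> h"
  have vg: "valid (typed (ob D A) (ob E A) (gamma_hat C \<iota> D \<alpha> Y))" "valid (typed A (ob D A) h)"
    unfolding g using h by simp_all
  have tg: "typed A (ob E A) ?g = B"
    unfolding typed_mul[OF vg] g by (simp add: B_def H_def mul_assoc)
  then have garr: "?g \<in> Arr C A (ob E A)" using iso_valid[OF B(1)] valid_typed by metis
  note check = typed_check_form[OF O(1) garr, unfolded tg]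
  have form: "typed ?S (ob E ?S) (phi_check C \<iota> D \<alpha> A \<cdot> ar F A (ob E A) ?g)
     = I (d (p1 A ?b)) \<star> B \<star> p1 A ?b \<boxplus>
       neg (I (d (Ft \<star> p2 A ?b)) \<star> B \<star> (Ft \<star> p2 A ?b))"
  proof -
    have "I (al A) \<star> I B = I (d Ft) \<star> I H"
      by (simp add: B_def flip: fmap_mul[OF conj_functor])
    from mul_lift[OF this] mul_lift[OF BF] show ?thesis
      unfolding check by (simp add: d_simps I_simps mul_assoc)
  qed
  have "hyperbolic CC E' (neg_bidual CC E' \<epsilon>') (ob F A, phi_check C \<iota> D \<alpha> A \<cdot> ar F A (ob E A) ?g)"
    by (rule LTN.difference_hyperbolic[OF YC F_Obj[of A], of A c B])
      (use c symB anti form in \<open>simp_all add: Fob_fst str_F map_E ob_E flip: A_def Ft_def\<close>)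
  then show ?thesis by (simp add: Y func_comp_def herm_func_def G_func_def A_def)
qed

text \<open>
  The dual of \<open>\<Lambda>\<^bsup>-1\<^esup>\<close> moves the diagonal form to the off-diagonal entries, the one on \<open>\<iota>(A)\<close> being
  \<open>\<lambda> \<iota>(h)\<close>; the other entry is its transpose by \<open>untwist\<close> and the symmetry of \<open>h\<close>.
\<close>

lemma Gcheck_Fcheck_hyperbolic:
  assumes "X \<in> Obj (herm_cat C E (neg_bidual C E \<epsilon>))"
  shows "hyperbolic C D (neg_bidual C D \<delta>) (ob (SGcheck \<circ>\<^sub>F SFcheck) X)"
proof -
  obtain A h where X: "X = (A, h)" by fastforce
  have A [simp]: "A \<in> Obj C" and sym: "symmetric_space C E (neg_bidual C E \<epsilon>) (A, h)"
    using assms by (simp_all add: X herm_cat_def symmetric_space_def)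
  define H where "H = typed A (ob E A) h"
  have H [simp]: "invertible H" "src H = A" "tgt H = ob \<iota> (ob D A)"
    and Hs: "neg (I (d H) \<star> eps A) = H"
    using sym by (simp_all add: H_def TN.symmetric_space_typed ob_E) (simp_all add: TN_bid map_E ob_E)
  have h: "h \<in> Arr C A (ob E A)" using iso_valid[OF H(1)] by (simp add: H_def)
  let ?b = "ob \<iota> A" let ?S = "DSum C A ?b"
  note check = typed_check_form[OF A h, folded H_def]
  have FF [simp]: "fst (ob F A) \<in> Obj C" "invertible (struct (ob F A))" by (simp_all add: Fob_fst inv_str_F)
  note g = typed_gamma_check[of "ob F A", simplified, unfolded Fob_fst]
  have f: "I (p1 A ?b) \<star> arrinv (struct (ob F A)) = p2 A ?b"
    "I (p2 A ?b) \<star> arrinv (struct (ob F A)) = arrinv (lm A) \<star> p1 A ?b"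
    using arg_cong[OF proj_str_F(1)[OF A], of "\<lambda>x. arrinv (lm A) \<star> x \<star> arrinv (struct (ob F A))"]
     arg_cong[OF proj_str_F(2)[OF A], of "\<lambda>x. x \<star> arrinv (struct (ob F A))"]
    by (simp_all add: mul_assoc mul_inv Fob_fst)
  have df: "d (arrinv (struct (ob F A))) \<star> d (I (p1 A ?b)) = d (p2 A ?b)"
    "d (arrinv (struct (ob F A))) \<star> d (I (p2 A ?b)) = d (p1 A ?b) \<star> arrinv (d (lm A))"
    using arg_cong[OF f(1), of d] arg_cong[OF f(2), of d] by (simp_all add: d_simps Fob_fst)
  have n: "al ?S \<star> I (d (p1 A ?b)) = d (I (p1 A ?b)) \<star> al A"
    "al ?S \<star> I (d (p2 A ?b)) = d (I (p2 A ?b)) \<star> al ?b"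
    using al_natural[of "p1 A ?b"] al_natural[of "p2 A ?b"] by simp_all
  let ?\<beta> = "gamma_check C \<iota> D \<alpha> (ob F A) \<cdot> phi_check C \<iota> D \<alpha> A \<cdot> ar F A (ob E A) h"
  have v: "valid (typed (ob E ?S) (ob D ?S) (gamma_check C \<iota> D \<alpha> (ob F A)))"
    "valid (typed ?S (ob E ?S) (phi_check C \<iota> D \<alpha> A \<cdot> ar F A (ob E A) h))"
    unfolding g check by (simp_all add: Fob_fst)
  have l: "arrinv (d (lm A)) \<star> al ?b \<star> I (al A) \<star> I H \<star> p2 A ?b = lm (ob D A) \<star> I H \<star> p2 A ?b"
    using mul_lift[OF al_lm'[OF A], of "I H \<star> p2 A ?b"] by (simp add: mul_assoc)
  have "al A \<star> H = neg (d (lm (ob D A) \<star> I H) \<star> bid A)"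
    by (subst Hs[symmetric]) (simp add: untwist)
  from mul_lift[OF this, of "p1 A ?b"]
  have m: "al A \<star> H \<star> p1 A ?b = neg (d (lm (ob D A) \<star> I H) \<star> bid A \<star> p1 A ?b)"
    by (simp add: mul_assoc)
  have b: "typed ?S (ob D ?S) ?\<beta> = d (p1 A ?b) \<star> (lm (ob D A) \<star> I H) \<star> p2 A ?b
      \<boxplus> d (p2 A ?b) \<star> (d (lm (ob D A) \<star> I H) \<star> N.bid A) \<star> p1 A ?b"
    unfolding typed_mul[OF v] g check
    by (simp add: mul_pls mul_assoc mul_lift[OF n(1)] mul_lift[OF n(2)] mul_lift[OF df(1)]
        mul_lift[OF df(2)] Fob_fst l m N_bid pls_comm)
  have "hyperbolic C D (neg_bidual C D \<delta>) (?S, ?\<beta>)"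
    by (rule N.off_diagonal_hyperbolic[OF _ _ _ _ _ b]) simp_all
  then show ?thesis by (simp add: X func_comp_def herm_func_def G_func_def Fob_fst)
qed

text \<open>
  The form \<open>b\<^sub>0 = D(f)\<^bsup>-1\<^esup> \<alpha> h\<close> satisfies \<open>h f = \<iota>(b\<^sub>0)\<close>, because \<open>h\<close> is a morphism to the dual of
  \<open>(A, f)\<close>. Together with \<open>\<lambda> = f \<iota>(f)\<close> this gives \<open>\<lambda> \<iota>(h) = b\<^sub>0 f\<close>, so that the symmetry of \<open>b\<^sub>0\<close>
  follows from \<open>untwist\<close>.
\<close>

lemma Fhat_Gcheck_hyperbolic:
  assumes c: "c \<in> carrier k" "c \<oplus>\<^bsub>k\<^esub> c = \<one>\<^bsub>k\<^esub>"
    and X: "X \<in> Obj (herm_cat CC E' (neg_bidual CC E' \<epsilon>'))"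
  shows "hyperbolic CC D' (neg_bidual CC D' \<delta>') (ob (SFhat \<circ>\<^sub>F SGcheck) X)"
proof -
  obtain Y h where Y: "X = (Y, h)" by fastforce
  define A Ft where "A = fst Y" and "Ft = struct Y"
  have YC: "Y \<in> Obj CC" and sym: "symmetric_space CC E' (neg_bidual CC E' \<epsilon>') (Y, h)"
    using X by (simp_all add: Y herm_cat_def symmetric_space_def)
  note O = double_ObjD[OF YC, folded A_def Ft_def]
  have Ft [simp]: "src Ft = ob \<iota> A" "tgt Ft = A" by (simp_all add: Ft_def A_def)
  note [simp] = O(1-3)
  define H where "H = typed A (ob E A) h"
  have H [simp]: "invertible H" "src H = A" "tgt H = ob \<iota> (ob D A)"
    and Hs: "neg (I (d H) \<star> eps A) = H"
    and HF: "H \<star> Ft = struct (ob E' Y) \<star> I H"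
    using LTN.lift_symmetric[OF sym] by (simp_all add: TN_bid map_E ob_E flip: A_def Ft_def)
      (simp_all add: H_def ob_E)
  define B where "B = arrinv (d Ft) \<star> al A \<star> H"
  have B [simp]: "invertible B" "src B = A" "tgt B = ob D A" by (simp_all add: B_def)
  have sE: "struct (ob E' Y) = I (arrinv (d Ft)) \<star> I (al A)"
    using str_twisted[OF YC] str_dual[of Y] by (simp add: I_simps flip: A_def Ft_def)
  have HF': "H \<star> Ft = I B"
    unfolding HF sE by (simp add: B_def I_simps mul_assoc)
  have anti: "B \<star> Ft = neg (struct (ob D' Y) \<star> I B)"
    using str_dual[of Y] by (simp add: B_def mul_assoc HF' flip: A_def Ft_def)
  have symB: "d B \<star> N.bid A = B"
  proof -
    have "lm (ob D A) \<star> I H \<star> I Ft = B \<star> lm A"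
      using lm_natural[of B] arg_cong[OF HF', of I] by (simp add: I_simps)
    then have "(lm (ob D A) \<star> I H) \<star> I Ft = (B \<star> Ft) \<star> I Ft"
      by (simp add: mul_assoc O(4))
    then have e: "lm (ob D A) \<star> I H = B \<star> Ft"
      by (rule mul_right_eq[rotated]) simp_all
    have "d Ft \<star> d B \<star> N.bid A = neg (al A \<star> I (d H) \<star> eps A)"
      using untwist[of H A] unfolding e by (simp add: d_simps N_bid mul_assoc)
    also have "\<dots> = al A \<star> H" by (subst (2) Hs[symmetric]) simp
    also have "\<dots> = d Ft \<star> B" by (simp add: B_def)
    finally show ?thesis by (rule mul_left_eq[rotated]) (simp_all add: N_bid)
  qed
  let ?b = "ob \<iota> A" let ?S = "DSum C A ?b"
  have h: "h \<in> Arr C A (ob E A)" using iso_valid[OF H(1)] by (simp add: H_def)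
  note g = typed_gamma_check[of Y, folded A_def Ft_def, simplified]
  let ?g = "gamma_check C \<iota> D \<alpha> Y \<cdot> h"
  have vg: "valid (typed (ob E A) (ob D A) (gamma_check C \<iota> D \<alpha> Y))" "valid (typed A (ob E A) h)"
    unfolding g using h by (simp_all add: ob_E)
  have tg: "typed A (ob D A) ?g = B"
    unfolding typed_mul[OF vg] g by (simp add: B_def H_def mul_assoc d_simps)
  then have garr: "?g \<in> Arr C A (ob D A)" using iso_valid[OF B(1)] valid_typed by metis
  note hat = typed_hat_form[OF O(1) garr, unfolded tg]
  have form: "typed ?S (ob D ?S) (phi_hat C \<iota> D \<alpha> A \<cdot> ar F A (ob D A) ?g)
     = d (p1 A ?b) \<star> B \<star> p1 A ?b \<boxplus>
       neg (d (Ft \<star> p2 A ?b) \<star> B \<star> (Ft \<star> p2 A ?b))"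
  proof -
    have "d Ft \<star> B = al A \<star> H" by (simp add: B_def)
    from mul_lift[OF this] mul_lift[OF HF'] show ?thesis
      unfolding hat by (simp add: d_simps mul_assoc)
  qed
  have "hyperbolic CC D' (neg_bidual CC D' \<delta>') (ob F A, phi_hat C \<iota> D \<alpha> A \<cdot> ar F A (ob D A) ?g)"
    by (rule LN.difference_hyperbolic[OF YC F_Obj[of A], of A c B])
      (use c symB anti form in \<open>simp_all add: Fob_fst str_F flip: A_def Ft_def\<close>)
  then show ?thesis by (simp add: Y func_comp_def herm_func_def G_func_def A_def)
qed

text \<open>
  Only the first commutation axiom involves \<open>\<delta>\<close>, and there both sides change sign.
\<close>

lemma neg_commutation: "commutation C \<iota> lam D (neg_bidual C D \<delta>) \<alpha>"
proof -
  have "\<alpha> (ob D A) \<cdot> ar \<iota> A (ob D (ob D A)) (neg_bidual C D \<delta> A) =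
        ar D (ob \<iota> (ob D A)) (ob D (ob \<iota> A)) (\<alpha> A) \<cdot> neg_bidual C D \<delta> (ob \<iota> A)"
    if [simp]: "A \<in> Obj C" for A
  proof -
    have e: "al (ob D A) \<star> I (N.bid A) = d (al A) \<star> N.bid (ob \<iota> A)"
      using al_bid[of A] by (simp add: N_bid I_simps)
    have v: "valid (al (ob D A) \<star> I (N.bid A))" "valid (d (al A) \<star> N.bid (ob \<iota> A))" by simp_all
    from arg_cong[OF e, of raw] show ?thesis
      unfolding raw_mul[OF v(1)] raw_mul[OF v(2)]
      by (simp add: raw_fmap raw_cmap raw_consts) (simp add: N.bid_def)
  qed
  then show ?thesis using commutation by (simp add: commutation_def)
qed

end

text \<open>
  The double negation of \<open>\<delta>\<close> is identified with \<open>\<delta>\<close> on objects only, so the families that define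
  hermitian categories have to be replaced by families with the same values on objects.
\<close>

lemma symmetric_space_cong:
  assumes "\<And>A. A \<in> Obj C \<Longrightarrow> \<delta>1 A = \<delta>2 A"
  shows "symmetric_space C D \<delta>1 = symmetric_space C D \<delta>2"
  using assms by (auto simp: symmetric_space_def fun_eq_iff)

lemma hyperbolic_cong:
  assumes "\<And>A. A \<in> Obj C \<Longrightarrow> \<delta>1 A = \<delta>2 A"
  shows "hyperbolic C D \<delta>1 = hyperbolic C D \<delta>2"
proof -
  have "Arr (herm_cat C D \<delta>1) X (hyperbolic_space C D \<delta>1 L)
      = Arr (herm_cat C D \<delta>2) X (hyperbolic_space C D \<delta>2 L)" if "L \<in> Obj C" for X L
    using assms[OF that] by (simp add: herm_cat_def hyperbolic_space_def)
  moreover have "symmetric_space C D \<delta>1 = symmetric_space C D \<delta>2"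
    using assms by (rule symmetric_space_cong)
  ultimately show ?thesis
    by (auto simp: hyperbolic_def fun_eq_iff)
qed

lemma herm_Obj_cong:
  assumes "\<And>A. A \<in> Obj C \<Longrightarrow> \<delta>1 A = \<delta>2 A"
  shows "Obj (herm_cat C D \<delta>1) = Obj (herm_cat C D \<delta>2)"
proof -
  have "symmetric_space C D \<delta>1 = symmetric_space C D \<delta>2"
    using assms by (rule symmetric_space_cong)
  then show ?thesis by (simp add: herm_cat_def)
qed

theorem theorem3p1:
  fixes k :: "('k, 'r) ring_scheme"
    and C :: "('k, 'o, 'm) addcat"
    and \<iota> D :: "('o, 'm, 'o, 'm) func"
    and lam \<delta> \<alpha> :: "'o \<Rightarrow> 'm"
  assumes "cring k"
    and "\<one>\<^bsub>k\<^esub> \<oplus>\<^bsub>k\<^esub> \<one>\<^bsub>k\<^esub> \<in> Units k"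
    and "pseudo_abelian_category k C"
    and "conjugation k C \<iota> lam"
    and "duality k C D \<delta>"
    and "commutation C \<iota> lam D \<delta> \<alpha>"
  shows
    "let C' = double_cat C \<iota> lam;
         \<iota>' = double_conj C \<iota>;
         lam' = double_lam C \<iota> lam;
         D' = double_dual C \<iota> D \<alpha>;
         \<delta>' = double_bidual \<delta>;
         \<alpha>' = double_comm C \<iota> D \<alpha>;
         E = \<iota> \<circ>\<^sub>C D;
         \<epsilon> = twisted_bidual C \<iota> lam D \<delta> \<alpha>;
         E' = \<iota>' \<circ>\<^sub>C D';
         \<epsilon>' = twisted_bidual C' \<iota>' lam' D' \<delta>' \<alpha>';
         SFhat = herm_func D C' (F_func C \<iota> lam) (phi_hat C \<iota> D \<alpha>);
         SGhat = herm_func D' C G_func (gamma_hat C \<iota> D \<alpha>);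
         SFcheck = herm_func E C' (F_func C \<iota> lam) (phi_check C \<iota> D \<alpha>);
         SGcheck = herm_func E' C G_func (gamma_check C \<iota> D \<alpha>)
     in ob (SGhat \<circ>\<^sub>F SFhat) ` Obj (herm_cat C D \<delta>)
          \<subseteq> {X. hyperbolic C E (neg_bidual C E \<epsilon>) X} \<and>
        ob (SFcheck \<circ>\<^sub>F SGhat) ` Obj (herm_cat C' D' \<delta>')
          \<subseteq> {X. hyperbolic C' E' (neg_bidual C' E' \<epsilon>') X} \<and>
        ob (SGcheck \<circ>\<^sub>F SFcheck) ` Obj (herm_cat C E (neg_bidual C E \<epsilon>))
          \<subseteq> {X. hyperbolic C D (neg_bidual C D \<delta>) X} \<and>
        ob (SFhat \<circ>\<^sub>F SGcheck) ` Obj (herm_cat C' E' (neg_bidual C' E' \<epsilon>'))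
          \<subseteq> {X. hyperbolic C' D' (neg_bidual C' D' \<delta>') X} \<and>
        ob (SGhat \<circ>\<^sub>F SFhat) ` Obj (herm_cat C D (neg_bidual C D \<delta>))
          \<subseteq> {X. hyperbolic C E \<epsilon> X} \<and>
        ob (SFcheck \<circ>\<^sub>F SGhat) ` Obj (herm_cat C' D' (neg_bidual C' D' \<delta>'))
          \<subseteq> {X. hyperbolic C' E' \<epsilon>' X} \<and>
        ob (SGcheck \<circ>\<^sub>F SFcheck) ` Obj (herm_cat C E \<epsilon>)
          \<subseteq> {X. hyperbolic C D \<delta> X} \<and>
        ob (SFhat \<circ>\<^sub>F SGcheck) ` Obj (herm_cat C' E' \<epsilon>')
          \<subseteq> {X. hyperbolic C' D' \<delta>' X}"
proof -
  obtain c where c: "c \<in> carrier k" "c \<oplus>\<^bsub>k\<^esub> c = \<one>\<^bsub>k\<^esub>"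
  proof -
    interpret cring k by fact
    let ?t = "\<one>\<^bsub>k\<^esub> \<oplus>\<^bsub>k\<^esub> \<one>\<^bsub>k\<^esub>"
    have "inv\<^bsub>k\<^esub> ?t \<otimes>\<^bsub>k\<^esub> ?t = \<one>\<^bsub>k\<^esub>" using assms(2) by (rule Units_l_inv)
    moreover have "inv\<^bsub>k\<^esub> ?t \<in> carrier k" using assms(2) by simp
    ultimately show ?thesis using that[of "inv\<^bsub>k\<^esub> ?t"] by (simp add: r_distr)
  qed
  interpret additive_category k C
    using assms(3) by (simp add: pseudo_abelian_category_def)
  interpret octagon k C D \<delta> \<iota> lam \<alpha>
    by unfold_locales (fact assms)+
  \<comment> \<open>The octagon of \<open>(D, -\<delta>)\<close>; its first half is the second half of the given one.\<close>
  interpret M: octagon k C D "neg_bidual C D \<delta>" \<iota> lam \<alpha>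
    by unfold_locales (fact neg_commutation)
  have D: "neg_bidual C D (neg_bidual C D \<delta>) A = \<delta> A" if A: "A \<in> Obj C" for A
  proof -
    have "typed A (ob D (ob D A)) (neg_bidual C D (neg_bidual C D \<delta>) A) = bid A"
      using A by (simp add: N.typed_neg_bidual N_bid)
    then show ?thesis by (simp add: bid_def)
  qed
  have E: "neg_bidual C E M.\<epsilon> A = \<epsilon> A" if A: "A \<in> Obj C" for A
  proof -
    have "M.eps A = neg (eps A)"
      using A by (simp add: M.eps_def eps_def N_bid)
    then have "typed A (ob E (ob E A)) (neg_bidual C E M.\<epsilon> A) = typed A (ob E (ob E A)) (\<epsilon> A)"
      using A by (simp add: M.T.typed_neg_bidual M.T_bid typed_eps)
    then show ?thesis by simp
  qed
  have D': "double_bidual (neg_bidual C D \<delta>) X = neg_bidual CC D' \<delta>' X" if "X \<in> Obj CC" for X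
    using neg_bidual_dual[OF that] by (simp add: double_bidual_def case_prod_beta)
  have D'': "neg_bidual CC D' (double_bidual (neg_bidual C D \<delta>)) X = \<delta>' X" if "X \<in> Obj CC" for X
    using M.neg_bidual_dual[OF that] D double_ObjD(1)[OF that]
    by (simp add: double_bidual_def case_prod_beta)
  have E': "neg_bidual CC E' M.\<epsilon>' X = \<epsilon>' X" if "X \<in> Obj CC" for X
    using M.neg_bidual_twisted[OF that] E double_ObjD(1)[OF that] twisted_lift[OF that] by simp
  note half = Ghat_Fhat_hyperbolic Fcheck_Ghat_hyperbolic[OF c] Gcheck_Fcheck_hyperbolic
    Fhat_Gcheck_hyperbolic[OF c]
  have targets: "hyperbolic C E (neg_bidual C E M.\<epsilon>) = hyperbolic C E \<epsilon>"
    "hyperbolic CC E' (neg_bidual CC E' M.\<epsilon>') = hyperbolic CC E' \<epsilon>'"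
    "hyperbolic C D (neg_bidual C D (neg_bidual C D \<delta>)) = hyperbolic C D \<delta>"
    "hyperbolic CC D' (neg_bidual CC D' (double_bidual (neg_bidual C D \<delta>))) = hyperbolic CC D' \<delta>'"
    by (rule hyperbolic_cong; simp add: D E D'' E')+
  have sources: "Obj (herm_cat CC D' (double_bidual (neg_bidual C D \<delta>)))
      = Obj (herm_cat CC D' (neg_bidual CC D' \<delta>'))"
    "Obj (herm_cat C E (neg_bidual C E M.\<epsilon>)) = Obj (herm_cat C E \<epsilon>)"
    "Obj (herm_cat CC E' (neg_bidual CC E' M.\<epsilon>')) = Obj (herm_cat CC E' \<epsilon>')"
    by (rule herm_Obj_cong; simp add: D' E E')+
  note other_half = M.Ghat_Fhat_hyperbolic M.Fcheck_Ghat_hyperbolic[OF c]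
    M.Gcheck_Fcheck_hyperbolic M.Fhat_Gcheck_hyperbolic[OF c]
  show ?thesis
    unfolding Let_def image_subset_iff mem_Collect_eq
    by (intro conjI ballI) (fact half other_half[unfolded targets sources])+
qed

end
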